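(* Let $q_0$ be a prime with $q_0\equiv1\pmod4$, let $q=q_0^{2^l}$ with $l\ge0$, and let $n\ge3$. Then the centric linking system (at the prime $2$) of $\mathrm{P}\Omega^-_{2n}(q)$ has a noninner rigid automorphism induced by a reflection in an anisotropic vector.
   Context: Let $V$ be a $2n$-dimensional vector space over $\mathbb F_q$ with a nondegenerate quadratic form of Witt index $n-1$ and associated bilinear form $\beta$; $O(V)$ is its isometry group, $\Omega(V)=\Omega^-_{2n}(q)$ the commutator subgroup of $O(V)$, and $\mathrm{P}\Omega^-_{2n}(q)$ its image modulo scalars (here $\mathrm{P}\Omega^-_{2n}(q)=\Omega^-_{2n}(q)$). A vector $w$ is anisotropic if $\beta(w,w)\ne0$; $r_w\in O(V)$ is the orthogonal reflection in the hyperplane $w^\perp$, and conjugation $c_{r_w}$ by $r_w$ gives an automorphism of $\mathrm{P}\Omega^-_{2n}(q)$. For a finite group $H$ with $R\in\mathrm{Syl}_2(H)$: a $2$-subgroup $P$ is $2$-centric if $Z(P)\in\mathrm{Syl}_2(C_H(P))$. The centric linking system $\mathcal L=\mathcal L_R^c(H)$ has as objects the $2$-centric subgroups $P\le R$ of $H$, with $\mathrm{Mor}_{\mathcal L}(P,Q)=\{g\in H:gPg^{-1}\le Q\}/O_{2'}(C_H(P))$; $\delta_{P,Q}(g)$ is the class of $g\in R$ (when $gPg^{-1}\le Q$), $\delta_P=\delta_{P,P}$, and $\pi$ sends the class of $g$ to conjugation by $g$. An automorphism of $\mathcal L$ is a self-equivalence $\alpha$ with $\alpha(\delta_P(P))=\delta_{\alpha(P)}(\alpha(P))$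 and $\alpha(\delta_{P,Q}(1))=\delta_{\alpha(P),\alpha(Q)}(1)$ for $P\le Q$. It is rigid if $\alpha_R\circ\delta_R=\delta_R$; it is inner if it is conjugation by some $\gamma\in\mathrm{Aut}_{\mathcal L}(R)$ (sending $P\mapsto\pi(\gamma)(P)$ and $\psi:P\to Q$ to $\gamma|_Q\circ\psi\circ(\gamma|_P)^{-1}$, where $\gamma|_P:P\to\pi(\gamma)(P)$ is the restriction of $\gamma$). $\mathrm{Out}(\mathcal L)$ is $\mathrm{Aut}(\mathcal L)$ modulo inner automorphisms. $\kappa_H:\mathrm{Out}(H)\to\mathrm{Out}(\mathcal L)$ sends the class of $\alpha\in\mathrm{Aut}(H)$ with $\alpha(R)=R$ to the class of the automorphism $P\mapsto\alpha(P)$, $gO_{2'}(C_H(P))\mapsto\alpha(g)O_{2'}(C_H(\alpha(P)))$. An automorphism of $\mathcal L$ is induced by $r_w$ if its class in $\mathrm{Out}(\mathcal L)$ is $\kappa_H([c_{r_w}])$ with $H=\mathrm{P}\Omega^-_{2n}(q)$. *)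

theory Defs
  imports
    "HOL.Vector_Spaces"
    "HOL-Algebra.Bij"
    "HOL-Algebra.Coset"
    "HOL-Algebra.Generated_Groups"
    "HOL-Computational_Algebra.Primes"
begin

definition centralizer :: "('h, 'm) monoid_scheme \<Rightarrow> 'h set \<Rightarrow> 'h set" where
  "centralizer H P = {g \<in> carrier H. \<forall>x\<in>P. g \<otimes>\<^bsub>H\<^esub> x = x \<otimes>\<^bsub>H\<^esub> g}"

definition center_of :: "('h, 'm) monoid_scheme \<Rightarrow> 'h set \<Rightarrow> 'h set" where
  "center_of H P = P \<inter> centralizer H P"

definition Syl :: "nat \<Rightarrow> ('h, 'm) monoid_scheme \<Rightarrow> 'h set set" where
  "Syl p H = {P. subgroup P H \<and> card P = p ^ multiplicity p (order H)}"

text \<open>The largest normal subgroup of odd order of a finite group, written as the subgroup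
  generated by all normal subgroups of odd order.\<close>

definition odd_core :: "('h, 'm) monoid_scheme \<Rightarrow> 'h set" where
  "odd_core H = generate H (\<Union>{N. N \<lhd> H \<and> odd (card N)})"

definition conj_set :: "('h, 'm) monoid_scheme \<Rightarrow> 'h \<Rightarrow> 'h set \<Rightarrow> 'h set" where
  "conj_set H g P = (\<lambda>x. g \<otimes>\<^bsub>H\<^esub> x \<otimes>\<^bsub>H\<^esub> inv\<^bsub>H\<^esub> g) ` P"

definition Inn :: "('h, 'm) monoid_scheme \<Rightarrow> ('h \<Rightarrow> 'h) set" where
  "Inn H = (\<lambda>g. \<lambda>x\<in>carrier H. g \<otimes>\<^bsub>H\<^esub> x \<otimes>\<^bsub>H\<^esub> inv\<^bsub>H\<^esub> g) ` carrier H"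

definition Out :: "('h, 'm) monoid_scheme \<Rightarrow> ('h \<Rightarrow> 'h) set monoid" where
  "Out H = AutoGroup H Mod Inn H"

definition Out_class :: "('h, 'm) monoid_scheme \<Rightarrow> ('h \<Rightarrow> 'h) \<Rightarrow> ('h \<Rightarrow> 'h) set" where
  "Out_class H a = Inn H #>\<^bsub>AutoGroup H\<^esub> a"

text \<open>The composite of \<open>f \<in> Mor X Y\<close> and \<open>g \<in> Mor Y Z\<close> is \<open>Comp g f \<in> Mor X Z\<close>.
  A functor is a pair (object map, morphism map); both maps are required to be extensional, so
  that equality of functors is equality of pairs.\<close>

record ('o, 'a) small_category =
  Obj :: "'o set"
  Mor :: "'o \<Rightarrow> 'o \<Rightarrow> 'a set"
  Ident :: "'o \<Rightarrow> 'a"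
  Comp :: "'a \<Rightarrow> 'a \<Rightarrow> 'a"

definition Arr :: "('o, 'a) small_category \<Rightarrow> 'a set" where
  "Arr C = (\<Union>X\<in>Obj C. \<Union>Y\<in>Obj C. Mor C X Y)"

definition inverse_pair ::
    "('o, 'a) small_category \<Rightarrow> 'o \<Rightarrow> 'o \<Rightarrow> 'a \<Rightarrow> 'a \<Rightarrow> bool" where
  "inverse_pair C X Y f g \<longleftrightarrow>
     f \<in> Mor C X Y \<and> g \<in> Mor C Y X \<and> Comp C g f = Ident C X \<and> Comp C f g = Ident C Y"

type_synonym ('o, 'a) functor_maps = "('o \<Rightarrow> 'o) \<times> ('a \<Rightarrow> 'a)"

definition endofunctor :: "('o, 'a) small_category \<Rightarrow> ('o, 'a) functor_maps \<Rightarrow> bool" where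
  "endofunctor C F \<longleftrightarrow>
     fst F \<in> extensional (Obj C) \<and> snd F \<in> extensional (Arr C) \<and>
     (\<forall>X\<in>Obj C. fst F X \<in> Obj C) \<and>
     (\<forall>X\<in>Obj C. \<forall>Y\<in>Obj C. \<forall>f\<in>Mor C X Y. snd F f \<in> Mor C (fst F X) (fst F Y)) \<and>
     (\<forall>X\<in>Obj C. snd F (Ident C X) = Ident C (fst F X)) \<and>
     (\<forall>X\<in>Obj C. \<forall>Y\<in>Obj C. \<forall>Z\<in>Obj C. \<forall>f\<in>Mor C X Y. \<forall>g\<in>Mor C Y Z.
        snd F (Comp C g f) = Comp C (snd F g) (snd F f))"

definition id_functor :: "('o, 'a) small_category \<Rightarrow> ('o, 'a) functor_maps" where
  "id_functor C = (\<lambda>X\<in>Obj C. X, \<lambda>f\<in>Arr C. f)"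

definition comp_functor ::
    "('o, 'a) small_category \<Rightarrow> ('o, 'a) functor_maps \<Rightarrow> ('o, 'a) functor_maps \<Rightarrow>
      ('o, 'a) functor_maps" where
  "comp_functor C G F = (compose (Obj C) (fst G) (fst F), compose (Arr C) (snd G) (snd F))"

definition naturally_isomorphic ::
    "('o, 'a) small_category \<Rightarrow> ('o, 'a) functor_maps \<Rightarrow> ('o, 'a) functor_maps \<Rightarrow> bool" where
  "naturally_isomorphic C F G \<longleftrightarrow>
     (\<exists>t. (\<forall>X\<in>Obj C. \<exists>u. inverse_pair C (fst F X) (fst G X) (t X) u) \<and>
          (\<forall>X\<in>Obj C. \<forall>Y\<in>Obj C. \<forall>f\<in>Mor C X Y.
             Comp C (t Y) (snd F f) = Comp C (snd G f) (t X)))"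

definition self_equivalence :: "('o, 'a) small_category \<Rightarrow> ('o, 'a) functor_maps \<Rightarrow> bool" where
  "self_equivalence C F \<longleftrightarrow> endofunctor C F \<and>
     (\<exists>G. endofunctor C G \<and>
          naturally_isomorphic C (comp_functor C G F) (id_functor C) \<and>
          naturally_isomorphic C (comp_functor C F G) (id_functor C))"

definition two_centric :: "('h, 'm) monoid_scheme \<Rightarrow> 'h set \<Rightarrow> bool" where
  "two_centric H P \<longleftrightarrow> subgroup P H \<and> (\<exists>k. card P = 2 ^ k) \<and>
     center_of H P \<in> Syl 2 (H\<lparr>carrier := centralizer H P\<rparr>)"

definition odd_core_centralizer :: "('h, 'm) monoid_scheme \<Rightarrow> 'h set \<Rightarrow> 'h set" where
  "odd_core_centralizer H P = odd_core (H\<lparr>carrier := centralizer H P\<rparr>)"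

text \<open>A morphism is a triple (source, target, coset): the same coset
  \<open>g O\<^sub>2\<^sub>'(C\<^sub>H(P))\<close> represents different morphisms for different targets.\<close>

type_synonym 'h link_mor = "'h set \<times> 'h set \<times> 'h set"

definition link_class :: "('h, 'm) monoid_scheme \<Rightarrow> 'h set \<Rightarrow> 'h set \<Rightarrow> 'h \<Rightarrow> 'h link_mor" where
  "link_class H P Q g = (P, Q, g <#\<^bsub>H\<^esub> odd_core_centralizer H P)"

text \<open>Composition is induced by multiplication of representatives. It is written as the product of
  cosets: if \<open>P\<close> is 2-centric and \<open>g P g\<inverse> \<subseteq> Q\<close>, then
  \<open>g\<inverse> O\<^sub>2\<^sub>'(C\<^sub>H(Q)) g \<subseteq> O\<^sub>2\<^sub>'(C\<^sub>H(P))\<close>, so the product of the sets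
  \<open>h O\<^sub>2\<^sub>'(C\<^sub>H(Q))\<close> and \<open>g O\<^sub>2\<^sub>'(C\<^sub>H(P))\<close> is \<open>hg O\<^sub>2\<^sub>'(C\<^sub>H(P))\<close>.\<close>

definition linking_system ::
    "('h, 'm) monoid_scheme \<Rightarrow> 'h set \<Rightarrow> ('h set, 'h link_mor) small_category" where
  "linking_system H R =
     \<lparr>Obj = {P. P \<subseteq> R \<and> two_centric H P},
      Mor = (\<lambda>P Q. link_class H P Q ` {g \<in> carrier H. conj_set H g P \<subseteq> Q}),
      Ident = (\<lambda>P. link_class H P P \<one>\<^bsub>H\<^esub>),
      Comp = (\<lambda>\<psi> \<phi>. (fst \<phi>, fst (snd \<psi>), snd (snd \<psi>) <#>\<^bsub>H\<^esub> snd (snd \<phi>)))\<rparr>"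

text \<open>\<open>\<delta>\<^sub>P\<^sub>,\<^sub>Q\<close> is \<open>link_class H P Q\<close>, applied to elements of \<open>R\<close>.\<close>

definition link_proj :: "('h, 'm) monoid_scheme \<Rightarrow> 'h link_mor \<Rightarrow> 'h \<Rightarrow> 'h" where
  "link_proj H \<phi> =
     (\<lambda>x\<in>fst \<phi>. the_elem ((\<lambda>g. g \<otimes>\<^bsub>H\<^esub> x \<otimes>\<^bsub>H\<^esub> inv\<^bsub>H\<^esub> g) ` snd (snd \<phi>)))"

definition link_automorphism ::
    "('h, 'm) monoid_scheme \<Rightarrow> 'h set \<Rightarrow> ('h set, 'h link_mor) functor_maps \<Rightarrow> bool" where
  "link_automorphism H R \<alpha> \<longleftrightarrow> self_equivalence (linking_system H R) \<alpha> \<and>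
     (\<forall>P\<in>Obj (linking_system H R).
        snd \<alpha> ` (link_class H P P ` P) = link_class H (fst \<alpha> P) (fst \<alpha> P) ` (fst \<alpha> P)) \<and>
     (\<forall>P\<in>Obj (linking_system H R). \<forall>Q\<in>Obj (linking_system H R). P \<subseteq> Q \<longrightarrow>
        snd \<alpha> (link_class H P Q \<one>\<^bsub>H\<^esub>) = link_class H (fst \<alpha> P) (fst \<alpha> Q) \<one>\<^bsub>H\<^esub>)"

definition Aut_link ::
    "('h, 'm) monoid_scheme \<Rightarrow> 'h set \<Rightarrow> ('h set, 'h link_mor) functor_maps monoid" where
  "Aut_link H R =
     \<lparr>carrier = {\<alpha>. link_automorphism H R \<alpha>},
      monoid.mult = comp_functor (linking_system H R),
      one = id_functor (linking_system H R)\<rparr>"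

definition rigid :: "('h, 'm) monoid_scheme \<Rightarrow> 'h set \<Rightarrow> ('h set, 'h link_mor) functor_maps \<Rightarrow> bool"
  where "rigid H R \<alpha> \<longleftrightarrow> (\<forall>g\<in>R. snd \<alpha> (link_class H R R g) = link_class H R R g)"

text \<open>For \<open>\<gamma> \<in> Aut\<^sub>\<L>(R)\<close> and an object \<open>P\<close>, the restriction of \<open>\<gamma>\<close> is the morphism from \<open>P\<close>
  to \<open>\<pi>(\<gamma>)(P)\<close> that commutes with \<open>\<gamma>\<close> and the inclusions \<open>\<delta>(1)\<close> into \<open>R\<close>.\<close>

definition link_restrict ::
    "('h, 'm) monoid_scheme \<Rightarrow> 'h set \<Rightarrow> 'h link_mor \<Rightarrow> 'h set \<Rightarrow> 'h link_mor" where
  "link_restrict H R \<gamma> P =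
     (THE \<phi>. \<phi> \<in> Mor (linking_system H R) P (link_proj H \<gamma> ` P) \<and>
        Comp (linking_system H R) (link_class H (link_proj H \<gamma> ` P) R \<one>\<^bsub>H\<^esub>) \<phi> =
        Comp (linking_system H R) \<gamma> (link_class H P R \<one>\<^bsub>H\<^esub>))"

definition link_conj ::
    "('h, 'm) monoid_scheme \<Rightarrow> 'h set \<Rightarrow> 'h link_mor \<Rightarrow> ('h set, 'h link_mor) functor_maps" where
  "link_conj H R \<gamma> =
     (let L = linking_system H R in
      (\<lambda>P\<in>Obj L. link_proj H \<gamma> ` P,
       \<lambda>\<psi>\<in>Arr L. let P = fst \<psi>; Q = fst (snd \<psi>);
            r = THE r. inverse_pair L P (link_proj H \<gamma> ` P) (link_restrict H R \<gamma> P) r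
          in Comp L (link_restrict H R \<gamma> Q) (Comp L \<psi> r)))"

definition Inn_link ::
    "('h, 'm) monoid_scheme \<Rightarrow> 'h set \<Rightarrow> ('h set, 'h link_mor) functor_maps set" where
  "Inn_link H R = link_conj H R ` Mor (linking_system H R) R R"

definition Out_link ::
    "('h, 'm) monoid_scheme \<Rightarrow> 'h set \<Rightarrow> ('h set, 'h link_mor) functor_maps set monoid" where
  "Out_link H R = Aut_link H R Mod Inn_link H R"

definition Out_link_class ::
    "('h, 'm) monoid_scheme \<Rightarrow> 'h set \<Rightarrow> ('h set, 'h link_mor) functor_maps \<Rightarrow>
      ('h set, 'h link_mor) functor_maps set" where
  "Out_link_class H R \<alpha> = Inn_link H R #>\<^bsub>Aut_link H R\<^esub> \<alpha>"

text \<open>An automorphism \<open>a\<close> of \<open>H\<close> maps the coset \<open>g O\<^sub>2\<^sub>'(C\<^sub>H(P))\<close> onto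
  \<open>a(g) O\<^sub>2\<^sub>'(C\<^sub>H(a(P)))\<close>, so its action on cosets is the image of sets.\<close>

definition induced_link ::
    "('h, 'm) monoid_scheme \<Rightarrow> 'h set \<Rightarrow> ('h \<Rightarrow> 'h) \<Rightarrow> ('h set, 'h link_mor) functor_maps" where
  "induced_link H R a =
     (\<lambda>P\<in>Obj (linking_system H R). a ` P,
      \<lambda>\<psi>\<in>Arr (linking_system H R). (a ` fst \<psi>, a ` fst (snd \<psi>), a ` snd (snd \<psi>)))"

text \<open>\<open>\<kappa>\<^sub>H\<close>: by Sylow's theorem each class \<open>c\<close> in \<open>Out H\<close> has representatives that normalize \<open>R\<close>,
  and they all give the same class of automorphisms of the linking system.\<close>

definition kappa ::
    "('h, 'm) monoid_scheme \<Rightarrow> 'h set \<Rightarrow> ('h \<Rightarrow> 'h) set \<Rightarrow>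
      ('h set, 'h link_mor) functor_maps set" where
  "kappa H R c =
     the_elem ((\<lambda>a. Out_link_class H R (induced_link H R a)) ` {a \<in> c. a ` R = R})"

definition polar :: "('v::ab_group_add \<Rightarrow> 'k::field) \<Rightarrow> 'v \<Rightarrow> 'v \<Rightarrow> 'k" where
  "polar Q u v = Q (u + v) - Q u - Q v"

definition quadratic_form ::
    "('k::field \<Rightarrow> 'v::ab_group_add \<Rightarrow> 'v) \<Rightarrow> ('v \<Rightarrow> 'k) \<Rightarrow> bool" where
  "quadratic_form scale Q \<longleftrightarrow>
     (\<forall>c v. Q (scale c v) = c ^ 2 * Q v) \<and>
     (\<forall>u. Vector_Spaces.linear scale (*) (\<lambda>v. polar Q u v)) \<and>
     (\<forall>v. Vector_Spaces.linear scale (*) (\<lambda>u. polar Q u v))"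

definition nondegenerate :: "('v::ab_group_add \<Rightarrow> 'k::field) \<Rightarrow> bool" where
  "nondegenerate Q \<longleftrightarrow> (\<forall>u. (\<forall>v. polar Q u v = 0) \<longrightarrow> u = 0)"

definition witt_index ::
    "('k::field \<Rightarrow> 'v::ab_group_add \<Rightarrow> 'v) \<Rightarrow> ('v \<Rightarrow> 'k) \<Rightarrow> nat" where
  "witt_index scale Q =
     Max {vector_space.dim scale W |W. module.subspace scale W \<and> (\<forall>w\<in>W. Q w = 0)}"

definition anisotropic :: "('v::ab_group_add \<Rightarrow> 'k::field) \<Rightarrow> 'v \<Rightarrow> bool" where
  "anisotropic Q w \<longleftrightarrow> polar Q w w \<noteq> 0"

definition reflection ::
    "('k::field \<Rightarrow> 'v::ab_group_add \<Rightarrow> 'v) \<Rightarrow> ('v \<Rightarrow> 'k) \<Rightarrow> 'v \<Rightarrow> 'v \<Rightarrow> 'v" where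
  "reflection scale Q w v = v - scale (2 * polar Q v w / polar Q w w) w"

definition O_group ::
    "('k::field \<Rightarrow> 'v::ab_group_add \<Rightarrow> 'v) \<Rightarrow> ('v \<Rightarrow> 'k) \<Rightarrow> ('v \<Rightarrow> 'v) monoid" where
  "O_group scale Q = (BijGroup UNIV)
     \<lparr>carrier := {g. Vector_Spaces.linear scale scale g \<and> bij g \<and> (\<forall>v. Q (g v) = Q v)}\<rparr>"

definition Omega ::
    "('k::field \<Rightarrow> 'v::ab_group_add \<Rightarrow> 'v) \<Rightarrow> ('v \<Rightarrow> 'k) \<Rightarrow> ('v \<Rightarrow> 'v) set" where
  "Omega scale Q = derived (O_group scale Q) (carrier (O_group scale Q))"

definition O_scalars ::
    "('k::field \<Rightarrow> 'v::ab_group_add \<Rightarrow> 'v) \<Rightarrow> ('v \<Rightarrow> 'k) \<Rightarrow> ('v \<Rightarrow> 'v) set" where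
  "O_scalars scale Q = carrier (O_group scale Q) \<inter> range scale"

definition PO_group ::
    "('k::field \<Rightarrow> 'v::ab_group_add \<Rightarrow> 'v) \<Rightarrow> ('v \<Rightarrow> 'k) \<Rightarrow> ('v \<Rightarrow> 'v) set monoid" where
  "PO_group scale Q = O_group scale Q Mod O_scalars scale Q"

definition PO_class ::
    "('k::field \<Rightarrow> 'v::ab_group_add \<Rightarrow> 'v) \<Rightarrow> ('v \<Rightarrow> 'k) \<Rightarrow> ('v \<Rightarrow> 'v) \<Rightarrow> ('v \<Rightarrow> 'v) set" where
  "PO_class scale Q g = O_scalars scale Q #>\<^bsub>O_group scale Q\<^esub> g"

text \<open>The image of \<open>\<Omega>(V)\<close> in \<open>O(V)\<close> modulo scalars, so that the image of a reflection,
  which lies outside it, still acts on it by conjugation.\<close>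

definition POmega ::
    "('k::field \<Rightarrow> 'v::ab_group_add \<Rightarrow> 'v) \<Rightarrow> ('v \<Rightarrow> 'k) \<Rightarrow> ('v \<Rightarrow> 'v) set monoid" where
  "POmega scale Q = (PO_group scale Q)\<lparr>carrier := PO_class scale Q ` Omega scale Q\<rparr>"

definition reflection_aut ::
    "('k::field \<Rightarrow> 'v::ab_group_add \<Rightarrow> 'v) \<Rightarrow> ('v \<Rightarrow> 'k) \<Rightarrow> 'v \<Rightarrow> ('v \<Rightarrow> 'v) set \<Rightarrow> ('v \<Rightarrow> 'v) set"
  where
  "reflection_aut scale Q w =
     (\<lambda>X\<in>carrier (POmega scale Q).
        PO_class scale Q (reflection scale Q w) \<otimes>\<^bsub>PO_group scale Q\<^esub> X
          \<otimes>\<^bsub>PO_group scale Q\<^esub> inv\<^bsub>PO_group scale Q\<^esub> (PO_class scale Q (reflection scale Q w)))"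

definition induced_by_reflection ::
    "('k::field \<Rightarrow> 'v::ab_group_add \<Rightarrow> 'v) \<Rightarrow> ('v \<Rightarrow> 'k) \<Rightarrow> ('v \<Rightarrow> 'v) set set \<Rightarrow> 'v \<Rightarrow>
      (('v \<Rightarrow> 'v) set set, ('v \<Rightarrow> 'v) set link_mor) functor_maps \<Rightarrow> bool" where
  "induced_by_reflection scale Q R w \<alpha> \<longleftrightarrow>
     Out_link_class (POmega scale Q) R \<alpha> =
     kappa (POmega scale Q) R (Out_class (POmega scale Q) (reflection_aut scale Q w))"

end

theory Submission
  imports
    Defs
    "Jordan_Normal_Form.Determinant"
    "HOL-Combinatorics.Transposition"
    "HOL-Algebra.Sylow"
    "HOL-Algebra.Group_Action"
    "HOL-Algebra.Multiplicative_Group"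
begin

text \<open>As \<open>-1\<close> is a square in the field and the Witt index is \<open>n - 1\<close>, every \<open>a \<noteq> 0\<close> admits
  an orthogonal basis \<open>b\<close> with \<open>Q(b\<^sub>i) = a\<close> for all \<open>i\<close> but the last, whose norm lies in the other square
  class. The products of two reflections in basis vectors of norm \<open>a\<close> lie in \<open>\<Omega>(V)\<close>, and an isometry
  that commutes with all of them, even only up to sign, is diagonal. So their centralizer \<open>P(b)\<close> in
  \<open>H = P\<Omega>(V)\<close> is an elementary abelian self-centralizing 2-group, and its normalizer contains
  3-cycles of basis vectors of norm \<open>a\<close>.

  After conjugation, \<open>P(b) \<le> R\<close>. As \<open>P(b)\<close> fixes just one line spanned by a vector of norm
  \<open>Q(w)\<close>, where \<open>w\<close> is the last vector of \<open>b\<close>, a count of fixed points modulo 2 shows that \<open>R\<close> fixes the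
  line of \<open>w\<close>. Hence \<open>r\<^sub>w\<close> centralizes \<open>R\<close> and induces a rigid automorphism of the linking system.

  If it were conjugation by \<open>g\<close>, then \<open>g\<close> would centralize \<open>R\<close>, and \<open>t = g\<inverse> r\<^sub>w\<close> would commute with the
  normalizers of \<open>P(b)\<close> and \<open>P(b')\<close>, where \<open>b\<close> belongs to \<open>a = 1\<close> and \<open>b'\<close> to \<open>a = Q(w)\<close>. The first
  condition leaves \<open>t = \<plusminus>1\<close> or \<open>t = \<plusminus>r\<^sub>w\<close>; the second excludes \<open>\<plusminus>r\<^sub>w\<close>; and \<open>t = \<plusminus>1\<close> would put
  \<open>\<plusminus>r\<^sub>w\<close>, which has determinant \<open>-1\<close>, into \<open>\<Omega>(V)\<close>.\<close>

section \<open>Finite groups\<close>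

text \<open>Two bases are needed because \<open>b\<close> cannot detect \<open>r w\<close>: this
  reflection fixes every vector that the 3-cycles of \<open>b\<close> move, and the 3-cycles fix
  \<open>w\<close>, so they commute. In \<open>b'\<close> the permuted vectors have the norm of
  \<open>w\<close>, and \<open>r w\<close> acts on them neither as 1 nor as -1.

  A square root of -1 produces the exceptional square class: among 2n orthogonal vectors of equal
  norm, each of n disjoint pairs would span a plane with a singular vector, and the Witt index would
  be n. The bound \<open>n >= 3\<close> leaves three vectors of norm \<open>a\<close> outside any
  pair, which excludes isometries that commute with the double reflections only up to sign.

  For linking systems the obstacle is that morphisms are cosets of a subgroup defined by generators.
  For a 2-centric \<open>P\<close> the transfer identifies it with the set of elements of odd order
  in the centralizer of \<open>P\<close>. In this form it is compatible with automorphisms and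
  conjugation, and it is trivial for the self-centralizing 2-groups used here, so that equality of
  morphisms on them is equality of group elements.\<close>

lemma power_of_two_if_prime_divisors:
  fixes n :: nat
  assumes "n > 0" "\<And>p. prime p \<Longrightarrow> p dvd n \<Longrightarrow> p = 2"
  shows "\<exists>k. n = 2 ^ k"
proof -
  obtain m where m: "n = 2 ^ multiplicity 2 n * m" "\<not> 2 dvd m"
    using multiplicity_decompose'[of n 2] assms(1) by auto
  have "m = 1"
  proof (rule ccontr)
    assume "m \<noteq> 1"
    then obtain p where "prime p" "p dvd m"
      using prime_factor_nat by blast
    then have "p = 2"
      using assms(2) m(1) by (metis dvd_mult)
    with \<open>p dvd m\<close> m(2) show False by simp
  qed
  with m(1) show ?thesis by auto
qed

context group
begin

lemma eq_one_if_coprime_pow_eq_one: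
  assumes "x \<in> carrier G" "x [^] (m::nat) = \<one>" "x [^] (n::nat) = \<one>" "coprime m n"
  shows "x = \<one>"
proof -
  have "ord x dvd m" "ord x dvd n"
    using assms pow_eq_id by auto
  with assms(4) have "ord x = 1"
    using coprime_common_divisor_nat by blast
  then show ?thesis
    using assms(1) ord_eq_1 by simp
qed

lemma subgroup_pow_card:
  assumes "subgroup P G" "x \<in> P"
  shows "x [^] card P = \<one>"
proof -
  interpret P: group "G\<lparr>carrier := P\<rparr>"
    using assms(1) subgroup_imp_group by blast
  have "x [^]\<^bsub>G\<lparr>carrier := P\<rparr>\<^esub> Coset.order (G\<lparr>carrier := P\<rparr>) = \<one>\<^bsub>G\<lparr>carrier := P\<rparr>\<^esub>"
    using P.pow_order_eq_1 assms(2) by simp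
  then show ?thesis
    by (simp add: Coset.order_def nat_pow_consistent[symmetric])
qed

lemma card_subgroup_dvd: "subgroup H G \<Longrightarrow> card H dvd Coset.order G"
  unfolding lagrange[symmetric] by simp

lemma Cauchy:
  assumes "finite (carrier G)" "prime p" "p dvd Coset.order G"
  shows "\<exists>x\<in>carrier G. x \<noteq> \<one> \<and> x [^] p = \<one>"
proof -
  \<comment> \<open>\<open>sylow_thm\<close> applies to every power of \<open>p\<close> that divides
    the order; exponent 1 gives a subgroup of order \<open>p\<close>.\<close>
  obtain m where "Coset.order G = p ^ 1 * m"
    using assms(3) by (auto elim: dvdE)
  then obtain H where H: "subgroup H G" "card H = p ^ 1"
    using sylow_thm assms is_group by metis
  have "card H \<noteq> card {\<one>}"
    using H(2) assms(2) by (auto simp: prime_nat_iff)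
  then have "H \<noteq> {\<one>}" by metis
  then obtain x where "x \<in> H" "x \<noteq> \<one>"
    using H(1) subgroup.one_closed by blast
  then show ?thesis
    using subgroup_pow_card[OF H(1), of x] H subgroup.mem_carrier by fastforce
qed

lemma order_power_of_two:
  assumes "finite (carrier G)" "\<And>x. x \<in> carrier G \<Longrightarrow> \<exists>k. x [^] (2 ^ k :: nat) = \<one>"
  shows "\<exists>k. Coset.order G = 2 ^ k"
proof (rule power_of_two_if_prime_divisors)
  show "Coset.order G > 0"
    using assms(1) order_gt_0_iff_finite by simp
next
  fix p :: nat assume p: "prime p" "p dvd Coset.order G"
  obtain x where x: "x \<in> carrier G" "x \<noteq> \<one>" "x [^] p = \<one>"
    using Cauchy[OF assms(1) p] by blast
  obtain k where "x [^] (2 ^ k :: nat) = \<one>"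
    using assms(2) x(1) by blast
  then have "\<not> coprime p (2 ^ k)"
    using eq_one_if_coprime_pow_eq_one x by blast
  then show "p = 2"
    using p(1) primes_coprime[OF p(1), of 2] by (auto simp: two_is_prime_nat)
qed

lemma subgroup_card_power_of_two:
  assumes "finite (carrier G)" "subgroup P G" "\<And>x. x \<in> P \<Longrightarrow> \<exists>k. x [^] (2 ^ k :: nat) = \<one>"
  shows "\<exists>k. card P = 2 ^ k"
proof -
  interpret P: group "G\<lparr>carrier := P\<rparr>"
    using assms(2) subgroup_imp_group by blast
  have "finite P"
    using assms(1,2) subgroup.subset finite_subset by blast
  then have "\<exists>k. Coset.order (G\<lparr>carrier := P\<rparr>) = 2 ^ k"
    using P.order_power_of_two assms(3) by (simp add: nat_pow_consistent[symmetric])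
  then show ?thesis by (simp add: Coset.order_def)
qed

lemma subgroup_centralizer:
  assumes "P \<subseteq> carrier G"
  shows "subgroup (centralizer G P) G"
proof (rule subgroupI)
  show "centralizer G P \<subseteq> carrier G" "centralizer G P \<noteq> {}"
    using assms by (auto simp: centralizer_def intro!: exI[of _ \<one>])
next
  fix g h assume "g \<in> centralizer G P" "h \<in> centralizer G P"
  then have gh: "g \<in> carrier G" "h \<in> carrier G" "\<And>x. x \<in> P \<Longrightarrow> g \<otimes> x = x \<otimes> g"
    "\<And>x. x \<in> P \<Longrightarrow> h \<otimes> x = x \<otimes> h"
    by (auto simp: centralizer_def)
  have "g \<otimes> h \<otimes> x = x \<otimes> (g \<otimes> h)" if "x \<in> P" for x
  proof -
    have x: "x \<in> carrier G" using that assms by blast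
    have "g \<otimes> h \<otimes> x = g \<otimes> x \<otimes> h"
      using gh(1,2) gh(4)[OF that] x by (simp add: m_assoc)
    then show ?thesis
      using gh(1,2) gh(3)[OF that] x by (simp add: m_assoc)
  qed
  then show "g \<otimes> h \<in> centralizer G P"
    using gh by (simp add: centralizer_def)
next
  fix g assume "g \<in> centralizer G P"
  then have g: "g \<in> carrier G" "\<And>x. x \<in> P \<Longrightarrow> g \<otimes> x = x \<otimes> g"
    by (auto simp: centralizer_def)
  have "inv g \<otimes> x = x \<otimes> inv g" if "x \<in> P" for x
  proof -
    have x: "x \<in> carrier G" using that assms by blast
    have "inv g \<otimes> (x \<otimes> g) \<otimes> inv g = inv g \<otimes> (g \<otimes> x) \<otimes> inv g"
      using g(2)[OF that] by simp
    then have "inv g \<otimes> x \<otimes> (g \<otimes> inv g) = (inv g \<otimes> g) \<otimes> x \<otimes> inv g"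
      by (simp only: m_assoc g(1) x m_closed inv_closed)
    then show ?thesis
      using g(1) x by simp
  qed
  then show "inv g \<in> centralizer G P"
    using g by (simp add: centralizer_def)
qed

end

section \<open>Elements of odd order and the transfer into a central subgroup\<close>

definition odd_elements :: "('h, 'm) monoid_scheme \<Rightarrow> 'h set" where
  "odd_elements H = {x \<in> carrier H. \<exists>m::nat. odd m \<and> x [^]\<^bsub>H\<^esub> m = \<one>\<^bsub>H\<^esub>}"

context group
begin

text \<open>The transfer into a central subgroup \<open>Z\<close> of odd index restricts to a power map with odd exponent
  on \<open>Z\<close>; its kernel consists of the elements of odd order.\<close>

lemma transfer_to_central_subgroup:
  assumes fin: "finite (carrier G)" and Z: "subgroup Z G"
    and central: "\<And>z g. z \<in> Z \<Longrightarrow> g \<in> carrier G \<Longrightarrow> z \<otimes> g = g \<otimes> z"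
  shows "\<exists>\<tau>. group_hom G (G\<lparr>carrier := Z\<rparr>) \<tau> \<and> (\<forall>z\<in>Z. \<tau> z = z [^] card (rcosets Z))"
proof -
  interpret Z: subgroup Z G by (fact Z)
  interpret ZG: comm_group "G\<lparr>carrier := Z\<rparr>"
    using group.group_comm_groupI[OF subgroup_imp_group[OF Z]] central Z.subset by auto
  have finZ: "finite Z"
    using fin Z.subset finite_subset by blast
  have finC: "finite (rcosets Z)"
    using fin by (metis rcosets_part_G finite_UnionD[of "rcosets Z"] Z)
  define s :: "'a set \<Rightarrow> 'a" where "s = (\<lambda>C. SOME x. x \<in> C)"
  have s: "s C \<in> C" if "C \<in> rcosets Z" for C
    using Z.rcosets_non_empty[OF that] by (simp add: s_def some_in_eq)
  have sG: "s C \<in> carrier G" if "C \<in> rcosets Z" for C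
    using s[OF that] Z.rcosets_carrier[OF is_group that] by blast
  have sC: "C = Z #> s C" if "C \<in> rcosets Z" for C
    using that s[OF that] repr_independence[OF _ _ Z] by (auto simp: RCOSETS_def)
  have act: "C #> g \<in> rcosets Z" if "C \<in> rcosets Z" "g \<in> carrier G" for C g
    using that Z.subset by (auto simp: RCOSETS_def coset_mult_assoc)
  have act_act: "C #> g #> h = C #> (g \<otimes> h)"
    if "C \<in> rcosets Z" "g \<in> carrier G" "h \<in> carrier G" for C g h
    using that coset_mult_assoc Z.rcosets_carrier[OF is_group that(1)] by blast
  define t where "t = (\<lambda>g C. s C \<otimes> g \<otimes> inv s (C #> g))"
  have tZ: "t g C \<in> Z" if C: "C \<in> rcosets Z" and g: "g \<in> carrier G" for g C
  proof -
    have "Z #> s (C #> g) = C #> g"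
      using sC act C g by metis
    also have "\<dots> = Z #> (s C \<otimes> g)"
      using sC[OF C] sG[OF C] g Z.subset by (metis coset_mult_assoc)
    finally have "s C \<otimes> g \<in> Z #> s (C #> g)"
      using rcos_self[OF _ Z] sG[OF C] g by simp
    then show ?thesis
      using Z.rcos_module_imp[OF is_group] sG act C g by (simp add: t_def)
  qed
  \<comment> \<open>This cocycle identity makes the product of \<open>t g\<close> over all cosets
    multiplicative in \<open>g\<close>, once the second factor is reindexed by the permutation
    \<open>C #> g\<close> of the cosets.\<close>
  have t_mult: "t (g \<otimes> h) C = t g C \<otimes> t h (C #> g)"
    if C: "C \<in> rcosets Z" and g: "g \<in> carrier G" and h: "h \<in> carrier G" for g h C
  proof -
    let ?a = "s C" and ?b = "s (C #> g)" and ?c = "s (C #> (g \<otimes> h))"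
    have c: "?a \<in> carrier G" "?b \<in> carrier G" "?c \<in> carrier G"
      using sG act C g h by auto
    have "t g C \<otimes> t h (C #> g) = (?a \<otimes> g \<otimes> inv ?b) \<otimes> (?b \<otimes> h \<otimes> inv ?c)"
      by (simp add: t_def act_act[OF C g h])
    also have "\<dots> = ?a \<otimes> g \<otimes> (inv ?b \<otimes> ?b) \<otimes> h \<otimes> inv ?c"
      by (simp only: c g h m_assoc m_closed inv_closed)
    also have "\<dots> = ?a \<otimes> g \<otimes> h \<otimes> inv ?c"
      using c g h by simp
    also have "\<dots> = t (g \<otimes> h) C"
      using c g h by (simp add: t_def m_assoc)
    finally show ?thesis by simp
  qed
  define \<tau> where "\<tau> = (\<lambda>g. finprod (G\<lparr>carrier := Z\<rparr>) (t g) (rcosets Z))"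
  have t_fun: "t g \<in> rcosets Z \<rightarrow> Z" if "g \<in> carrier G" for g
    using tZ that by blast
  have "\<tau> (g \<otimes> h) = \<tau> g \<otimes> \<tau> h" if g: "g \<in> carrier G" and h: "h \<in> carrier G" for g h
  proof -
    have inj: "inj_on (\<lambda>C. C #> g) (rcosets Z)"
      by (rule inj_on_inverseI[where g = "\<lambda>C. C #> inv g"])
        (use g act_act Z.rcosets_carrier[OF is_group] in simp)
    have surj: "(\<lambda>C. C #> g) ` (rcosets Z) = rcosets Z"
      by (rule endo_inj_surj[OF finC _ inj]) (use act g in blast)
    have "\<tau> (g \<otimes> h) = finprod (G\<lparr>carrier := Z\<rparr>)
        (\<lambda>C. t g C \<otimes>\<^bsub>G\<lparr>carrier := Z\<rparr>\<^esub> t h (C #> g)) (rcosets Z)"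
      unfolding \<tau>_def
      by (rule ZG.finprod_cong') (use t_mult g h tZ act in auto)
    also have "\<dots> = \<tau> g \<otimes> finprod (G\<lparr>carrier := Z\<rparr>) (\<lambda>C. t h (C #> g)) (rcosets Z)"
      unfolding \<tau>_def
      by (subst ZG.finprod_multf) (use t_fun g h act in \<open>auto simp: Pi_def\<close>)
    also have "finprod (G\<lparr>carrier := Z\<rparr>) (\<lambda>C. t h (C #> g)) (rcosets Z) = \<tau> h"
      unfolding \<tau>_def
      using ZG.finprod_reindex[OF _ inj, of "t h"] surj t_fun[OF h] by simp
    finally show ?thesis .
  qed
  moreover have "\<tau> g \<in> Z" if "g \<in> carrier G" for g
    using ZG.finprod_closed[of "t g" "rcosets Z"] t_fun[OF that] by (simp add: \<tau>_def)
  ultimately have hom: "group_hom G (G\<lparr>carrier := Z\<rparr>) \<tau>"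
    by unfold_locales (auto simp: hom_def)
  have "\<tau> z = z [^] card (rcosets Z)" if z: "z \<in> Z" for z
  proof -
    \<comment> \<open>A central \<open>z\<close> in \<open>Z\<close> fixes every coset, so each
      factor of the transfer of \<open>z\<close> is \<open>z\<close> itself.\<close>
    have "t z C = z" if C: "C \<in> rcosets Z" for C
    proof -
      have "C #> z = Z #> (z \<otimes> s C)"
        using sC[OF C] sG[OF C] z Z.subset central by (metis coset_mult_assoc subsetD)
      also have "\<dots> = C"
        using sC[OF C] sG[OF C] z Z.subset coset_mult_assoc[of Z z "s C"] Z.rcos_const[OF is_group z]
        by auto
      finally have "t z C = z \<otimes> s C \<otimes> inv s C"
        using central[OF z sG[OF C]] by (simp add: t_def)
      then show ?thesis
        using sG[OF C] z by (simp add: m_assoc)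
    qed
    then have "\<tau> z = finprod (G\<lparr>carrier := Z\<rparr>) (\<lambda>_. z) (rcosets Z)"
      unfolding \<tau>_def by (intro ZG.finprod_cong') (use z in auto)
    also have "\<dots> = z [^] card (rcosets Z)"
      using z by (simp add: ZG.finprod_const nat_pow_consistent[symmetric])
    finally show ?thesis .
  qed
  with hom show ?thesis by blast
qed

text \<open>The kernel of the transfer is the set of elements of odd order. Such an element has
  trivial image because \<open>Z\<close> is a 2-group. Conversely, let \<open>x\<close> be in the
  kernel and \<open>m\<close> the odd index: \<open>x [^] m\<close> lies in \<open>Z\<close>, and
  its transfer is both trivial and equal to \<open>x [^] (m * m)\<close>. By Cauchy's theorem the
  kernel has odd order, so it is one of the generators of \<open>odd_core G\<close>, and it contains
  all the others.\<close>

lemma odd_core_central_Sylow: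
  assumes fin: "finite (carrier G)" and Z: "subgroup Z G" "card Z = 2 ^ k"
    and central: "\<And>z g. z \<in> Z \<Longrightarrow> g \<in> carrier G \<Longrightarrow> z \<otimes> g = g \<otimes> z"
    and odd: "odd (card (rcosets Z))"
  shows "odd_core G = odd_elements G" "odd_elements G \<lhd> G"
proof -
  obtain \<tau> where hom: "group_hom G (G\<lparr>carrier := Z\<rparr>) \<tau>"
    and \<tau>Z: "\<And>z. z \<in> Z \<Longrightarrow> \<tau> z = z [^] card (rcosets Z)"
    using transfer_to_central_subgroup[OF fin Z(1) central] by blast
  interpret \<tau>: group_hom G "G\<lparr>carrier := Z\<rparr>" \<tau> by (fact hom)
  interpret Z: subgroup Z G by (fact Z(1))
  have normZ: "Z \<lhd> G"
  proof -
    have "x \<otimes> z \<otimes> inv x \<in> Z" if "x \<in> carrier G" "z \<in> Z" for x z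
      using that central[of z x, symmetric] by (simp add: m_assoc)
    then show ?thesis
      using Z(1) by (simp add: normal_inv_iff)
  qed
  interpret nZ: normal Z G by (fact normZ)
  have \<tau>_in: "\<tau> x \<in> Z" if "x \<in> carrier G" for x
    using \<tau>.hom_closed that by simp
  have \<tau>_pow: "\<tau> (x [^] (n::nat)) = \<tau> x [^] n" if "x \<in> carrier G" for x n
    using \<tau>.hom_nat_pow[OF that, of n] by (simp add: nat_pow_consistent[symmetric])
  have \<tau>_one: "\<tau> x = \<one>" if "x \<in> carrier G" "x [^] (m::nat) = \<one>" "odd m" for x m
  proof -
    have "\<tau> x [^] m = \<one>"
      using \<tau>_pow[OF that(1), of m] that(2) \<tau>.hom_one by simp
    moreover have "\<tau> x [^] (2 ^ k :: nat) = \<one>"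
      using subgroup_pow_card[OF Z(1) \<tau>_in[OF that(1)]] Z(2) by simp
    moreover have "coprime m (2 ^ k)" using that(3) by simp
    moreover have "\<tau> x \<in> carrier G"
      using \<tau>_in[OF that(1)] by simp
    ultimately show ?thesis
      by (rule eq_one_if_coprime_pow_eq_one[rotated])
  qed
  have odd_elem: "x \<in> odd_elements G" if x: "x \<in> carrier G" "\<tau> x = \<one>" for x
  proof -
    let ?m = "card (rcosets Z)"
    have "Z #> x [^] ?m = (Z #> x) [^]\<^bsub>G Mod Z\<^esub> Coset.order (G Mod Z)"
      using nZ.FactGroup_pow[OF x(1), of ?m] by (simp add: Coset.order_def FactGroup_def)
    also have "\<dots> = Z"
      using group.pow_order_eq_1[OF nZ.factorgroup_is_group, of "Z #> x"] x(1)
      by (simp add: carrier_FactGroup)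
    finally have in_Z: "x [^] ?m \<in> Z"
      using x(1) by (metis nat_pow_closed rcos_self Z(1))
    have "x [^] (?m * ?m) = \<tau> (x [^] ?m)"
      using \<tau>Z[OF in_Z] x(1) by (simp add: nat_pow_pow)
    also have "\<dots> = \<one>"
      using \<tau>_pow[OF x(1)] x(2) by simp
    finally show ?thesis
      using odd x(1) by (auto simp: odd_elements_def intro!: exI[of _ "?m * ?m"])
  qed
  have ker: "odd_elements G = kernel G (G\<lparr>carrier := Z\<rparr>) \<tau>"
    using \<tau>_one odd_elem by (auto simp: kernel_def odd_elements_def)
  then show normal: "odd_elements G \<lhd> G"
    using \<tau>.normal_kernel by simp
  have sub: "subgroup (odd_elements G) G"
    using normal normal_imp_subgroup by blast
  have "odd (card (odd_elements G))"
  proof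
    assume even: "even (card (odd_elements G))"
    interpret N: group "G\<lparr>carrier := odd_elements G\<rparr>"
      using sub subgroup_imp_group by blast
    have "finite (odd_elements G)"
      using fin by (simp add: odd_elements_def)
    then obtain x where x: "x \<in> odd_elements G" "x \<noteq> \<one>" "x [^] (2::nat) = \<one>"
      using N.Cauchy[of 2] even by (auto simp: Coset.order_def nat_pow_consistent[symmetric])
    then obtain m :: nat where "odd m" "x [^] m = \<one>" "x \<in> carrier G"
      by (auto simp: odd_elements_def)
    then show False
      using eq_one_if_coprime_pow_eq_one[of x 2 m] x by simp
  qed
  then have "odd_elements G \<subseteq> odd_core G"
    unfolding odd_core_def using normal by (blast intro: generate.incl)
  moreover have "N \<subseteq> odd_elements G" if "N \<lhd> G" "odd (card N)" for N
  proof
    fix x assume "x \<in> N"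
    then show "x \<in> odd_elements G"
      using that subgroup_pow_card[of N x] normal_imp_subgroup[OF that(1)] subgroup.mem_carrier
      by (fastforce simp: odd_elements_def)
  qed
  then have "odd_core G \<subseteq> odd_elements G"
    unfolding odd_core_def by (intro generate_subgroup_incl[OF _ sub]) blast
  ultimately show "odd_core G = odd_elements G" by blast
qed

lemma subgroup_center_of:
  assumes "subgroup P G"
  shows "subgroup (center_of G P) (G\<lparr>carrier := centralizer G P\<rparr>)"
proof -
  have sub: "subgroup (centralizer G P) G"
    using subgroup_centralizer[OF subgroup.subset[OF assms]] .
  have "subgroup (center_of G P) G"
    unfolding center_of_def using subgroups_Inter_pair[OF assms sub] .
  then show ?thesis
    by (intro subgroup_incl[OF _ sub]) (simp_all add: center_of_def)
qed

lemma two_centric_iff: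
  "two_centric G P \<longleftrightarrow> subgroup P G \<and> (\<exists>k. card P = 2 ^ k) \<and>
     card (center_of G P) = 2 ^ multiplicity 2 (card (centralizer G P))"
  using subgroup_center_of by (auto simp: two_centric_def Syl_def Coset.order_def)

text \<open>Being 2-centric makes \<open>center_of G P\<close> a central Sylow 2-subgroup of the
  centralizer of \<open>P\<close>, so \<open>odd_core_central_Sylow\<close> applies inside this
  centralizer. All later work with the cosets of morphisms goes through this elementwise
  description.\<close>

lemma odd_core_centralizer_eq:
  assumes fin: "finite (carrier G)" and P: "two_centric G P"
  shows "odd_core_centralizer G P = {x \<in> centralizer G P. \<exists>m::nat. odd m \<and> x [^] m = \<one>}"
    "subgroup (odd_core_centralizer G P) G"
proof -
  let ?C = "G\<lparr>carrier := centralizer G P\<rparr>"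
  have subP: "subgroup P G"
    using P by (simp add: two_centric_def)
  have sub: "subgroup (centralizer G P) G"
    using subgroup_centralizer[OF subgroup.subset[OF subP]] .
  interpret C: group ?C
    using subgroup_imp_group[OF sub] .
  have finC: "finite (carrier ?C)"
    using fin by (simp add: centralizer_def)
  let ?Z = "center_of G P"
  have Z: "subgroup ?Z ?C" "card ?Z = 2 ^ multiplicity 2 (Coset.order ?C)"
    using P subgroup_center_of[OF subP] by (simp_all add: two_centric_iff Coset.order_def)
  have idx: "card (rcosets\<^bsub>?C\<^esub> ?Z) * 2 ^ multiplicity 2 (Coset.order ?C) = Coset.order ?C"
    using C.lagrange[OF Z(1)] Z(2) by simp
  have "odd (card (rcosets\<^bsub>?C\<^esub> ?Z))"
  proof
    assume "even (card (rcosets\<^bsub>?C\<^esub> ?Z))"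
    then have "2 ^ Suc (multiplicity 2 (Coset.order ?C)) dvd Coset.order ?C"
      using idx by (metis mult_dvd_mono dvd_refl power_Suc)
    moreover have "Coset.order ?C > 0"
      using C.order_gt_0_iff_finite finC by blast
    ultimately have "Suc (multiplicity 2 (Coset.order ?C)) \<le> multiplicity 2 (Coset.order ?C)"
      by (intro multiplicity_geI) auto
    then show False by simp
  qed
  then have *: "odd_core ?C = odd_elements ?C" "odd_elements ?C \<lhd> ?C"
    using C.odd_core_central_Sylow[OF finC Z] by (auto simp: center_of_def centralizer_def)
  then show "odd_core_centralizer G P = {x \<in> centralizer G P. \<exists>m::nat. odd m \<and> x [^] m = \<one>}"
    by (simp add: odd_core_centralizer_def odd_elements_def nat_pow_consistent[symmetric])
  show "subgroup (odd_core_centralizer G P) G"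
    using incl_subgroup[OF sub normal_imp_subgroup[OF *(2)]] *(1)
    by (simp add: odd_core_centralizer_def)
qed

end

text \<open>Orbits of a 2-group have 2-power size, so those that are not single fixed points
  contribute an even number.\<close>

lemma (in group_action) card_mod_two_group:
  assumes "Coset.order G = 2 ^ k" "finite E"
  shows "card E mod 2 = card {x \<in> E. \<forall>g\<in>carrier G. \<phi> g x = x} mod 2"
proof -
  interpret group G
    using group_hom group_hom.axioms(1) by blast
  let ?F = "{x \<in> E. \<forall>g\<in>carrier G. \<phi> g x = x}"
  have card_orb: "card O' mod 2 = card (O' \<inter> ?F) mod 2" if O': "O' \<in> orbits G E \<phi>" for O'
  proof -
    obtain x where x: "x \<in> E" "O' = orbit G \<phi> x"
      using O' by (auto simp: orbits_def)
    have "card O' dvd 2 ^ k"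
      using orbit_stabilizer_theorem[OF x(1)] x(2) assms(1) by (metis dvd_triv_left)
    then obtain i where i: "card O' = 2 ^ i"
      using divides_primepow_nat two_is_prime_nat by blast
    show ?thesis
    proof (cases "i = 0")
      case True
      then obtain y where "O' = {y}"
        using i card_1_singletonE by auto
      then have single: "O' = {x}"
        using orbit_refl[OF x(1)] x(2) by auto
      have "\<phi> g x = x" if "g \<in> carrier G" for g
        using that single x(2) by (auto simp: orbit_def)
      then have "O' \<inter> ?F = {x}"
        using single x(1) by auto
      with single show ?thesis by simp
    next
      case False
      have "O' \<inter> ?F = {}"
      proof (rule ccontr)
        assume "O' \<inter> ?F \<noteq> {}"
        then obtain y where y: "y \<in> O'" "y \<in> E" "\<And>g. g \<in> carrier G \<Longrightarrow> \<phi> g y = y"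
          by auto
        have "orbit G \<phi> y \<inter> O' \<noteq> {}"
          using y orbit_refl by blast
        then have "O' = orbit G \<phi> y"
          using disjoint_union[OF O', of "orbit G \<phi> y"] y(2) by (auto simp: orbits_def)
        also have "\<dots> = {y}"
          using y(3) by (auto simp: orbit_def intro!: exI[of _ \<one>])
        finally show False
          using i False by (metis One_nat_def card_1_singleton_iff nat_power_eq_Suc_0_iff
              numeral_eq_one_iff semiring_norm(85))
      qed
      with i False show ?thesis by simp
    qed
  qed
  have card_sum: "card A = (\<Sum>O'\<in>orbits G E \<phi>. card (O' \<inter> A))" if "A \<subseteq> E" for A
  proof -
    have "card A = (\<Sum>x\<in>E. if x \<in> A then 1 else 0)"
      using that assms(2) by (simp add: sum.If_cases Int_absorb1)
    also have "\<dots> = (\<Sum>O'\<in>orbits G E \<phi>. \<Sum>x\<in>O'. if x \<in> A then 1 else 0)"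
      using disjoint_sum[OF assms(2)] by metis
    also have "\<dots> = (\<Sum>O'\<in>orbits G E \<phi>. card (O' \<inter> A))"
    proof (rule sum.cong[OF refl])
      fix O' assume "O' \<in> orbits G E \<phi>"
      then have "O' \<subseteq> E"
        using orbits_coverture by blast
      then have "finite O'"
        using assms(2) by (rule finite_subset)
      then show "(\<Sum>x\<in>O'. if x \<in> A then 1 else 0) = card (O' \<inter> A)"
        by (simp add: sum.If_cases Int_def)
    qed
    finally show ?thesis .
  qed
  have "card E mod 2 = (\<Sum>O'\<in>orbits G E \<phi>. card O' mod 2) mod 2"
  proof -
    have "(\<Sum>O'\<in>orbits G E \<phi>. card (O' \<inter> E)) = (\<Sum>O'\<in>orbits G E \<phi>. card O')"
      using orbits_coverture by (intro sum.cong refl arg_cong[of _ _ card]) blast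
    then show ?thesis
      using card_sum[of E] by (simp add: mod_sum_eq)
  qed
  also have "\<dots> = (\<Sum>O'\<in>orbits G E \<phi>. card (O' \<inter> ?F) mod 2) mod 2"
    using card_orb by simp
  also have "\<dots> = card ?F mod 2"
    using card_sum[of ?F] by (simp add: mod_sum_eq)
  finally show ?thesis .
qed

section \<open>Sylow 2-subgroups: conjugation into them and their centricity\<close>

context group
begin

text \<open>\<open>group_action\<close> asks for values in \<open>BijGroup E\<close>, whose elements
  are extensional on \<open>E\<close>; the \<open>restrict\<close> supplies this.\<close>

lemma group_actionI:
  assumes "\<And>g x. g \<in> carrier G \<Longrightarrow> x \<in> E \<Longrightarrow> f g x \<in> E"
    and "\<And>x. x \<in> E \<Longrightarrow> f \<one> x = x"
    and "\<And>g h x. g \<in> carrier G \<Longrightarrow> h \<in> carrier G \<Longrightarrow> x \<in> E \<Longrightarrow> f (g \<otimes> h) x = f g (f h x)"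
  shows "group_action G E (\<lambda>g. restrict (f g) E)"
proof -
  have bij: "restrict (f g) E \<in> Bij E" if "g \<in> carrier G" for g
  proof -
    have "bij_betw (f g) E E"
      by (rule bij_betwI[where g = "f (inv g)"])
        (use that assms assms(3)[of "inv g" g] assms(3)[of g "inv g"] in auto)
    then show ?thesis
      by (auto simp: Bij_def cong: bij_betw_cong)
  qed
  have "(\<lambda>g. restrict (f g) E) \<in> hom G (BijGroup E)"
    using bij assms by (auto simp: hom_def BijGroup_def compose_def fun_eq_iff)
  then show ?thesis
    unfolding group_action_def group_hom_def group_hom_axioms_def
    using is_group group_BijGroup by blast
qed

text \<open>A 2-subgroup fixes one of the oddly many cosets of a Sylow 2-subgroup.\<close>

lemma two_subgroup_conj_into_Syl:
  assumes fin: "finite (carrier G)" and R: "R \<in> Syl 2 G" and P: "subgroup P G" "card P = 2 ^ k"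
  shows "\<exists>g\<in>carrier G. conj_set G g P \<subseteq> R"
proof -
  have subR: "subgroup R G" and cardR: "card R = 2 ^ multiplicity 2 (Coset.order G)"
    using R by (auto simp: Syl_def)
  interpret R: subgroup R G by (fact subR)
  interpret P: subgroup P G by (fact P(1))
  interpret PG: group "G\<lparr>carrier := P\<rparr>"
    using subgroup_imp_group[OF P(1)] .
  have carr: "C \<subseteq> carrier G" if "C \<in> rcosets R" for C
    using R.rcosets_carrier[OF is_group that] .
  have "group_action (G\<lparr>carrier := P\<rparr>) (rcosets R)
      (\<lambda>g. restrict (\<lambda>C. C #> inv g) (rcosets R))"
  proof (rule PG.group_actionI)
    show "C #> inv g \<in> rcosets R" if "g \<in> carrier (G\<lparr>carrier := P\<rparr>)" "C \<in> rcosets R" for g C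
      using that R.subset by (auto simp: RCOSETS_def coset_mult_assoc)
    show "C #> inv \<one>\<^bsub>G\<lparr>carrier := P\<rparr>\<^esub> = C" if "C \<in> rcosets R" for C
      using carr[OF that] by simp
    show "C #> inv (g \<otimes>\<^bsub>G\<lparr>carrier := P\<rparr>\<^esub> h) = C #> inv h #> inv g"
      if "g \<in> carrier (G\<lparr>carrier := P\<rparr>)" "h \<in> carrier (G\<lparr>carrier := P\<rparr>)" "C \<in> rcosets R" for g h C
      using that carr[of C] by (simp add: inv_mult_group coset_mult_assoc)
  qed
  then interpret act: group_action "G\<lparr>carrier := P\<rparr>" "rcosets R"
      "\<lambda>g. restrict (\<lambda>C. C #> inv g) (rcosets R)" .
  have finC: "finite (rcosets R)"
    using fin by (metis rcosets_part_G finite_UnionD[of "rcosets R"] subR)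
  have idx: "card (rcosets R) * 2 ^ multiplicity 2 (Coset.order G) = Coset.order G"
    using lagrange[OF subR] cardR by simp
  have "odd (card (rcosets R))"
  proof
    assume "even (card (rcosets R))"
    then have "2 ^ Suc (multiplicity 2 (Coset.order G)) dvd Coset.order G"
      using idx by (metis mult_dvd_mono dvd_refl power_Suc)
    moreover have "Coset.order G > 0"
      using order_gt_0_iff_finite fin by blast
    ultimately have "Suc (multiplicity 2 (Coset.order G)) \<le> multiplicity 2 (Coset.order G)"
      by (intro multiplicity_geI) auto
    then show False by simp
  qed
  then have "card {C \<in> rcosets R. \<forall>g\<in>carrier (G\<lparr>carrier := P\<rparr>).
      restrict (\<lambda>C. C #> inv g) (rcosets R) C = C} mod 2 = 1"
    using act.card_mod_two_group[of k] P(2) finC by (simp add: Coset.order_def odd_iff_mod_2_eq_one)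
  then have "{C \<in> rcosets R. \<forall>g\<in>carrier (G\<lparr>carrier := P\<rparr>).
      restrict (\<lambda>C. C #> inv g) (rcosets R) C = C} \<noteq> {}"
    by (metis card.empty mod_0 zero_neq_one)
  then obtain C where C: "C \<in> rcosets R" "\<And>g. g \<in> P \<Longrightarrow> C #> inv g = C"
    by auto
  obtain x where x: "x \<in> carrier G" "C = R #> x"
    using C(1) by (auto simp: RCOSETS_def)
  have "x \<otimes> g \<otimes> inv x \<in> R" if g: "g \<in> P" for g
  proof -
    have "R #> x = R #> x #> g"
      using C(2)[OF P.m_inv_closed[OF g]] x g by simp
    also have "\<dots> = R #> (x \<otimes> g)"
      using coset_mult_assoc[of R x g] x g R.subset by simp
    finally have "x \<otimes> g \<in> R #> x"
      using rcos_self[of "x \<otimes> g" R] subR x(1) g by simp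
    then show ?thesis
      using R.rcos_module_imp[OF is_group x(1)] by simp
  qed
  then show ?thesis
    using x(1) by (auto simp: conj_set_def)
qed

text \<open>Let \<open>T\<close> be a Sylow 2-subgroup of the centralizer of \<open>R\<close>. Then
  \<open>R <#> T\<close> is a 2-subgroup containing \<open>R\<close>, hence equal to
  \<open>R\<close> by maximality of the order. So \<open>T\<close> lies in the center of
  \<open>R\<close>, which is itself a 2-subgroup of the centralizer and therefore no larger than
  \<open>T\<close>.\<close>

lemma two_centric_Syl:
  assumes fin: "finite (carrier G)" and R: "R \<in> Syl 2 G"
  shows "two_centric G R"
proof -
  have subR: "subgroup R G" and cardR: "card R = 2 ^ multiplicity 2 (Coset.order G)"
    using R by (auto simp: Syl_def)
  interpret R: subgroup R G by (fact subR)
  let ?C = "centralizer G R"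
  have subC: "subgroup ?C G"
    using subgroup_centralizer[OF R.subset] .
  interpret C: group "G\<lparr>carrier := ?C\<rparr>"
    using subgroup_imp_group[OF subC] .
  have finC: "finite ?C"
    using fin by (simp add: centralizer_def)
  have ordpos: "Coset.order (G\<lparr>carrier := ?C\<rparr>) > 0"
    using C.order_gt_0_iff_finite finC by simp
  obtain T where T: "subgroup T (G\<lparr>carrier := ?C\<rparr>)" "card T = 2 ^ multiplicity 2 (card ?C)"
    using sylow_thm[OF two_is_prime_nat C.is_group, of "multiplicity 2 (card ?C)"]
      multiplicity_dvd[of 2 "card ?C"] finC by (auto simp: Coset.order_def elim!: dvdE)
  have subT: "subgroup T G"
    using incl_subgroup[OF subC T(1)] .
  interpret T: subgroup T G by (fact subT)
  have TC: "T \<subseteq> ?C"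
    using subgroup.subset[OF T(1)] by simp
  have comm: "t \<otimes> x = x \<otimes> t" if "t \<in> T" "x \<in> R" for t x
    using that TC by (auto simp: centralizer_def)
  have K: "subgroup (R <#> T) G"
  proof (rule subgroupI)
    show "R <#> T \<subseteq> carrier G"
      using setmult_subset_G[OF R.subset T.subset] .
    show "R <#> T \<noteq> {}"
      using R.one_closed T.one_closed unfolding set_mult_def by blast
  next
    fix a assume "a \<in> R <#> T"
    then obtain x t where xt: "x \<in> R" "t \<in> T" "a = x \<otimes> t"
      by (auto simp: set_mult_def)
    then have "inv a = inv x \<otimes> inv t"
      using comm[of "inv t" "inv x"] by (simp add: inv_mult_group)
    then show "inv a \<in> R <#> T"
      using xt by (auto simp: set_mult_def)
  next
    fix a b assume "a \<in> R <#> T" "b \<in> R <#> T"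
    then obtain x t y u where xt: "x \<in> R" "t \<in> T" "a = x \<otimes> t" "y \<in> R" "u \<in> T" "b = y \<otimes> u"
      by (auto simp: set_mult_def)
    have "a \<otimes> b = x \<otimes> (t \<otimes> y) \<otimes> u"
      using xt by (simp add: m_assoc)
    also have "\<dots> = x \<otimes> (y \<otimes> t) \<otimes> u"
      using xt comm by simp
    also have "\<dots> = (x \<otimes> y) \<otimes> (t \<otimes> u)"
      using xt by (simp add: m_assoc)
    finally show "a \<otimes> b \<in> R <#> T"
      using xt by (auto simp: set_mult_def)
  qed
  have "\<exists>k. a [^] (2 ^ k :: nat) = \<one>" if a: "a \<in> R <#> T" for a
  proof -
    obtain x t where xt: "x \<in> R" "t \<in> T" "a = x \<otimes> t"
      using a by (auto simp: set_mult_def)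
    obtain i j where ij: "card R = 2 ^ i" "card T = 2 ^ j"
      using cardR T(2) by blast
    have "a [^] (2 ^ (i + j) :: nat) = x [^] (card R * card T) \<otimes> t [^] (card T * card R)"
      using xt ij pow_mult_distrib[OF comm[OF xt(2,1), symmetric]]
      by (simp add: power_add mult.commute)
    also have "\<dots> = \<one>"
      using subgroup_pow_card[OF subR xt(1)] subgroup_pow_card[OF subT xt(2)] xt
      by (simp add: nat_pow_pow[symmetric])
    finally show ?thesis by blast
  qed
  then obtain i where i: "card (R <#> T) = 2 ^ i"
    using subgroup_card_power_of_two[OF fin K] by blast
  have "card (R <#> T) dvd Coset.order G"
    using card_subgroup_dvd[OF K] .
  moreover have "Coset.order G \<noteq> 0"
    using order_gt_0_iff_finite fin by blast
  ultimately have "i \<le> multiplicity 2 (Coset.order G)"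
    using i by (intro multiplicity_geI) auto
  then have "card (R <#> T) \<le> card R"
    using i cardR by simp
  moreover have "R \<subseteq> R <#> T"
  proof
    fix x assume x: "x \<in> R"
    then have "x \<otimes> \<one> \<in> R <#> T"
      using T.one_closed unfolding set_mult_def by blast
    with x show "x \<in> R <#> T" by simp
  qed
  moreover have "finite (R <#> T)"
    using finite_subset[OF subgroup.subset[OF K] fin] .
  ultimately have eq: "R <#> T = R"
    using card_seteq[of "R <#> T" R] by simp
  have "T \<subseteq> R"
  proof
    fix t assume t: "t \<in> T"
    then have "\<one> \<otimes> t \<in> R <#> T"
      using R.one_closed unfolding set_mult_def by blast
    with eq t show "t \<in> R" by simp
  qed
  then have "T \<subseteq> center_of G R"
    using TC by (auto simp: center_of_def)
  moreover have finZ: "finite (center_of G R)"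
    using finC by (simp add: center_of_def)
  ultimately have le: "2 ^ multiplicity 2 (card ?C) \<le> card (center_of G R)"
    using T(2) card_mono by metis
  have "card (center_of G R) dvd card R"
  proof -
    interpret RG: group "G\<lparr>carrier := R\<rparr>"
      using subgroup_imp_group[OF subR] .
    have "subgroup (center_of G R) G"
      unfolding center_of_def using subgroups_Inter_pair[OF subR subC] .
    then have "subgroup (center_of G R) (G\<lparr>carrier := R\<rparr>)"
      by (intro subgroup_incl[OF _ subR]) (simp_all add: center_of_def)
    from RG.card_subgroup_dvd[OF this] show ?thesis
      by (simp add: Coset.order_def)
  qed
  then obtain j where j: "card (center_of G R) = 2 ^ j"
    using cardR divides_primepow_nat[OF two_is_prime_nat] by auto
  have "card (center_of G R) dvd card ?C"
    using C.card_subgroup_dvd[OF subgroup_center_of[OF subR]] by (simp add: Coset.order_def)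
  then have "j \<le> multiplicity 2 (card ?C)"
    using j ordpos by (intro multiplicity_geI) (auto simp: Coset.order_def)
  with le j have "card (center_of G R) = 2 ^ multiplicity 2 (card ?C)"
    by (simp add: le_antisym)
  then show ?thesis
    using subR cardR by (auto simp: two_centric_iff)
qed

end

section \<open>Automorphisms of the centric linking system\<close>

definition conj_aut :: "('h, 'm) monoid_scheme \<Rightarrow> 'h \<Rightarrow> 'h \<Rightarrow> 'h" where
  "conj_aut H g = (\<lambda>x\<in>carrier H. g \<otimes>\<^bsub>H\<^esub> x \<otimes>\<^bsub>H\<^esub> inv\<^bsub>H\<^esub> g)"

context group
begin

lemma lcoset_eq_iff:
  assumes "subgroup K G" "g \<in> carrier G" "h \<in> carrier G"
  shows "g <# K = h <# K \<longleftrightarrow> inv h \<otimes> g \<in> K"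
proof
  interpret K: subgroup K G by (fact assms(1))
  assume "g <# K = h <# K"
  then have "g \<in> h <# K"
    using assms K.one_closed by (force simp: l_coset_def)
  then obtain k where "k \<in> K" "g = h \<otimes> k"
    by (auto simp: l_coset_def)
  then show "inv h \<otimes> g \<in> K"
    using assms by (simp add: m_assoc[symmetric])
next
  interpret K: subgroup K G by (fact assms(1))
  assume *: "inv h \<otimes> g \<in> K"
  have "g = h \<otimes> (inv h \<otimes> g)"
    using assms by (simp add: m_assoc[symmetric])
  then have "g \<in> h <# K"
    using * unfolding l_coset_def by blast
  then show "g <# K = h <# K"
    using l_repr_independence[OF _ assms(3,1)] by simp
qed

lemma eq_if_inv_mult_eq_one:
  assumes "inv x \<otimes> y = \<one>" "x \<in> carrier G" "y \<in> carrier G"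
  shows "x = y"
proof -
  have "y = x \<otimes> (inv x \<otimes> y)"
    using assms(2,3) by (simp add: m_assoc[symmetric])
  then show ?thesis
    using assms by simp
qed

lemma auto_group_hom: "a \<in> auto G \<Longrightarrow> group_hom G G a"
  using is_group by (simp add: auto_def group_hom_def group_hom_axioms_def)

lemma auto_closed: "a \<in> auto G \<Longrightarrow> x \<in> carrier G \<Longrightarrow> a x \<in> carrier G"
  by (auto simp: auto_def hom_def)

lemma auto_mult:
  "a \<in> auto G \<Longrightarrow> x \<in> carrier G \<Longrightarrow> y \<in> carrier G \<Longrightarrow> a (x \<otimes> y) = a x \<otimes> a y"
  by (auto simp: auto_def hom_def)

lemma auto_inj: "a \<in> auto G \<Longrightarrow> inj_on a (carrier G)"
  by (auto simp: auto_def Bij_def bij_betw_def)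

lemma auto_image: "a \<in> auto G \<Longrightarrow> a ` carrier G = carrier G"
  by (auto simp: auto_def Bij_def bij_betw_def)

lemma auto_compose: "a \<in> auto G \<Longrightarrow> b \<in> auto G \<Longrightarrow> compose (carrier G) a b \<in> auto G"
  using compose_Bij[of a "carrier G" b]
  by (auto simp: auto_def hom_def compose_def Pi_iff)

lemma auto_inverse:
  assumes "a \<in> auto G"
  shows "restrict (inv_into (carrier G) a) (carrier G) \<in> auto G"
  using assms restrict_inv_into_hom restrict_inv_into_Bij by (auto simp: auto_def)

lemma centralizer_auto:
  assumes a: "a \<in> auto G" and P: "P \<subseteq> carrier G"
  shows "centralizer G (a ` P) = a ` centralizer G P"
proof
  show "a ` centralizer G P \<subseteq> centralizer G (a ` P)"
    using P auto_closed[OF a] by (auto simp: centralizer_def auto_mult[OF a, symmetric] subset_iff)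
  show "centralizer G (a ` P) \<subseteq> a ` centralizer G P"
  proof
    fix g assume g: "g \<in> centralizer G (a ` P)"
    then obtain h where h: "h \<in> carrier G" "g = a h"
      using auto_image[OF a] by (auto simp: centralizer_def)
    have "h \<otimes> x = x \<otimes> h" if "x \<in> P" for x
    proof (rule inj_onD[OF auto_inj[OF a]])
      show "a (h \<otimes> x) = a (x \<otimes> h)"
        using g h that P by (auto simp: centralizer_def auto_mult[OF a] subset_iff)
    qed (use h that P in auto)
    then show "g \<in> a ` centralizer G P"
      using h by (auto simp: centralizer_def)
  qed
qed

lemma two_centric_auto:
  assumes a: "a \<in> auto G" and P: "two_centric G P"
  shows "two_centric G (a ` P)"
proof -
  have subP: "subgroup P G"
    using P by (simp add: two_centric_def)
  have PG: "P \<subseteq> carrier G"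
    using subgroup.subset[OF subP] .
  have CG: "centralizer G P \<subseteq> carrier G"
    by (auto simp: centralizer_def)
  have "center_of G (a ` P) = a ` center_of G P"
    using inj_on_image_Int[OF auto_inj[OF a] PG CG]
    by (simp add: center_of_def centralizer_auto[OF a PG])
  moreover have "card (a ` X) = card X" if "X \<subseteq> carrier G" for X
    using card_image inj_on_subset[OF auto_inj[OF a] that] by blast
  moreover have "subgroup (a ` P) G"
    using group_hom.subgroup_img_is_subgroup[OF auto_group_hom[OF a] subP] .
  moreover have "center_of G P \<subseteq> carrier G"
    using PG by (auto simp: center_of_def)
  ultimately show ?thesis
    using P PG CG by (simp add: two_centric_iff centralizer_auto[OF a PG])
qed

lemma odd_core_centralizer_auto:
  assumes fin: "finite (carrier G)" and a: "a \<in> auto G" and P: "two_centric G P"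
  shows "odd_core_centralizer G (a ` P) = a ` odd_core_centralizer G P"
proof -
  interpret a: group_hom G G a
    using auto_group_hom[OF a] .
  have PG: "P \<subseteq> carrier G"
    using P subgroup.subset by (auto simp: two_centric_def)
  have *: "a x [^] (m::nat) = \<one> \<longleftrightarrow> x [^] m = \<one>" if "x \<in> carrier G" for x m
    using that inj_onD[OF auto_inj[OF a], of "x [^] m" \<one>] a.hom_nat_pow[of x m] by auto
  have "x \<in> centralizer G P \<Longrightarrow> x \<in> carrier G" for x
    by (simp add: centralizer_def)
  then show ?thesis
    unfolding odd_core_centralizer_eq(1)[OF fin P]
      odd_core_centralizer_eq(1)[OF fin two_centric_auto[OF a P]] centralizer_auto[OF a PG]
    by (auto simp: * intro!: imageI)
qed

lemma conj_aut_closed: "g \<in> carrier G \<Longrightarrow> x \<in> carrier G \<Longrightarrow> conj_aut G g x \<in> carrier G"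
  by (simp add: conj_aut_def)

lemma conj_aut_mult:
  assumes "g \<in> carrier G" "h \<in> carrier G"
  shows "compose (carrier G) (conj_aut G g) (conj_aut G h) = conj_aut G (g \<otimes> h)"
  using assms by (auto simp: conj_aut_def compose_def fun_eq_iff inv_mult_group m_assoc)

lemma conj_aut_auto:
  assumes g: "g \<in> carrier G"
  shows "conj_aut G g \<in> auto G"
proof -
  have 1: "conj_aut G h \<in> hom G G" if h: "h \<in> carrier G" for h
  proof (rule homI)
    fix x y assume xy: "x \<in> carrier G" "y \<in> carrier G"
    have "(h \<otimes> x \<otimes> inv h) \<otimes> (h \<otimes> y \<otimes> inv h) = h \<otimes> x \<otimes> (inv h \<otimes> h) \<otimes> y \<otimes> inv h"
      by (simp only: h xy m_assoc m_closed inv_closed)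
    then show "conj_aut G h (x \<otimes> y) = conj_aut G h x \<otimes> conj_aut G h y"
      using h xy by (simp add: conj_aut_def m_assoc)
  qed (use h conj_aut_closed in auto)
  have "conj_aut G (inv g) (conj_aut G g x) = x" "conj_aut G g (conj_aut G (inv g) x) = x"
    if x: "x \<in> carrier G" for x
  proof -
    have "compose (carrier G) (conj_aut G (inv g)) (conj_aut G g) x = x"
      "compose (carrier G) (conj_aut G g) (conj_aut G (inv g)) x = x"
      using g x by (simp_all add: conj_aut_mult) (simp_all add: conj_aut_def)
    then show "conj_aut G (inv g) (conj_aut G g x) = x" "conj_aut G g (conj_aut G (inv g) x) = x"
      using x by (simp_all add: compose_def)
  qed
  then have "bij_betw (conj_aut G g) (carrier G) (carrier G)"
    by (intro bij_betwI[where g = "conj_aut G (inv g)"]) (use g conj_aut_closed in auto)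
  then show ?thesis
    using 1[OF g] by (auto simp: auto_def Bij_def conj_aut_def)
qed

lemma conj_set_eq: "P \<subseteq> carrier G \<Longrightarrow> conj_set G g P = conj_aut G g ` P"
  by (auto simp: conj_set_def conj_aut_def intro!: image_cong)

end

section \<open>The centric linking system over a fixed Sylow 2-subgroup\<close>

locale linking = group +
  fixes R
  assumes fin: "finite (carrier G)" and R: "R \<in> Syl 2 G"
begin

abbreviation "L \<equiv> linking_system G R"
abbreviation "K P \<equiv> odd_core_centralizer G P"
abbreviation "lc \<equiv> link_class G"

text \<open>The transporter from \<open>P\<close> to \<open>Q\<close>, that is, the representatives
  of the morphisms. For \<open>P = Q\<close> a subgroup of the finite group it is the normalizer of
  \<open>P\<close>.\<close>

definition Tr :: "'a set \<Rightarrow> 'a set \<Rightarrow> 'a set" where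
  "Tr P Q = {g \<in> carrier G. conj_set G g P \<subseteq> Q}"

lemma Obj_L: "P \<in> Obj L \<longleftrightarrow> P \<subseteq> R \<and> two_centric G P"
  by (simp add: linking_system_def)

lemma Mor_L: "Mor L P Q = lc P Q ` Tr P Q"
  by (simp add: linking_system_def Tr_def)

lemma Ident_L: "Ident L P = lc P P \<one>"
  by (simp add: linking_system_def)

lemma subgroup_Obj: "P \<in> Obj L \<Longrightarrow> subgroup P G"
  by (simp add: Obj_L two_centric_def)

lemma Obj_carrier: "P \<in> Obj L \<Longrightarrow> P \<subseteq> carrier G"
  using subgroup_Obj subgroup.subset by blast

lemma Obj_R: "R \<in> Obj L"
  using two_centric_Syl[OF fin R] by (simp add: Obj_L)

lemma R_carrier: "R \<subseteq> carrier G"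
  using Obj_carrier[OF Obj_R] .

lemma K_eq: "P \<in> Obj L \<Longrightarrow> K P = {x \<in> centralizer G P. \<exists>m::nat. odd m \<and> x [^] m = \<one>}"
  using odd_core_centralizer_eq(1)[OF fin] by (simp add: Obj_L)

lemma subgroup_K: "P \<in> Obj L \<Longrightarrow> subgroup (K P) G"
  using odd_core_centralizer_eq(2)[OF fin] by (simp add: Obj_L)

lemma K_carrier: "P \<in> Obj L \<Longrightarrow> K P \<subseteq> carrier G"
  using subgroup_K subgroup.subset by blast

lemma TrD: "g \<in> Tr P Q \<Longrightarrow> g \<in> carrier G"
  "g \<in> Tr P Q \<Longrightarrow> x \<in> P \<Longrightarrow> g \<otimes> x \<otimes> inv g \<in> Q"
  by (auto simp: Tr_def conj_set_def)

lemma Tr_one: "P \<subseteq> Q \<Longrightarrow> Q \<subseteq> carrier G \<Longrightarrow> \<one> \<in> Tr P Q"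
  by (auto simp: Tr_def conj_set_def subset_iff)

lemma Tr_mult:
  assumes "g \<in> Tr P Q" "h \<in> Tr Q S" "P \<subseteq> carrier G"
  shows "h \<otimes> g \<in> Tr P S"
proof -
  have "h \<otimes> g \<otimes> x \<otimes> inv (h \<otimes> g) \<in> S" if "x \<in> P" for x
  proof -
    have "h \<otimes> g \<otimes> x \<otimes> inv (h \<otimes> g) = h \<otimes> (g \<otimes> x \<otimes> inv g) \<otimes> inv h"
      using assms that TrD(1) by (auto simp: inv_mult_group m_assoc subset_iff)
    then show ?thesis
      using TrD(2)[OF assms(2) TrD(2)[OF assms(1) that]] by simp
  qed
  then show ?thesis
    using assms by (auto simp: Tr_def conj_set_def)
qed

lemma Tr_auto:
  assumes a: "a \<in> auto G" and g: "g \<in> Tr P Q" and P: "P \<subseteq> carrier G"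
  shows "a g \<in> Tr (a ` P) (a ` Q)"
proof -
  interpret a: group_hom G G a
    using auto_group_hom[OF a] .
  have "a g \<otimes> a x \<otimes> inv (a g) = a (g \<otimes> x \<otimes> inv g)" if "x \<in> P" for x
    using that P TrD(1)[OF g] by auto
  then show ?thesis
    using g TrD(2)[OF g] by (auto simp: Tr_def conj_set_def)
qed

text \<open>Conjugation by \<open>inv g\<close> carries the centralizer of \<open>Q\<close> into
  that of \<open>P\<close> and preserves odd exponents. Moving \<open>y\<close> past
  \<open>g\<close> in this way turns a product of two cosets into a single coset, which is the
  composition law \<open>Comp_lc\<close>.\<close>

lemma K_conj:
  assumes P: "P \<in> Obj L" and Q: "Q \<in> Obj L" and g: "g \<in> Tr P Q" and y: "y \<in> K Q"
  shows "inv g \<otimes> y \<otimes> g \<in> K P"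
proof -
  have gG: "g \<in> carrier G" using g TrD(1) by blast
  have yG: "y \<in> carrier G" using y K_carrier[OF Q] by blast
  have yc: "y \<in> centralizer G Q" using y K_eq[OF Q] by blast
  obtain m :: nat where m: "odd m" "y [^] m = \<one>"
    using y K_eq[OF Q] by auto
  have eq: "inv g \<otimes> y \<otimes> g = conj_aut G (inv g) y"
    using gG yG by (simp add: conj_aut_def)
  interpret c: group_hom G G "conj_aut G (inv g)"
    using auto_group_hom[OF conj_aut_auto] gG by simp
  have "(inv g \<otimes> y \<otimes> g) [^] m = conj_aut G (inv g) (y [^] m)"
    using c.hom_nat_pow[OF yG, of m] eq by simp
  then have "(inv g \<otimes> y \<otimes> g) [^] m = \<one>"
    using m(2) by simp
  moreover have "(inv g \<otimes> y \<otimes> g) \<otimes> x = x \<otimes> (inv g \<otimes> y \<otimes> g)" if x: "x \<in> P" for x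
  proof -
    have xG: "x \<in> carrier G" using x Obj_carrier[OF P] by blast
    have comm: "y \<otimes> (g \<otimes> x \<otimes> inv g) = (g \<otimes> x \<otimes> inv g) \<otimes> y"
      using TrD(2)[OF g x] yc by (auto simp: centralizer_def)
    have "(inv g \<otimes> y \<otimes> g) \<otimes> x = inv g \<otimes> (y \<otimes> (g \<otimes> x \<otimes> inv g)) \<otimes> g"
      using gG yG xG by (simp add: m_assoc)
    also have "\<dots> = (inv g \<otimes> g) \<otimes> x \<otimes> (inv g \<otimes> y \<otimes> g)"
      unfolding comm by (simp only: gG yG xG m_assoc m_closed inv_closed)
    also have "\<dots> = x \<otimes> (inv g \<otimes> y \<otimes> g)"
      using gG yG xG by simp
    finally show ?thesis .
  qed
  ultimately show ?thesis
    using m(1) gG yG unfolding K_eq[OF P] centralizer_def by auto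
qed

lemma Comp_lc:
  assumes P: "P \<in> Obj L" and Q: "Q \<in> Obj L" and g: "g \<in> Tr P Q" and h: "h \<in> carrier G"
  shows "Comp L (lc Q S h) (lc P Q g) = lc P S (h \<otimes> g)"
proof -
  have gG: "g \<in> carrier G" using g TrD(1) by blast
  have "(h <# K Q) <#> (g <# K P) = (h \<otimes> g) <# K P"
  proof
    show "(h <# K Q) <#> (g <# K P) \<subseteq> (h \<otimes> g) <# K P"
    proof
      fix z assume "z \<in> (h <# K Q) <#> (g <# K P)"
      then obtain y k where yk: "y \<in> K Q" "k \<in> K P" "z = h \<otimes> y \<otimes> (g \<otimes> k)"
        by (auto simp: set_mult_def l_coset_def)
      have c: "y \<in> carrier G" "k \<in> carrier G"
        using yk K_carrier P Q by auto
      have "z = h \<otimes> (g \<otimes> inv g) \<otimes> y \<otimes> (g \<otimes> k)"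
        using yk(3) gG h by simp
      also have "\<dots> = (h \<otimes> g) \<otimes> ((inv g \<otimes> y \<otimes> g) \<otimes> k)"
        by (simp only: gG h c m_assoc m_closed inv_closed)
      finally show "z \<in> (h \<otimes> g) <# K P"
        using K_conj[OF P Q g yk(1)] yk(2) subgroup.m_closed[OF subgroup_K[OF P]]
        unfolding l_coset_def by blast
    qed
    show "(h \<otimes> g) <# K P \<subseteq> (h <# K Q) <#> (g <# K P)"
    proof
      fix z assume "z \<in> (h \<otimes> g) <# K P"
      then obtain k where k: "k \<in> K P" "z = h \<otimes> g \<otimes> k"
        by (auto simp: l_coset_def)
      then have "z = (h \<otimes> \<one>) \<otimes> (g \<otimes> k)"
        using gG h K_carrier[OF P] by (auto simp: m_assoc)
      then show "z \<in> (h <# K Q) <#> (g <# K P)"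
        using k(1) subgroup.one_closed[OF subgroup_K[OF Q]]
        unfolding l_coset_def set_mult_def by blast
    qed
  qed
  then show ?thesis
    by (simp add: linking_system_def link_class_def)
qed

lemma lc_eq_iff:
  assumes "P \<in> Obj L" "g \<in> carrier G" "h \<in> carrier G"
  shows "lc P Q g = lc P Q h \<longleftrightarrow> inv h \<otimes> g \<in> K P"
  using lcoset_eq_iff[OF subgroup_K] assms by (simp add: link_class_def)

lemma MorE:
  assumes "f \<in> Mor L P Q"
  obtains g where "g \<in> Tr P Q" "f = lc P Q g"
  using assms by (auto simp: Mor_L)

lemma ArrE:
  assumes "f \<in> Arr L"
  obtains P Q g where "P \<in> Obj L" "Q \<in> Obj L" "g \<in> Tr P Q" "f = lc P Q g"
  using assms by (auto simp: Mor_L Arr_def)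

lemma lc_Arr: "P \<in> Obj L \<Longrightarrow> Q \<in> Obj L \<Longrightarrow> g \<in> Tr P Q \<Longrightarrow> lc P Q g \<in> Arr L"
  by (auto simp: Arr_def Mor_L)

section \<open>The functor induced by an automorphism that preserves \<open>R\<close>\<close>

lemma Obj_auto:
  assumes "a \<in> auto G" "a ` R = R" "P \<in> Obj L"
  shows "a ` P \<in> Obj L"
proof -
  have "a ` P \<subseteq> a ` R"
    using assms(3) by (intro image_mono) (simp add: Obj_L)
  then show ?thesis
    using two_centric_auto[OF assms(1)] assms(2,3) by (simp add: Obj_L)
qed

lemma induced_fst: "P \<in> Obj L \<Longrightarrow> fst (induced_link G R a) P = a ` P"
  by (simp add: induced_link_def)

lemma induced_snd:
  assumes a: "a \<in> auto G" and P: "P \<in> Obj L" and Q: "Q \<in> Obj L" and g: "g \<in> Tr P Q"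
  shows "snd (induced_link G R a) (lc P Q g) = lc (a ` P) (a ` Q) (a g)"
proof -
  have gG: "g \<in> carrier G" using g TrD(1) by blast
  have "a ` (g <# K P) = a g <# (a ` K P)"
    using gG K_carrier[OF P] by (auto simp: l_coset_def auto_mult[OF a] subset_iff image_iff)
  then have "a ` (g <# K P) = a g <# K (a ` P)"
    using odd_core_centralizer_auto[OF fin a] P by (simp add: Obj_L)
  then show ?thesis
    using lc_Arr[OF P Q g] by (simp add: induced_link_def link_class_def)
qed

lemma endofunctor_induced:
  assumes a: "a \<in> auto G" "a ` R = R"
  shows "endofunctor L (induced_link G R a)"
proof -
  interpret a: group_hom G G a
    using auto_group_hom[OF a(1)] .
  note fs = induced_fst induced_snd[OF a(1)]
  have 1: "snd (induced_link G R a) f \<in>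
      Mor L (fst (induced_link G R a) X) (fst (induced_link G R a) Y)"
    if XY: "X \<in> Obj L" "Y \<in> Obj L" and f: "f \<in> Mor L X Y" for X Y f
  proof -
    obtain g where g: "g \<in> Tr X Y" "f = lc X Y g"
      using f by (rule MorE)
    then show ?thesis
      using XY Tr_auto[OF a(1) g(1) Obj_carrier] by (auto simp: fs Mor_L)
  qed
  have 2: "snd (induced_link G R a) (Ident L X) = Ident L (fst (induced_link G R a) X)"
    if X: "X \<in> Obj L" for X
    using X Tr_one[OF _ Obj_carrier, of X X] by (simp add: Ident_L fs)
  have 3: "snd (induced_link G R a) (Comp L g f) =
      Comp L (snd (induced_link G R a) g) (snd (induced_link G R a) f)"
    if XYZ: "X \<in> Obj L" "Y \<in> Obj L" "Z \<in> Obj L" and f: "f \<in> Mor L X Y" and g: "g \<in> Mor L Y Z"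
    for X Y Z f g
  proof -
    obtain x where x: "x \<in> Tr X Y" "f = lc X Y x"
      using f by (rule MorE)
    obtain y where y: "y \<in> Tr Y Z" "g = lc Y Z y"
      using g by (rule MorE)
    have c: "x \<in> carrier G" "y \<in> carrier G"
      using x y TrD(1) by auto
    have "snd (induced_link G R a) (Comp L g f) = lc (a ` X) (a ` Z) (a y \<otimes> a x)"
      using XYZ x y c Tr_mult[OF x(1) y(1) Obj_carrier] by (simp add: Comp_lc fs)
    also have "\<dots> = Comp L (lc (a ` Y) (a ` Z) (a y)) (lc (a ` X) (a ` Y) (a x))"
      using Comp_lc[OF Obj_auto[OF a XYZ(1)] Obj_auto[OF a XYZ(2)]
          Tr_auto[OF a(1) x(1) Obj_carrier[OF XYZ(1)]], of "a y"] c by simp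
    finally show ?thesis
      using XYZ x y by (simp add: fs)
  qed
  show ?thesis
    unfolding endofunctor_def
    using 1 2 3 Obj_auto[OF a] by (auto simp: induced_fst) (auto simp: induced_link_def)
qed

lemma comp_induced:
  assumes a: "a \<in> auto G" "a ` R = R" and b: "b \<in> auto G" "b ` R = R"
  shows "comp_functor L (induced_link G R a) (induced_link G R b) =
    induced_link G R (compose (carrier G) a b)"
proof (rule prod_eqI)
  have img: "compose (carrier G) a b ` X = a ` b ` X" if "X \<subseteq> carrier G" for X
    using that by (force simp: compose_def)
  show "fst (comp_functor L (induced_link G R a) (induced_link G R b)) =
    fst (induced_link G R (compose (carrier G) a b))"
  proof
    fix P show "fst (comp_functor L (induced_link G R a) (induced_link G R b)) P =
      fst (induced_link G R (compose (carrier G) a b)) P"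
    proof (cases "P \<in> Obj L")
      case True
      then show ?thesis
        using Obj_auto[OF b True] img[OF Obj_carrier[OF True]]
        by (simp add: comp_functor_def compose_def induced_fst)
    qed (simp add: comp_functor_def compose_def induced_link_def)
  qed
  show "snd (comp_functor L (induced_link G R a) (induced_link G R b)) =
    snd (induced_link G R (compose (carrier G) a b))"
  proof
    fix f show "snd (comp_functor L (induced_link G R a) (induced_link G R b)) f =
      snd (induced_link G R (compose (carrier G) a b)) f"
    proof (cases "f \<in> Arr L")
      case True
      then obtain P Q g where *: "P \<in> Obj L" "Q \<in> Obj L" "g \<in> Tr P Q" "f = lc P Q g"
        by (rule ArrE)
      have g: "g \<in> carrier G" using *(3) TrD(1) by blast
      have "snd (comp_functor L (induced_link G R a) (induced_link G R b)) f =
          snd (induced_link G R a) (lc (b ` P) (b ` Q) (b g))"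
        using True * induced_snd[OF b(1)] by (simp add: comp_functor_def compose_def)
      also have "\<dots> = lc (a ` b ` P) (a ` b ` Q) (a (b g))"
        using induced_snd[OF a(1)] Obj_auto[OF b] Tr_auto[OF b(1) *(3)] * Obj_carrier by simp
      also have "\<dots> = snd (induced_link G R (compose (carrier G) a b)) f"
        using * g induced_snd[OF auto_compose[OF a(1) b(1)]] img[OF Obj_carrier]
        by (simp add: compose_def)
      finally show ?thesis .
    qed (simp add: comp_functor_def compose_def induced_link_def)
  qed
qed

lemma induced_id: "induced_link G R (\<lambda>x\<in>carrier G. x) = id_functor L"
proof (rule prod_eqI)
  have img: "(\<lambda>x\<in>carrier G. x) ` X = X" if "X \<subseteq> carrier G" for X
    using that by force
  show "fst (induced_link G R (\<lambda>x\<in>carrier G. x)) = fst (id_functor L)"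
    using img[OF Obj_carrier] by (auto simp: induced_link_def id_functor_def intro!: restrict_ext)
  show "snd (induced_link G R (\<lambda>x\<in>carrier G. x)) = snd (id_functor L)"
  proof
    fix f show "snd (induced_link G R (\<lambda>x\<in>carrier G. x)) f = snd (id_functor L) f"
    proof (cases "f \<in> Arr L")
      case True
      then obtain P Q g where *: "P \<in> Obj L" "Q \<in> Obj L" "g \<in> Tr P Q" "f = lc P Q g"
        by (rule ArrE)
      then show ?thesis
        using True TrD(1)[OF *(3)] induced_snd[OF id_in_auto] img[OF Obj_carrier]
        by (simp add: id_functor_def)
    qed (simp add: induced_link_def id_functor_def)
  qed
qed

lemma naturally_isomorphic_id: "naturally_isomorphic L (id_functor L) (id_functor L)"
proof -
  have "inverse_pair L X X (Ident L X) (Ident L X)" if X: "X \<in> Obj L" for X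
    using X Tr_one[OF _ Obj_carrier, of X X] Comp_lc[OF X X, of \<one> \<one> X]
    by (auto simp: inverse_pair_def Ident_L Mor_L)
  moreover have "Comp L (Ident L Y) f = Comp L f (Ident L X)"
    if X: "X \<in> Obj L" and Y: "Y \<in> Obj L" and f: "f \<in> Mor L X Y" for X Y f
  proof -
    obtain g where g: "g \<in> Tr X Y" "f = lc X Y g"
      using f by (rule MorE)
    then show ?thesis
      using X Y TrD(1)[OF g(1)] Tr_one[OF _ Obj_carrier, of X X]
      by (simp add: Ident_L Comp_lc)
  qed
  moreover have "f \<in> Arr L" if "X \<in> Obj L" "Y \<in> Obj L" "f \<in> Mor L X Y" for X Y f
    using that by (auto simp: Arr_def)
  ultimately show ?thesis
    unfolding naturally_isomorphic_def
    by (intro exI[of _ "Ident L"] conjI ballI exI[of _ "Ident L _"]) (simp_all add: id_functor_def)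
qed

text \<open>The inverse of \<open>a\<close> induces a strict inverse functor, so the natural
  isomorphisms in the definition of a self-equivalence can be taken to be identities.\<close>

lemma induced_in_Aut_link:
  assumes a: "a \<in> auto G" "a ` R = R"
  shows "induced_link G R a \<in> carrier (Aut_link G R)"
proof -
  define b where "b = restrict (inv_into (carrier G) a) (carrier G)"
  have b: "b \<in> auto G"
    using auto_inverse[OF a(1)] by (simp add: b_def)
  have ba: "compose (carrier G) b a = (\<lambda>x\<in>carrier G. x)"
    using a(1) Bij_compose_restrict_eq[of a "carrier G"] by (simp only: b_def auto_def Int_iff)
  have ab: "compose (carrier G) a b = (\<lambda>x\<in>carrier G. x)"
    using auto_image[OF a(1)] by (auto simp: b_def compose_def fun_eq_iff f_inv_into_f)
  have "b ` R = b ` a ` R"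
    using a(2) by simp
  also have "\<dots> = compose (carrier G) b a ` R"
    using R_carrier by (force simp: compose_def)
  also have "\<dots> = R"
    unfolding ba using R_carrier by force
  finally have bR: "b ` R = R" .
  have "self_equivalence L (induced_link G R a)"
    unfolding self_equivalence_def
    using endofunctor_induced[OF a] endofunctor_induced[OF b bR] naturally_isomorphic_id
      comp_induced[OF a b bR] comp_induced[OF b bR a]
    by (intro conjI exI[of _ "induced_link G R b"]) (simp_all only: ab ba induced_id)
  moreover have "snd (induced_link G R a) ` lc P P ` P =
      lc (fst (induced_link G R a) P) (fst (induced_link G R a) P) ` fst (induced_link G R a) P"
    if P: "P \<in> Obj L" for P
  proof -
    have "x \<in> Tr P P" if "x \<in> P" for x
      using that subgroup_Obj[OF P] Obj_carrier[OF P]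
      by (auto simp: Tr_def conj_set_def intro!: subgroup.m_closed subgroup.m_inv_closed)
    then have "snd (induced_link G R a) ` lc P P ` P = (\<lambda>x. lc (a ` P) (a ` P) (a x)) ` P"
      unfolding image_image using induced_snd[OF a(1) P P] by (intro image_cong) auto
    then show ?thesis
      by (simp add: induced_fst[OF P] image_image)
  qed
  moreover have "snd (induced_link G R a) (lc P Q \<one>) =
      lc (fst (induced_link G R a) P) (fst (induced_link G R a) Q) \<one>"
    if "P \<in> Obj L" "Q \<in> Obj L" "P \<subseteq> Q" for P Q
    using that induced_snd[OF a(1)] Tr_one[OF that(3) Obj_carrier]
      group_hom.hom_one[OF auto_group_hom[OF a(1)]]
    by (simp add: induced_fst)
  ultimately show ?thesis
    by (auto simp: Aut_link_def link_automorphism_def)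
qed

lemma rigid_induced:
  assumes a: "a \<in> auto G" and aR: "\<And>x. x \<in> R \<Longrightarrow> a x = x"
  shows "rigid G R (induced_link G R a)"
proof -
  have "g \<in> Tr R R" if "g \<in> R" for g
    using that subgroup_Obj[OF Obj_R] R_carrier
    by (auto simp: Tr_def conj_set_def intro!: subgroup.m_closed subgroup.m_inv_closed)
  moreover have "a ` R = R"
    using aR by simp
  ultimately show ?thesis
    using induced_snd[OF a Obj_R Obj_R] aR by (auto simp: rigid_def)
qed

section \<open>Inner automorphisms of the linking system\<close>

lemma conj_aut_R: "g \<in> Tr R R \<longleftrightarrow> g \<in> carrier G \<and> conj_aut G g ` R = R"
proof -
  have "conj_aut G g ` R = R" if g: "g \<in> carrier G" "conj_aut G g ` R \<subseteq> R"
  proof (rule card_subset_eq[OF _ g(2)])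
    show "finite R" using R_carrier fin finite_subset by blast
    show "card (conj_aut G g ` R) = card R"
      using card_image inj_on_subset[OF auto_inj[OF conj_aut_auto[OF g(1)]] R_carrier] by blast
  qed
  then show ?thesis
    by (auto simp: Tr_def conj_set_eq[OF R_carrier])
qed

text \<open>This evaluates the definite descriptions behind \<open>link_conj\<close>. Composition
  with an inclusion into \<open>R\<close> changes only the target label, so the restriction of the
  class of \<open>g\<close> to \<open>P\<close> is unique and is again the class of
  \<open>g\<close>, with inverse the class of \<open>inv g\<close>. Hence conjugation sends the
  class of \<open>h\<close> to the class of \<open>g h g^-1\<close>.\<close>

lemma link_conj_eq_induced:
  assumes g: "g \<in> Tr R R"
  shows "link_conj G R (lc R R g) = induced_link G R (conj_aut G g)"
proof -
  let ?c = "conj_aut G g" and ?\<gamma> = "lc R R g"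
  have gG: "g \<in> carrier G" and cR: "?c ` R = R"
    using g conj_aut_R by auto
  note c = conj_aut_auto[OF gG]
  have proj: "link_proj G ?\<gamma> x = ?c x" if x: "x \<in> R" for x
  proof -
    have xG: "x \<in> carrier G" using x R_carrier by blast
    \<comment> \<open>\<open>K R\<close> centralizes \<open>R\<close>, so all representatives of the
      coset conjugate \<open>x\<close> to the same element, and \<open>the_elem\<close> in
      \<open>link_proj\<close> meets a singleton.\<close>
    have "(\<lambda>h. h \<otimes> x \<otimes> inv h) ` (g <# K R) = {?c x}"
    proof -
      have "g \<otimes> k \<otimes> x \<otimes> inv (g \<otimes> k) = ?c x" if k: "k \<in> K R" for k
      proof -
        have kG: "k \<in> carrier G" and kx: "k \<otimes> x = x \<otimes> k"
          using k x K_eq[OF Obj_R] by (auto simp: centralizer_def)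
        have "g \<otimes> k \<otimes> x \<otimes> inv (g \<otimes> k) = g \<otimes> (k \<otimes> x) \<otimes> inv k \<otimes> inv g"
          using gG kG xG by (simp add: inv_mult_group m_assoc)
        also have "\<dots> = g \<otimes> x \<otimes> (k \<otimes> inv k) \<otimes> inv g"
          unfolding kx by (simp only: gG kG xG m_assoc m_closed inv_closed)
        also have "\<dots> = ?c x"
          using gG kG xG by (simp add: conj_aut_def)
        finally show ?thesis .
      qed
      moreover have "K R \<noteq> {}"
        using subgroup.one_closed[OF subgroup_K[OF Obj_R]] by blast
      ultimately show ?thesis
        by (auto simp: l_coset_def image_UN)
    qed
    then show ?thesis
      using x by (simp add: link_proj_def link_class_def)
  qed
  have proj_image: "link_proj G ?\<gamma> ` P = ?c ` P" if "P \<in> Obj L" for P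
    using proj that by (auto simp: Obj_L intro!: image_cong)
  have gTr: "g \<in> Tr P (?c ` P)" if "P \<in> Obj L" for P
    using gG conj_set_eq[OF Obj_carrier[OF that]] by (simp add: Tr_def)
  have inv_gTr: "inv g \<in> Tr (?c ` P) P" if P: "P \<in> Obj L" for P
  proof -
    have "inv g \<otimes> (?c x) \<otimes> inv (inv g) = x" if "x \<in> P" for x
    proof -
      have "x \<in> carrier G" using that Obj_carrier[OF P] by blast
      then have "compose (carrier G) (conj_aut G (inv g)) ?c x = x"
        using gG by (simp add: conj_aut_mult) (simp add: conj_aut_def)
      then show ?thesis
        using \<open>x \<in> carrier G\<close> conj_aut_closed[OF gG] by (simp add: compose_def conj_aut_def[of G "inv g"])
    qed
    then show ?thesis
      using gG by (auto simp: Tr_def conj_set_def)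
  qed
  note Obj_c = Obj_auto[OF c cR]
  have restr: "link_restrict G R ?\<gamma> P = lc P (?c ` P) g" if P: "P \<in> Obj L" for P
  proof -
    have 1: "Comp L (lc (?c ` P) R \<one>) (lc P (?c ` P) h) = lc P R h" if "h \<in> Tr P (?c ` P)" for h
      using Comp_lc[OF P Obj_c[OF P] that] TrD(1)[OF that] by simp
    have 2: "Comp L ?\<gamma> (lc P R \<one>) = lc P R g"
      using Comp_lc[OF P Obj_R Tr_one gG, of R] P gG R_carrier by (simp add: Obj_L)
    have 3: "lc P (?c ` P) h = lc P (?c ` P) g" if "lc P R h = lc P R g" for h
      using that by (simp add: link_class_def)
    show ?thesis
      unfolding link_restrict_def proj_image[OF P] 2
    proof (rule the_equality)
      show "lc P (?c ` P) g \<in> Mor L P (?c ` P) \<and>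
          Comp L (lc (?c ` P) R \<one>) (lc P (?c ` P) g) = lc P R g"
        using gTr[OF P] 1 by (auto simp: Mor_L)
    next
      fix \<phi> assume \<phi>: "\<phi> \<in> Mor L P (?c ` P) \<and> Comp L (lc (?c ` P) R \<one>) \<phi> = lc P R g"
      then obtain h where h: "h \<in> Tr P (?c ` P)" "\<phi> = lc P (?c ` P) h"
        by (blast elim: MorE)
      then show "\<phi> = lc P (?c ` P) g"
        using 3[of h] 1[OF h(1)] \<phi> by simp
    qed
  qed
  have inverse: "(THE r. inverse_pair L P (?c ` P) (lc P (?c ` P) g) r) = lc (?c ` P) P (inv g)"
    if P: "P \<in> Obj L" for P
  proof (rule the_equality)
    have "Comp L (lc (?c ` P) P (inv g)) (lc P (?c ` P) g) = lc P P \<one>"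
      "Comp L (lc P (?c ` P) g) (lc (?c ` P) P (inv g)) = lc (?c ` P) (?c ` P) \<one>"
      using Comp_lc[OF P Obj_c[OF P] gTr[OF P]] Comp_lc[OF Obj_c[OF P] P inv_gTr[OF P]] gG
      by simp_all
    then show "inverse_pair L P (?c ` P) (lc P (?c ` P) g) (lc (?c ` P) P (inv g))"
      using gTr[OF P] inv_gTr[OF P] unfolding inverse_pair_def Mor_L Ident_L by blast
  next
    fix r assume r: "inverse_pair L P (?c ` P) (lc P (?c ` P) g) r"
    then obtain h where h: "h \<in> Tr (?c ` P) P" "r = lc (?c ` P) P h"
      unfolding inverse_pair_def by (blast elim: MorE)
    have hG: "h \<in> carrier G" using h(1) TrD(1) by blast
    have "lc (?c ` P) (?c ` P) (g \<otimes> h) = lc (?c ` P) (?c ` P) \<one>"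
      using r h Comp_lc[OF Obj_c[OF P] P h(1) gG] by (simp add: inverse_pair_def Ident_L)
    then have "g \<otimes> h \<in> K (?c ` P)"
      using lc_eq_iff[OF Obj_c[OF P], of "g \<otimes> h" \<one>] gG hG by simp
    then show "r = lc (?c ` P) P (inv g)"
      using lc_eq_iff[OF Obj_c[OF P] hG, of "inv g"] gG h(2) by simp
  qed
  show ?thesis
  proof (rule prod_eqI)
    show "fst (link_conj G R ?\<gamma>) = fst (induced_link G R ?c)"
      using proj_image by (auto simp: link_conj_def induced_link_def Let_def intro!: restrict_ext)
    show "snd (link_conj G R ?\<gamma>) = snd (induced_link G R ?c)"
    proof
      fix f show "snd (link_conj G R ?\<gamma>) f = snd (induced_link G R ?c) f"
      proof (cases "f \<in> Arr L")
        case True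
        then obtain P Q h where *: "P \<in> Obj L" "Q \<in> Obj L" "h \<in> Tr P Q" "f = lc P Q h"
          by (rule ArrE)
        have hG: "h \<in> carrier G" using *(3) TrD(1) by blast
        have f: "fst f = P" "fst (snd f) = Q"
          using *(4) by (simp_all add: link_class_def)
        have "snd (link_conj G R ?\<gamma>) f =
            Comp L (lc Q (?c ` Q) g) (Comp L (lc P Q h) (lc (?c ` P) P (inv g)))"
          using True by (simp add: link_conj_def Let_def f restr[OF *(1)] restr[OF *(2)]
              proj_image[OF *(1)] inverse[OF *(1)]) (simp add: *(4))
        also have "\<dots> = lc (?c ` P) (?c ` Q) (g \<otimes> (h \<otimes> inv g))"
          using Comp_lc[OF Obj_c[OF *(1)] *(1) inv_gTr[OF *(1)] hG]
            Comp_lc[OF Obj_c[OF *(1)] *(2) Tr_mult[OF inv_gTr[OF *(1)] *(3)] gG]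
            Obj_carrier[OF Obj_c[OF *(1)]] by simp
        also have "\<dots> = snd (induced_link G R ?c) f"
          using induced_snd[OF c *(1-3)] *(4) gG hG by (simp add: conj_aut_def m_assoc)
        finally show ?thesis .
      qed (simp add: link_conj_def induced_link_def Let_def)
    qed
  qed
qed

lemma Inn_link_eq: "Inn_link G R = (\<lambda>g. induced_link G R (conj_aut G g)) ` Tr R R"
  unfolding Inn_link_def Mor_L image_image using link_conj_eq_induced by (rule image_cong[OF refl])

text \<open>If conjugation by \<open>g\<close> induces the same automorphism as \<open>a\<close>, then \<open>g\<close> centralizes \<open>R\<close>
  because \<open>R \<inter> O\<^sub>2\<^sub>'(C(R)) = 1\<close>, and the two maps agree on the normalizer of each object \<open>P\<close> with
  \<open>O\<^sub>2\<^sub>'(C(P)) = 1\<close>.\<close>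

lemma induced_not_in_Inn_link:
  assumes a: "a \<in> auto G" and aR: "\<And>x. x \<in> R \<Longrightarrow> a x = x"
    and ex: "\<And>g. g \<in> centralizer G R \<Longrightarrow>
      \<exists>P\<in>Obj L. K P = {\<one>} \<and> (\<exists>c\<in>Tr P P. g \<otimes> c \<otimes> inv g \<noteq> a c)"
  shows "induced_link G R a \<notin> Inn_link G R"
proof
  assume "induced_link G R a \<in> Inn_link G R"
  then obtain g where g: "g \<in> Tr R R" and eq: "induced_link G R a = induced_link G R (conj_aut G g)"
    by (auto simp: Inn_link_eq)
  have gG: "g \<in> carrier G" using g TrD(1) by blast
  have eq_lc: "lc (a ` P) (a ` P) (a c) = lc (a ` P) (a ` P) (conj_aut G g c)"
    if P: "P \<in> Obj L" and c: "c \<in> Tr P P" for P c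
  proof -
    have "a ` P = conj_aut G g ` P"
      using induced_fst[OF P, of a] induced_fst[OF P, of "conj_aut G g"] eq by simp
    then show ?thesis
      using induced_snd[OF a P P c] induced_snd[OF conj_aut_auto[OF gG] P P c] eq by simp
  qed
  have aP: "a ` P = P" if "P \<in> Obj L" for P
    using that aR by (force simp: Obj_L)
  have "g \<otimes> x = x \<otimes> g" if x: "x \<in> R" for x
  proof -
    have xG: "x \<in> carrier G" using x R_carrier by blast
    have xT: "x \<in> Tr R R"
      using x subgroup_Obj[OF Obj_R] R_carrier
      by (auto simp: Tr_def conj_set_def intro!: subgroup.m_closed subgroup.m_inv_closed)
    let ?y = "inv (conj_aut G g x) \<otimes> x"
    have "lc R R x = lc R R (conj_aut G g x)"
      using eq_lc[OF Obj_R xT] aP[OF Obj_R] aR[OF x] by simp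
    then have y: "?y \<in> K R"
      using lc_eq_iff[OF Obj_R xG conj_aut_closed[OF gG xG]] by simp
    have "conj_aut G g x \<in> R"
      using g x conj_aut_R by blast
    then have yR: "?y \<in> R"
      using x subgroup_Obj[OF Obj_R] by (simp add: subgroup.m_closed subgroup.m_inv_closed)
    obtain m :: nat where m: "odd m" "?y [^] m = \<one>"
      using y K_eq[OF Obj_R] by auto
    obtain k where "card R = 2 ^ k"
      using Obj_R by (auto simp: Obj_L two_centric_def)
    then have "?y [^] (2 ^ k :: nat) = \<one>"
      using subgroup_pow_card[OF subgroup_Obj[OF Obj_R] yR] by simp
    then have "?y = \<one>"
      using eq_one_if_coprime_pow_eq_one[of ?y m "2 ^ k"] m yR R_carrier by auto
    then have "conj_aut G g x = x"
      using conj_aut_closed[OF gG xG] xG by (rule eq_if_inv_mult_eq_one)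
    then show ?thesis
      using gG xG by (simp add: conj_aut_def inv_solve_right')
  qed
  then have "g \<in> centralizer G R"
    using gG by (simp add: centralizer_def)
  then obtain P c where P: "P \<in> Obj L" "K P = {\<one>}" and c: "c \<in> Tr P P" "g \<otimes> c \<otimes> inv g \<noteq> a c"
    using ex by blast
  have cG: "c \<in> carrier G" using c TrD(1) by blast
  have "lc P P (a c) = lc P P (conj_aut G g c)"
    using eq_lc[OF P(1) c(1)] aP[OF P(1)] by simp
  then have "inv (conj_aut G g c) \<otimes> a c = \<one>"
    using lc_eq_iff[OF P(1) auto_closed[OF a cG] conj_aut_closed[OF gG cG]] P(2) by simp
  then have "conj_aut G g c = a c"
    using conj_aut_closed[OF gG cG] auto_closed[OF a cG] by (rule eq_if_inv_mult_eq_one)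
  then show False
    using c(2) cG by (simp add: conj_aut_def)
qed

section \<open>Outer classes and the comparison map \<open>kappa\<close>\<close>

lemma mult_AutoGroup:
  "a \<in> auto G \<Longrightarrow> b \<in> auto G \<Longrightarrow> a \<otimes>\<^bsub>AutoGroup G\<^esub> b = compose (carrier G) a b"
  by (simp add: AutoGroup_def BijGroup_def auto_def)

lemma Inn_eq: "Inn G = conj_aut G ` carrier G"
  by (simp add: Inn_def conj_aut_def)

text \<open>As \<open>a\<close> preserves \<open>R\<close>, the representatives of its class that
  also do so are its composites with conjugation by elements of the normalizer of \<open>R\<close>.
  Their induced functors all lie in one coset of \<open>Inn_link G R\<close>, so the set under
  \<open>the_elem\<close> in \<open>kappa\<close> is a singleton.\<close>

lemma kappa_Out_class:
  assumes a: "a \<in> auto G" "a ` R = R"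
  shows "kappa G R (Out_class G a) = Out_link_class G R (induced_link G R a)"
proof -
  have aG: "a x \<in> carrier G" if "x \<in> carrier G" for x
    using auto_closed[OF a(1) that] .
  have assoc: "compose (carrier G) (conj_aut G g) (compose (carrier G) (conj_aut G h) a) =
      compose (carrier G) (conj_aut G (g \<otimes> h)) a" if "g \<in> carrier G" "h \<in> carrier G" for g h
    using compose_assoc[of a "carrier G" "carrier G" "conj_aut G g" "conj_aut G h"]
      conj_aut_mult[OF that] aG by auto
  have oc: "Out_class G a = (\<lambda>h. compose (carrier G) (conj_aut G h) a) ` carrier G"
    using mult_AutoGroup[OF conj_aut_auto a(1)]
    by (auto simp: Out_class_def Inn_eq r_coset_def image_iff)
  have Tr_RR: "h \<in> Tr R R" if "h \<in> carrier G" "compose (carrier G) (conj_aut G h) a ` R = R" for h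
  proof -
    have "conj_aut G h ` R = conj_aut G h ` a ` R"
      using a(2) by simp
    also have "\<dots> = compose (carrier G) (conj_aut G h) a ` R"
      using R_carrier by (force simp: compose_def)
    finally show ?thesis
      using that conj_aut_R by simp
  qed
  have link_class_eq: "Out_link_class G R (induced_link G R (compose (carrier G) (conj_aut G h) a)) =
      (\<lambda>g. induced_link G R (compose (carrier G) (conj_aut G g) a)) ` Tr R R"
    if h: "h \<in> Tr R R" for h
  proof -
    have hG: "h \<in> carrier G" using h TrD(1) by blast
    let ?b = "compose (carrier G) (conj_aut G h) a"
    have b: "?b \<in> auto G"
      using auto_compose[OF conj_aut_auto[OF hG] a(1)] .
    have "?b ` R = conj_aut G h ` a ` R"
      using R_carrier by (force simp: compose_def)
    then have bR: "?b ` R = R"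
      using h conj_aut_R a(2) by simp
    have mult: "comp_functor L (induced_link G R (conj_aut G g)) (induced_link G R ?b) =
        induced_link G R (compose (carrier G) (conj_aut G (g \<otimes> h)) a)" if g: "g \<in> Tr R R" for g
    proof -
      have gG: "g \<in> carrier G" "conj_aut G g ` R = R"
        using g conj_aut_R by auto
      show ?thesis
        using comp_induced[OF conj_aut_auto[OF gG(1)] gG(2) b bR] assoc[OF gG(1) hG] by simp
    qed
    have "Out_link_class G R (induced_link G R ?b) =
        (\<lambda>g. induced_link G R (compose (carrier G) (conj_aut G g) a)) ` (\<lambda>g. g \<otimes> h) ` Tr R R"
      using mult by (auto simp: Out_link_class_def r_coset_def Inn_link_eq Aut_link_def image_iff)
    also have "(\<lambda>g. g \<otimes> h) ` Tr R R = Tr R R"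
    proof (rule endo_inj_surj)
      show "finite (Tr R R)"
        using fin by (simp add: Tr_def)
      show "(\<lambda>g. g \<otimes> h) ` Tr R R \<subseteq> Tr R R"
        using Tr_mult[OF h _ R_carrier] by auto
      show "inj_on (\<lambda>g. g \<otimes> h) (Tr R R)"
        using hG TrD(1) by (auto simp: inj_on_def)
    qed
    finally show ?thesis .
  qed
  have one: "compose (carrier G) (conj_aut G \<one>) a = a"
    using aG a(1) by (auto simp: conj_aut_def compose_def fun_eq_iff auto_def Bij_def
        extensional_def)
  have oneT: "\<one> \<in> Tr R R"
    using Tr_one R_carrier by simp
  have "(\<lambda>b. Out_link_class G R (induced_link G R b)) ` {b \<in> Out_class G a. b ` R = R} =
      {Out_link_class G R (induced_link G R a)}"
  proof -
    have "a \<in> Out_class G a"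
      unfolding oc using one by (metis imageI one_closed)
    moreover have "Out_link_class G R (induced_link G R b) = Out_link_class G R (induced_link G R a)"
      if b: "b \<in> Out_class G a" "b ` R = R" for b
    proof -
      obtain h where h: "h \<in> carrier G" "b = compose (carrier G) (conj_aut G h) a"
        using b(1) oc by blast
      show ?thesis
        using link_class_eq[OF Tr_RR[OF h(1)]] link_class_eq[OF oneT] b(2) h(2) one by simp
    qed
    ultimately show ?thesis
      using a(2) by blast
  qed
  then show ?thesis
    by (simp add: kappa_def)
qed

end

section \<open>Quadratic spaces\<close>

locale quad_space = vector_space scale
  for scale :: "'k::field \<Rightarrow> 'v::ab_group_add \<Rightarrow> 'v" +
  fixes Q :: "'v \<Rightarrow> 'k"
  assumes quadratic: "quadratic_form scale Q" and nondeg: "nondegenerate Q"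
    and two: "(2::'k) \<noteq> 0" and fin_space: "finite (UNIV :: 'v set)"
    and nontrivial: "\<exists>x::'v. x \<noteq> 0"
begin

abbreviation "B \<equiv> polar Q"
abbreviation "OG \<equiv> O_group scale Q"
abbreviation "PO \<equiv> PO_group scale Q"
abbreviation "\<pi> \<equiv> PO_class scale Q"
abbreviation "\<Omega> \<equiv> Omega scale Q"
abbreviation "H \<equiv> POmega scale Q"
abbreviation "r \<equiv> reflection scale Q"

lemma Q_scale: "Q (scale c v) = c\<^sup>2 * Q v"
  using quadratic by (simp add: quadratic_form_def)

lemma B_add_right: "B u (v + w) = B u v + B u w"
  and B_scale_right: "B u (scale c v) = c * B u v"
  and B_add_left: "B (v + w) u = B v u + B w u"
  and B_scale_left: "B (scale c v) u = c * B v u"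
  using quadratic by (simp_all add: quadratic_form_def Vector_Spaces.linear_iff)

lemma B_commute: "B u v = B v u"
  by (simp add: polar_def add.commute)

lemma B_zero_left [simp]: "B 0 u = 0" and B_zero_right [simp]: "B u 0 = 0"
  using B_scale_left[of 0 0 u] B_scale_right[of u 0 0] by simp_all

lemma B_minus_left [simp]: "B (- v) u = - B v u"
  using B_scale_left[of "-1" v u] by simp

lemma B_minus_right [simp]: "B u (- v) = - B u v"
  using B_scale_right[of u "-1" v] by simp

lemma B_diff_left: "B (v - w) u = B v u - B w u"
  using B_add_left[of v "- w" u] by simp

lemma B_diff_right: "B u (v - w) = B u v - B u w"
  using B_add_right[of u v "- w"] by simp

lemma B_sum_left: "B (\<Sum>i\<in>A. f i) u = (\<Sum>i\<in>A. B (f i) u)"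
  by (induction A rule: infinite_finite_induct) (simp_all add: B_add_left)

lemma Q_add: "Q (u + v) = Q u + Q v + B u v"
  by (simp add: polar_def)

lemma Q_zero [simp]: "Q 0 = 0"
  using Q_scale[of 0 0] by simp

lemma Q_minus [simp]: "Q (- v) = Q v"
  using Q_scale[of "-1" v] by simp

text \<open>The polar form counts \<open>Q\<close> twice on the diagonal; this is the origin of the
  factors \<open>2 * a\<close> in the computations with basis vectors of norm
  \<open>a\<close>.\<close>

lemma B_self: "B v v = 2 * Q v"
proof -
  have "v + v = scale 2 v"
    by (metis one_add_one scale_left_distrib scale_one)
  then show ?thesis
    by (simp add: polar_def Q_scale)
qed

lemma B_self_eq_0_iff [simp]: "B v v = 0 \<longleftrightarrow> Q v = 0"
  using two by (simp add: B_self)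

lemma Q_diff: "Q (u - v) = Q u + Q v - B u v"
  using Q_add[of u "- v"] by simp

lemma eq_minus_iff: "(v::'v) = - v \<longleftrightarrow> v = 0"
proof
  assume "v = - v"
  then have "scale 2 v = 0"
    by (metis add.right_inverse one_add_one scale_left_distrib scale_one)
  then show "v = 0" using two by simp
qed simp

lemma exists_anisotropic: "\<exists>v. Q v \<noteq> 0"
proof (rule ccontr)
  assume "\<nexists>v. Q v \<noteq> 0"
  then have "B u v = 0" for u v
    by (simp add: polar_def)
  then show False
    using nondeg nontrivial by (auto simp: nondegenerate_def)
qed

section \<open>The orthogonal group and its quotient\<close>

lemma carrier_OG:
  "g \<in> carrier OG \<longleftrightarrow> Vector_Spaces.linear scale scale g \<and> bij g \<and> (\<forall>v. Q (g v) = Q v)"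
  by (simp add: O_group_def)

lemma OG_linear:
  assumes "g \<in> carrier OG"
  shows "g (u + v) = g u + g v" "g (scale c v) = scale c (g v)" "g (- v) = - g v"
    "g (u - v) = g u - g v" "g 0 = 0"
proof -
  have lin: "Vector_Spaces.linear scale scale g"
    using assms by (simp add: carrier_OG)
  show add: "g (u + v) = g u + g v" for u v
    using lin by (simp add: Vector_Spaces.linear_iff)
  show sc: "g (scale c v) = scale c (g v)" for c v
    using lin by (simp add: Vector_Spaces.linear_iff)
  show neg: "g (- v) = - g v" for v
    using sc[of "-1" v] by simp
  show "g (u - v) = g u - g v"
    using add[of u "- v"] neg[of v] by simp
  show "g 0 = 0"
    using sc[of 0 0] by simp
qed

lemma OG_Q: "g \<in> carrier OG \<Longrightarrow> Q (g v) = Q v"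
  by (simp add: carrier_OG)

lemma OG_B: "g \<in> carrier OG \<Longrightarrow> B (g u) (g v) = B u v"
  by (simp add: polar_def OG_Q OG_linear(1)[symmetric])

lemma OG_I:
  assumes "\<And>u v. g (u + v) = g u + g v" "\<And>c v. g (scale c v) = scale c (g v)"
    "\<And>v. Q (g v) = Q v" "bij g"
  shows "g \<in> carrier OG"
  using assms vector_space_axioms by (simp add: carrier_OG Vector_Spaces.linear_iff)

lemma mult_OG: "g \<in> carrier OG \<Longrightarrow> h \<in> carrier OG \<Longrightarrow> g \<otimes>\<^bsub>OG\<^esub> h = g \<circ> h"
  by (auto simp: O_group_def BijGroup_def Bij_def compose_def fun_eq_iff)

lemma one_OG: "\<one>\<^bsub>OG\<^esub> = id"
  by (simp add: O_group_def BijGroup_def fun_eq_iff)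

lemma comp_OG: "g \<in> carrier OG \<Longrightarrow> h \<in> carrier OG \<Longrightarrow> g \<circ> h \<in> carrier OG"
  by (intro OG_I) (auto simp: OG_linear OG_Q carrier_OG intro: bij_comp)

lemma id_OG: "id \<in> carrier OG"
  by (intro OG_I) auto

lemma inv_OG_closed:
  assumes g: "g \<in> carrier OG"
  shows "Hilbert_Choice.inv g \<in> carrier OG"
proof (rule OG_I)
  have b: "bij g" using g by (simp add: carrier_OG)
  then show "bij (Hilbert_Choice.inv g)" by (rule bij_imp_bij_inv)
  have i: "g (Hilbert_Choice.inv g v) = v" for v
    using b by (simp add: bij_is_surj surj_f_inv_f)
  have j: "Hilbert_Choice.inv g (g v) = v" for v
    using b by (simp add: bij_is_inj)
  show "Hilbert_Choice.inv g (u + v) = Hilbert_Choice.inv g u + Hilbert_Choice.inv g v" for u v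
    using j[of "Hilbert_Choice.inv g u + Hilbert_Choice.inv g v"] by (simp add: OG_linear[OF g] i)
  show "Hilbert_Choice.inv g (scale c v) = scale c (Hilbert_Choice.inv g v)" for c v
    using j[of "scale c (Hilbert_Choice.inv g v)"] by (simp add: OG_linear[OF g] i)
  show "Q (Hilbert_Choice.inv g v) = Q v" for v
    using OG_Q[OF g, of "Hilbert_Choice.inv g v"] by (simp add: i)
qed

lemma inv_comp_OG:
  assumes "g \<in> carrier OG"
  shows "Hilbert_Choice.inv g \<circ> g = id" "g \<circ> Hilbert_Choice.inv g = id"
proof -
  have "bij g" using assms by (simp add: carrier_OG)
  then show "Hilbert_Choice.inv g \<circ> g = id" "g \<circ> Hilbert_Choice.inv g = id"
    by (simp_all add: bij_is_inj bij_is_surj surj_iff[symmetric])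
qed

sublocale OG: group OG
proof (rule groupI)
  fix x assume x: "x \<in> carrier OG"
  show "\<exists>y\<in>carrier OG. y \<otimes>\<^bsub>OG\<^esub> x = \<one>\<^bsub>OG\<^esub>"
    using x inv_OG_closed[OF x] by (intro bexI[of _ "Hilbert_Choice.inv x"])
      (simp_all add: mult_OG one_OG inv_comp_OG)
qed (simp_all add: mult_OG one_OG comp_OG id_OG comp_assoc)

lemma inv_OG: "g \<in> carrier OG \<Longrightarrow> inv\<^bsub>OG\<^esub> g = Hilbert_Choice.inv g"
  by (intro OG.inv_equality) (simp_all add: mult_OG one_OG inv_OG_closed inv_comp_OG)

lemma finite_OG: "finite (carrier OG)"
proof -
  have "finite (UNIV \<rightarrow>\<^sub>E (UNIV :: 'v set) :: ('v \<Rightarrow> 'v) set)"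
    using fin_space by (intro finite_PiE) auto
  then show ?thesis
    by (rule finite_subset[rotated]) auto
qed

lemma uminus_OG: "uminus \<in> carrier OG"
  by (intro OG_I) (auto simp: bij_uminus)

text \<open>Comparing norms on an anisotropic vector leaves only scalars with square 1. Elements of
  \<open>PO\<close> are therefore pairs of \<open>g\<close> and \<open>uminus \<circ> g\<close>, and
  commuting in \<open>PO\<close> means commuting or anticommuting in \<open>OG\<close>.\<close>

lemma O_scalars_eq: "O_scalars scale Q = {id, uminus}"
proof
  show "O_scalars scale Q \<subseteq> {id, uminus}"
  proof
    fix g assume "g \<in> O_scalars scale Q"
    then obtain c where c: "g = scale c" "g \<in> carrier OG"
      by (auto simp: O_scalars_def)
    obtain v where v: "Q v \<noteq> 0" using exists_anisotropic by blast
    have "c\<^sup>2 * Q v = Q v"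
      using OG_Q[OF c(2), of v] c(1) by (simp add: Q_scale)
    then have "c = 1 \<or> c = -1"
      using v by (simp add: power2_eq_1_iff)
    then show "g \<in> {id, uminus}"
      using c(1) by (auto simp: fun_eq_iff)
  qed
  have "id = scale 1" "uminus = scale (-1)"
    by (auto simp: fun_eq_iff)
  then show "{id, uminus} \<subseteq> O_scalars scale Q"
    using id_OG uminus_OG unfolding O_scalars_def by blast
qed

lemma uminus_comp: "g \<in> carrier OG \<Longrightarrow> uminus \<circ> g = g \<circ> uminus"
  by (auto simp: OG_linear)

lemma normal_O_scalars: "O_scalars scale Q \<lhd> OG"
proof (rule OG.normal_invI)
  show "subgroup (O_scalars scale Q) OG"
  proof (rule OG.subgroupI)
    show "O_scalars scale Q \<subseteq> carrier OG" "O_scalars scale Q \<noteq> {}"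
      using id_OG uminus_OG by (auto simp: O_scalars_eq)
  next
    fix a assume "a \<in> O_scalars scale Q"
    moreover have "inv\<^bsub>OG\<^esub> uminus = uminus"
      using uminus_OG by (intro OG.inv_equality) (auto simp: mult_OG one_OG fun_eq_iff)
    ultimately show "inv\<^bsub>OG\<^esub> a \<in> O_scalars scale Q"
      using OG.inv_one by (auto simp: O_scalars_eq one_OG)
  next
    fix a b assume ab: "a \<in> O_scalars scale Q" "b \<in> O_scalars scale Q"
    then have "a \<otimes>\<^bsub>OG\<^esub> b = a \<circ> b"
      using id_OG uminus_OG by (intro mult_OG) (auto simp: O_scalars_eq)
    moreover have "uminus \<circ> uminus = (id :: 'v \<Rightarrow> 'v)"
      by (simp add: fun_eq_iff)
    ultimately show "a \<otimes>\<^bsub>OG\<^esub> b \<in> O_scalars scale Q"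
      using ab by (auto simp: O_scalars_eq)
  qed
next
  fix x h assume x: "x \<in> carrier OG" and h: "h \<in> O_scalars scale Q"
  have hG: "h \<in> carrier OG"
    using h id_OG uminus_OG by (auto simp: O_scalars_eq)
  have "h \<circ> x = x \<circ> h"
    using h uminus_comp[OF x] by (auto simp: O_scalars_eq)
  then have "x \<otimes>\<^bsub>OG\<^esub> h \<otimes>\<^bsub>OG\<^esub> inv\<^bsub>OG\<^esub> x = h"
    using x hG by (simp add: mult_OG[symmetric] OG.inv_solve_right')
  then show "x \<otimes>\<^bsub>OG\<^esub> h \<otimes>\<^bsub>OG\<^esub> inv\<^bsub>OG\<^esub> x \<in> O_scalars scale Q"
    using h by simp
qed

sublocale PO: group PO
  unfolding PO_group_def using normal.factorgroup_is_group[OF normal_O_scalars] .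

sublocale \<pi>: group_hom OG PO \<pi>
proof unfold_locales
  have "\<pi> = (\<lambda>a. O_scalars scale Q #>\<^bsub>OG\<^esub> a)"
    by (simp add: PO_class_def fun_eq_iff)
  then show "\<pi> \<in> hom OG PO"
    using normal.r_coset_hom_Mod[OF normal_O_scalars] by (simp add: PO_group_def)
qed

lemma \<pi>_eq: "g \<in> carrier OG \<Longrightarrow> \<pi> g = {g, uminus \<circ> g}"
  using id_OG uminus_OG by (auto simp: PO_class_def r_coset_def O_scalars_eq mult_OG)

lemma \<pi>_eq_iff:
  assumes "g \<in> carrier OG" "h \<in> carrier OG"
  shows "\<pi> g = \<pi> h \<longleftrightarrow> g = h \<or> g = uminus \<circ> h"
proof -
  have "uminus \<circ> (uminus \<circ> h) = h"
    by (simp add: fun_eq_iff)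
  then show ?thesis
    using assms by (auto simp: \<pi>_eq doubleton_eq_iff)
qed

lemma \<pi>_surj: "\<pi> ` carrier OG = carrier PO"
  by (simp add: PO_group_def carrier_FactGroup PO_class_def image_def)

lemma \<pi>_comp: "g \<in> carrier OG \<Longrightarrow> h \<in> carrier OG \<Longrightarrow> \<pi> (g \<circ> h) = \<pi> g \<otimes>\<^bsub>PO\<^esub> \<pi> h"
  using \<pi>.hom_mult[of g h] by (simp add: mult_OG)

lemma finite_PO: "finite (carrier PO)"
  using finite_OG \<pi>_surj by (metis finite_imageI)

lemma normal_\<Omega>: "\<Omega> \<lhd> OG"
  unfolding Omega_def using OG.derived_is_normal[OF OG.normal_self] .

lemma \<Omega>_OG: "g \<in> \<Omega> \<Longrightarrow> g \<in> carrier OG"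
  using subgroup.mem_carrier[OF normal_imp_subgroup[OF normal_\<Omega>]] .

lemma commutator_\<Omega>:
  assumes "g \<in> carrier OG" "h \<in> carrier OG"
  shows "g \<circ> h \<circ> Hilbert_Choice.inv g \<circ> Hilbert_Choice.inv h \<in> \<Omega>"
proof -
  have "g \<otimes>\<^bsub>OG\<^esub> h \<otimes>\<^bsub>OG\<^esub> inv\<^bsub>OG\<^esub> g \<otimes>\<^bsub>OG\<^esub> inv\<^bsub>OG\<^esub> h \<in> derived_set OG (carrier OG)"
    using assms by (intro UN_I[of g] UN_I[of h]) simp_all
  then have "g \<otimes>\<^bsub>OG\<^esub> h \<otimes>\<^bsub>OG\<^esub> inv\<^bsub>OG\<^esub> g \<otimes>\<^bsub>OG\<^esub> inv\<^bsub>OG\<^esub> h \<in> \<Omega>"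
    unfolding Omega_def derived_def by (rule generate.incl)
  then show ?thesis
    using assms by (simp add: mult_OG inv_OG inv_OG_closed comp_OG)
qed

lemma carrier_H: "carrier H = \<pi> ` \<Omega>"
  by (simp add: POmega_def)

lemma mult_H: "x \<otimes>\<^bsub>H\<^esub> y = x \<otimes>\<^bsub>PO\<^esub> y" and one_H: "\<one>\<^bsub>H\<^esub> = \<one>\<^bsub>PO\<^esub>"
  by (simp_all add: POmega_def)

lemma normal_H: "\<pi> ` \<Omega> \<lhd> PO"
  using normal.surj_hom_normal_subgroup[OF normal_\<Omega> \<pi>.group_hom_axioms \<pi>_surj] .

sublocale H: group H
  unfolding POmega_def using PO.subgroup_imp_group[OF normal_imp_subgroup[OF normal_H]] .

lemma H_PO: "x \<in> carrier H \<Longrightarrow> x \<in> carrier PO"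
  using \<Omega>_OG by (auto simp: carrier_H)

lemma inv_H: "x \<in> carrier H \<Longrightarrow> inv\<^bsub>H\<^esub> x = inv\<^bsub>PO\<^esub> x"
  unfolding POmega_def using PO.m_inv_consistent[OF normal_imp_subgroup[OF normal_H]] by simp

lemma finite_H: "finite (carrier H)"
  by (rule finite_subset[OF _ finite_PO]) (use H_PO in blast)

section \<open>Reflections\<close>

lemma reflection_eq: "r w v = v - scale (B v w / Q w) w"
  using two by (simp add: reflection_def B_self)

lemma reflection_minus: "r (- w) = r w"
  by (simp add: fun_eq_iff reflection_eq)

context
  fixes w assumes w: "Q w \<noteq> 0"
begin

lemma reflection_self: "r w w = - w"
proof -
  have "r w w = w - scale 2 w"
    using w by (simp add: reflection_eq B_self)
  also have "scale 2 w = w + w"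
    by (metis one_add_one scale_left_distrib scale_one)
  finally show ?thesis by simp
qed

lemma reflection_orthogonal: "B v w = 0 \<Longrightarrow> r w v = v"
  by (simp add: reflection_eq)

lemma reflection_add: "r w (u + v) = r w u + r w v"
  by (simp add: reflection_eq B_add_left add_divide_distrib scale_left_distrib algebra_simps)

lemma reflection_scale: "r w (scale c v) = scale c (r w v)"
  by (simp add: reflection_eq B_scale_left scale_right_diff_distrib)

lemma reflection_invol: "r w (r w v) = v"
proof -
  let ?c = "B v w / Q w"
  have "r w (r w v) = r w (v + scale (- ?c) w)"
    by (subst (2) reflection_eq) simp
  also have "\<dots> = r w v + scale (- ?c) (- w)"
    by (simp only: reflection_add reflection_scale reflection_self)
  also have "\<dots> = v"
    by (simp add: reflection_eq)
  finally show ?thesis .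
qed

lemma reflection_comp: "r w \<circ> r w = id"
  by (simp add: fun_eq_iff reflection_invol)

lemma reflection_OG: "r w \<in> carrier OG"
proof (intro OG_I)
  show "Q (r w v) = Q v" for v
    using w by (simp add: reflection_eq Q_diff Q_scale B_scale_right power2_eq_square field_simps)
  show "bij (r w)"
    using reflection_comp o_bij by blast
qed (simp_all add: reflection_add reflection_scale)

lemma reflection_inv: "Hilbert_Choice.inv (r w) = r w"
  using reflection_comp by (metis comp_id fun.map_id0 id_comp inv_comp_OG(1) o_assoc reflection_OG)

lemma reflection_conj: "g \<in> carrier OG \<Longrightarrow> g \<circ> r w = r (g w) \<circ> g"
  by (simp add: fun_eq_iff reflection_eq OG_linear OG_B OG_Q)

lemma B_reflection: "B (r w u) v = B u (r w v)"
  using OG_B[OF reflection_OG, of u "r w v"] by (simp add: reflection_invol)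

end

end

context group
begin

text \<open>Here \<open>P\<close> coincides with its center and with its centralizer, which makes
  the Sylow condition trivial once \<open>P\<close> is known to be a 2-group. An element of odd
  order whose square is 1 is trivial.\<close>

lemma self_centralizing_two_centric:
  assumes fin: "finite (carrier G)" and P: "subgroup P G" "centralizer G P = P"
    and sq: "\<And>x. x \<in> P \<Longrightarrow> x \<otimes> x = \<one>"
  shows "two_centric G P" "odd_core_centralizer G P = {\<one>}"
proof -
  have sq': "x [^] (2::nat) = \<one>" if "x \<in> P" for x
    using sq[OF that] subgroup.mem_carrier[OF P(1) that] by (simp add: numeral_2_eq_2)
  have "\<exists>k. x [^] (2 ^ k :: nat) = \<one>" if "x \<in> P" for x
    using sq'[OF that] by (intro exI[of _ 1]) simp
  then obtain k where k: "card P = 2 ^ k"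
    using subgroup_card_power_of_two[OF fin P(1)] by blast
  then show two: "two_centric G P"
    using P by (auto simp: two_centric_iff center_of_def multiplicity_prime_power)
  have "x = \<one>" if x: "x \<in> P" "x [^] (m::nat) = \<one>" "odd m" for x m
    using eq_one_if_coprime_pow_eq_one[OF subgroup.mem_carrier[OF P(1) x(1)] x(2) sq'[OF x(1)]] x(3)
    by simp
  moreover have "\<exists>m::nat. odd m \<and> \<one> [^] m = \<one>"
    by (intro exI[of _ 1]) simp
  ultimately show "odd_core_centralizer G P = {\<one>}"
    unfolding odd_core_centralizer_eq(1)[OF fin two] P(2)
    using subgroup.one_closed[OF P(1)] by blast
qed

end

context quad_space
begin

definition refl2 :: "(nat \<Rightarrow> 'v) \<Rightarrow> nat \<Rightarrow> nat \<Rightarrow> 'v \<Rightarrow> 'v" where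
  "refl2 b i j = r (b i) \<circ> r (b j)"

definition E_set :: "nat \<Rightarrow> (nat \<Rightarrow> 'v) \<Rightarrow> ('v \<Rightarrow> 'v) set set" where
  "E_set m b = {\<pi> (refl2 b i j) |i j. i < m \<and> j < m \<and> i \<noteq> j}"

text \<open>A centralizer is taken rather than the subgroup generated by \<open>E_set m b\<close>:
  the inclusion of \<open>centralizer H (P_grp m b)\<close> in \<open>P_grp m b\<close> then needs
  only that \<open>P_grp m b\<close> contains \<open>E_set m b\<close>. The vector
  \<open>b m\<close> is left out of \<open>E_set\<close> because the proof that double reflections
  lie in \<open>\<Omega>\<close> swaps two vectors of equal norm.\<close>

definition P_grp :: "nat \<Rightarrow> (nat \<Rightarrow> 'v) \<Rightarrow> ('v \<Rightarrow> 'v) set set" where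
  "P_grp m b = centralizer H (E_set m b)"

lemma \<pi>_commute_iff:
  assumes "g \<in> carrier OG" "h \<in> carrier OG"
  shows "\<pi> g \<otimes>\<^bsub>PO\<^esub> \<pi> h = \<pi> h \<otimes>\<^bsub>PO\<^esub> \<pi> g \<longleftrightarrow> g \<circ> h = h \<circ> g \<or> g \<circ> h = uminus \<circ> (h \<circ> g)"
  using assms by (simp add: \<pi>_comp[symmetric] \<pi>_eq_iff comp_OG)

end

section \<open>Orthogonal bases with one exceptional square class\<close>

text \<open>An orthogonal basis \<open>b\<^sub>0, \<dots>, b\<^sub>m\<close>, where \<open>Q(b\<^sub>m)\<close> lies in the square class different from that of all
  the other \<open>Q(b\<^sub>i)\<close>. That it spans is expressed as separation by the coordinates.\<close>

locale frame = quad_space scale Q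
  for scale :: "'k::field \<Rightarrow> 'v::ab_group_add \<Rightarrow> 'v" and Q +
  fixes m :: nat and b :: "nat \<Rightarrow> 'v" and a :: 'k
  assumes m5: "5 \<le> m" and a0: "a \<noteq> 0"
    and orth: "i \<le> m \<Longrightarrow> j \<le> m \<Longrightarrow> i \<noteq> j \<Longrightarrow> B (b i) (b j) = 0"
    and Qb: "i < m \<Longrightarrow> Q (b i) = a"
    and Q_last: "Q (b m) \<noteq> c\<^sup>2 * a"
    and separating: "(\<And>i. i \<le> m \<Longrightarrow> B x (b i) = 0) \<Longrightarrow> x = 0"
begin

lemma other_index: "\<exists>j<m. j \<noteq> k \<and> j \<noteq> l"
proof -
  have "\<exists>j\<in>{0, 1, 2}. j \<noteq> k \<and> j \<noteq> l"
    by (cases "k = 0"; cases "l = 0"; cases "k = 1"; cases "l = 1") auto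
  then obtain j where "j \<in> {0, 1, 2}" "j \<noteq> k \<and> j \<noteq> l" ..
  moreover from this(1) have "j < m"
    using m5 by auto
  ultimately show ?thesis by blast
qed

lemma Qb_nz: "i \<le> m \<Longrightarrow> Q (b i) \<noteq> 0"
  \<comment> \<open>\<open>Q_last\<close> holds for every \<open>c\<close>; its instance 0 says that
    the last vector is anisotropic.\<close>
  using Qb[of i] a0 Q_last[of 0] by (cases "i = m") auto

lemma b_nz: "i \<le> m \<Longrightarrow> b i \<noteq> 0"
  using Qb_nz[of i] by auto

lemma b_neq_minus: "i \<le> m \<Longrightarrow> b i \<noteq> - b i"
  using b_nz eq_minus_iff by blast

lemma eqI:
  assumes "\<And>i. i \<le> m \<Longrightarrow> B x (b i) = B y (b i)"
  shows "x = y"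
  using separating[of "x - y"] assms by (simp add: B_diff_left)

lemma refl_OG: "i \<le> m \<Longrightarrow> r (b i) \<in> carrier OG"
  using reflection_OG Qb_nz by blast

lemma refl_b: "i \<le> m \<Longrightarrow> j \<le> m \<Longrightarrow> r (b i) (b j) = (if i = j then - b j else b j)"
  using reflection_self[OF Qb_nz] reflection_orthogonal[OF Qb_nz] orth[of j i] by auto

lemma B_refl: "i \<le> m \<Longrightarrow> j \<le> m \<Longrightarrow> B (r (b i) x) (b j) = (if i = j then - B x (b j) else B x (b j))"
  using B_reflection[OF Qb_nz[of i], of x "b j"] refl_b[of i j] by auto

lemma refl2_OG: "i \<le> m \<Longrightarrow> j \<le> m \<Longrightarrow> refl2 b i j \<in> carrier OG"
  using refl_OG comp_OG by (simp add: refl2_def)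

lemma refl2_b:
  "i \<le> m \<Longrightarrow> j \<le> m \<Longrightarrow> l \<le> m \<Longrightarrow> i \<noteq> j \<Longrightarrow>
    refl2 b i j (b l) = (if l = i \<or> l = j then - b l else b l)"
  using OG_linear(3)[OF refl_OG[of i]] by (auto simp: refl2_def refl_b)

lemma B_refl2:
  "i \<le> m \<Longrightarrow> j \<le> m \<Longrightarrow> l \<le> m \<Longrightarrow> i \<noteq> j \<Longrightarrow>
    B (refl2 b i j x) (b l) = (if l = i \<or> l = j then - B x (b l) else B x (b l))"
  by (auto simp: refl2_def B_refl)

lemma eq_neg_0: "x = - x \<Longrightarrow> x = (0::'k)"
proof -
  assume "x = - x"
  then have "2 * x = 0" by (metis add.right_inverse mult_2)
  then show "x = 0" using two by simp
qed

lemma eq_scale_b: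
  assumes "i \<le> m" "\<And>l. l \<le> m \<Longrightarrow> l \<noteq> i \<Longrightarrow> B x (b l) = 0"
  shows "x = scale (B x (b i) / B (b i) (b i)) (b i)"
proof (rule eqI)
  fix l assume l: "l \<le> m"
  show "B x (b l) = B (scale (B x (b i) / B (b i) (b i)) (b i)) (b l)"
    using assms l Qb_nz[OF assms(1)] orth[of i l] by (cases "l = i") (auto simp: B_scale_left)
qed

definition diag :: "('v \<Rightarrow> 'v) \<Rightarrow> bool" where
  "diag g \<longleftrightarrow> (\<forall>i\<le>m. g (b i) = b i \<or> g (b i) = - b i)"

text \<open>\<open>B (g x) (g (b i)) = B x (b i)\<close>, and \<open>g (b i)\<close> is
  \<open>b i\<close> up to sign. So a diagonal isometry multiplies each coordinate by a sign, and
  identities between such isometries can be checked coordinatewise with \<open>eqI\<close>.\<close>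

lemma diag_sign:
  assumes "g \<in> carrier OG" "diag g" "i \<le> m"
  shows "\<exists>e. (e = 1 \<or> e = -1) \<and> (\<forall>x. B (g x) (b i) = e * B x (b i))"
proof (cases "g (b i) = b i")
  case True
  then show ?thesis
    using OG_B[OF assms(1), of _ "b i"] by (intro exI[of _ 1]) simp
next
  case False
  then have "g (b i) = - b i"
    using assms by (auto simp: diag_def)
  then have "B (g x) (b i) = - B x (b i)" for x
    using OG_B[OF assms(1), of x "b i"] by (metis B_minus_right minus_minus)
  then show ?thesis
    by (intro exI[of _ "-1"]) simp
qed

lemma diag_commute:
  assumes g: "g \<in> carrier OG" "diag g" and h: "h \<in> carrier OG" "diag h"
  shows "g \<circ> h = h \<circ> g"
proof
  fix x show "(g \<circ> h) x = (h \<circ> g) x"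
  proof (rule eqI)
    fix i assume i: "i \<le> m"
    obtain e where e: "\<And>x. B (g x) (b i) = e * B x (b i)"
      using diag_sign[OF g i] by blast
    obtain f where f: "\<And>x. B (h x) (b i) = f * B x (b i)"
      using diag_sign[OF h i] by blast
    show "B ((g \<circ> h) x) (b i) = B ((h \<circ> g) x) (b i)"
      by (simp add: e f)
  qed
qed

lemma diag_square:
  assumes g: "g \<in> carrier OG" "diag g"
  shows "g \<circ> g = id"
proof
  fix x show "(g \<circ> g) x = id x"
  proof (rule eqI)
    fix i assume "i \<le> m"
    then obtain e where "e = 1 \<or> e = -1" "\<And>x. B (g x) (b i) = e * B x (b i)"
      using diag_sign[OF g] by blast
    then show "B ((g \<circ> g) x) (b i) = B (id x) (b i)"
      by auto
  qed
qed

lemma diag_refl2: "i < m \<Longrightarrow> j < m \<Longrightarrow> i \<noteq> j \<Longrightarrow> diag (refl2 b i j)"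
  by (auto simp: diag_def refl2_b)

text \<open>The \<open>-1\<close>-eigenspace of \<open>refl2 b i j\<close> is a plane, hence too small for the images of the three
  orthogonal vectors \<open>b k\<close>.\<close>

lemma not_anticommute_refl2:
  assumes g: "g \<in> carrier OG" and ij: "i < m" "j < m" "i \<noteq> j"
  shows "g \<circ> refl2 b i j \<noteq> uminus \<circ> (refl2 b i j \<circ> g)"
proof
  assume eq: "g \<circ> refl2 b i j = uminus \<circ> (refl2 b i j \<circ> g)"
  have zero: "B (g (b k)) (b l) = 0"
    if "k < m" "k \<noteq> i" "k \<noteq> j" "l \<le> m" "l \<noteq> i" "l \<noteq> j" for k l
  proof -
    have "g (refl2 b i j (b k)) = - refl2 b i j (g (b k))"
      using fun_cong[OF eq, of "b k"] by simp
    then have "g (b k) = - refl2 b i j (g (b k))"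
      using refl2_b[of i j k] ij that by simp
    then have "B (g (b k)) (b l) = - B (refl2 b i j (g (b k))) (b l)"
      by (metis B_minus_left)
    then show ?thesis
      using B_refl2[of i j l "g (b k)"] ij that by (intro eq_neg_0) simp
  qed
  \<comment> \<open>The coordinates of \<open>g (b k)\<close> in the plane of \<open>b i\<close> and
    \<open>b j\<close>; the divisor is \<open>B (b i) (b i) = 2 * a\<close>.\<close>
  define x where "x = (\<lambda>k. B (g (b k)) (b i) / (2 * a))"
  define y where "y = (\<lambda>k. B (g (b k)) (b j) / (2 * a))"
  have a2: "2 * a \<noteq> 0" using two a0 by simp
  have decomp: "g (b k) = scale (x k) (b i) + scale (y k) (b j)" if k: "k < m" "k \<noteq> i" "k \<noteq> j" for k
  proof (rule eqI)
    fix l assume l: "l \<le> m"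
    show "B (g (b k)) (b l) = B (scale (x k) (b i) + scale (y k) (b j)) (b l)"
      using zero[OF k l] orth[of i l] orth[of j l] ij l Qb[of i] Qb[of j] a2
      by (cases "l = i"; cases "l = j") (auto simp: B_add_left B_scale_left B_self x_def y_def)
  qed
  have inner: "B (g (b k)) (g (b l)) = 2 * a * (x k * x l + y k * y l)"
    if "k < m" "k \<noteq> i" "k \<noteq> j" "l < m" "l \<noteq> i" "l \<noteq> j" for k l
    unfolding decomp[OF that(1-3)] decomp[OF that(4-6)]
    using orth[of i j] orth[of j i] ij
    by (simp add: B_add_left B_add_right B_scale_left B_scale_right B_self Qb algebra_simps)
  have one: "x k * x k + y k * y k = 1" if "k < m" "k \<noteq> i" "k \<noteq> j" for k
    using inner[OF that that] OG_B[OF g, of "b k" "b k"] Qb[OF that(1)] a2 by (simp add: B_self)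
  have ort: "x k * x l + y k * y l = 0"
    if "k < m" "k \<noteq> i" "k \<noteq> j" "l < m" "l \<noteq> i" "l \<noteq> j" "k \<noteq> l" for k l
    using inner[OF that(1-6)] OG_B[OF g, of "b k" "b l"] orth[of k l] that a2 by simp
  \<comment> \<open>Here \<open>m5\<close> enters: two of at least five indices are removed.\<close>
  have "card ({..<m} - {i, j}) \<ge> 3"
    using ij m5 by (simp add: card_Diff_subset)
  then obtain S where S: "S \<subseteq> {..<m} - {i, j}" "card S = 3"
    using obtain_subset_with_card_n by metis
  then obtain k1 k2 k3 where k: "S = {k1, k2, k3}" "k1 \<noteq> k2" "k1 \<noteq> k3" "k2 \<noteq> k3"
    by (auto simp: card_3_iff)
  \<comment> \<open>These are 2x2 minors of three coordinate vectors that are orthonormal for the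
    standard form on the plane. By the Binet-Cauchy identity their products are Gram determinants:
    both squares are 1, but the mixed product is 0.\<close>
  let ?u = "x k1 * y k2 - x k2 * y k1" and ?v = "x k1 * y k3 - x k3 * y k1"
  have ks: "k1 < m" "k1 \<noteq> i" "k1 \<noteq> j" "k2 < m" "k2 \<noteq> i" "k2 \<noteq> j" "k3 < m" "k3 \<noteq> i" "k3 \<noteq> j"
    using S k by auto
  note o1 = one[OF ks(1-3)] one[OF ks(4-6)] one[OF ks(7-9)]
  note o2 = ort[OF ks(1-6) k(2)] ort[OF ks(1-3,7-9) k(3)] ort[OF ks(4-9) k(4)]
  have "?u * ?u = (x k1 * x k1 + y k1 * y k1) * (x k2 * x k2 + y k2 * y k2)
      - (x k1 * x k2 + y k1 * y k2) * (x k1 * x k2 + y k1 * y k2)"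
    by (simp add: algebra_simps)
  then have u: "?u * ?u = 1" by (simp add: o1 o2)
  have "?v * ?v = (x k1 * x k1 + y k1 * y k1) * (x k3 * x k3 + y k3 * y k3)
      - (x k1 * x k3 + y k1 * y k3) * (x k1 * x k3 + y k1 * y k3)"
    by (simp add: algebra_simps)
  then have v: "?v * ?v = 1" by (simp add: o1 o2)
  have "?u * ?v = (x k1 * x k1 + y k1 * y k1) * (x k2 * x k3 + y k2 * y k3)
      - (x k1 * x k2 + y k1 * y k2) * (x k1 * x k3 + y k1 * y k3)"
    by (simp add: algebra_simps)
  then have "?u * ?v = 0" by (simp add: o1 o2)
  then show False using u v by auto
qed

text \<open>Commuting modulo scalars is genuine commuting here, since
  \<open>not_anticommute_refl2\<close> excludes the other sign. For \<open>k \<noteq> l\<close>, a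
  double reflection that negates exactly one of \<open>b k\<close> and \<open>b l\<close> shows that
  \<open>B (g (b k)) (b l)\<close> is its own negative. The remaining diagonal entries have square
  1.\<close>

lemma diag_if_commute:
  assumes g: "g \<in> carrier OG"
    and comm: "\<And>i j. i < m \<Longrightarrow> j < m \<Longrightarrow> i \<noteq> j \<Longrightarrow> \<pi> g \<otimes>\<^bsub>PO\<^esub> \<pi> (refl2 b i j) = \<pi> (refl2 b i j) \<otimes>\<^bsub>PO\<^esub> \<pi> g"
  shows "diag g"
proof -
  have c: "g (refl2 b i j x) = refl2 b i j (g x)" if "i < m" "j < m" "i \<noteq> j" for i j x
  proof -
    have "g \<circ> refl2 b i j = refl2 b i j \<circ> g"
      using comm[OF that] \<pi>_commute_iff[OF g refl2_OG[of i j]] not_anticommute_refl2[OF g that] that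
      by simp
    then show ?thesis by (metis comp_apply)
  qed
  have zero: "B (g (b k)) (b l) = 0" if kl: "k \<le> m" "l \<le> m" "k \<noteq> l" for k l
  proof -
    obtain i j where ij: "i < m" "j < m" "i \<noteq> j" "(k = i \<or> k = j) \<noteq> (l = i \<or> l = j)"
    proof -
      obtain j where j: "j < m" "j \<noteq> k" "j \<noteq> l"
        using other_index by blast
      show ?thesis
        \<comment> \<open>The double reflections use only indices below \<open>m\<close>; since
          \<open>k \<noteq> l\<close>, at least one of the two is such an index.\<close>
        using that[of "if k < m then k else l" j] j kl by (auto split: if_splits)
    qed
    have "B (g (refl2 b i j (b k))) (b l) = B (refl2 b i j (g (b k))) (b l)"
      using c[OF ij(1-3)] by simp
    then show ?thesis
      using ij kl eq_neg_0[of "B (g (b k)) (b l)"] OG_linear(3)[OF g]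
      by (auto simp: refl2_b B_refl2 split: if_splits)
  qed
  show ?thesis
    unfolding diag_def
  proof (intro allI impI)
    fix i assume i: "i \<le> m"
    let ?x = "B (g (b i)) (b i) / B (b i) (b i)"
    have gb: "g (b i) = scale ?x (b i)"
      using eq_scale_b[OF i] zero[OF i] by blast
    have "?x\<^sup>2 * Q (b i) = Q (b i)"
      using OG_Q[OF g, of "b i"] gb by (metis Q_scale)
    then have "?x = 1 \<or> ?x = -1"
      using Qb_nz[OF i] by (simp add: power2_eq_1_iff)
    then show "g (b i) = b i \<or> g (b i) = - b i"
      using gb by auto
  qed
qed

lemma frame_image: "g \<in> carrier OG \<Longrightarrow> frame scale Q m (g \<circ> b) a"
proof unfold_locales
  fix x assume g: "g \<in> carrier OG" and *: "\<And>i. i \<le> m \<Longrightarrow> B x ((g \<circ> b) i) = 0"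
  let ?y = "Hilbert_Choice.inv g x"
  have x: "g ?y = x"
    using inv_comp_OG(2)[OF g] by (metis comp_apply id_apply)
  have "?y = 0"
    by (rule separating) (use * OG_B[OF g, of ?y] x in auto)
  then show "x = 0"
    using x OG_linear(5)[OF g] by simp
qed (use m5 a0 orth Qb Q_last in \<open>auto simp: OG_B OG_Q\<close>)

lemma swap_OG: "i < m \<Longrightarrow> j < m \<Longrightarrow> i \<noteq> j \<Longrightarrow> r (b i - b j) \<in> carrier OG"
  and Q_b_diff: "i < m \<Longrightarrow> j < m \<Longrightarrow> i \<noteq> j \<Longrightarrow> Q (b i - b j) = 2 * a"
proof -
  show *: "Q (b i - b j) = 2 * a" if "i < m" "j < m" "i \<noteq> j"
    using that orth[of i j] by (simp add: Q_diff Qb)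
  show "r (b i - b j) \<in> carrier OG" if "i < m" "j < m" "i \<noteq> j"
    using *[OF that] two a0 by (intro reflection_OG) simp
qed

lemma swap_b:
  assumes ij: "i < m" "j < m" "i \<noteq> j" and l: "l \<le> m"
  shows "r (b i - b j) (b l) = b (Transposition.transpose i j l)"
proof -
  have "2 * a / (2 * a) = 1"
    using two a0 by simp
  then show ?thesis
    using orth[of i j] orth[of j i] orth[of l i] orth[of l j] ij l a0
    by (cases "l = i"; cases "l = j")
      (auto simp: reflection_eq Q_b_diff B_diff_right B_self Qb Transposition.transpose_def)
qed

text \<open>Let \<open>s\<close> be the reflection in \<open>b i - b j\<close>. It conjugates the
  reflection in \<open>b i\<close> into that in \<open>b j\<close>, so the commutator of
  \<open>r (b i)\<close> and \<open>s\<close> is the product of these two reflections.\<close>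

lemma refl2_\<Omega>:
  assumes ij: "i < m" "j < m" "i \<noteq> j"
  shows "refl2 b i j \<in> \<Omega>"
proof -
  let ?s = "r (b i - b j)"
  have Q: "Q (b i - b j) \<noteq> 0"
    using Q_b_diff[OF ij] two a0 by simp
  have "?s (b i) = b j"
    using swap_b[OF ij, of i] ij by simp
  then have "?s \<circ> r (b i) = r (b j) \<circ> ?s"
    using reflection_conj[OF Qb_nz swap_OG[OF ij], of i] ij by simp
  then have "r (b i) \<circ> ?s \<circ> r (b i) \<circ> ?s = r (b i) \<circ> (r (b j) \<circ> ?s) \<circ> ?s"
    by (metis comp_assoc)
  also have "\<dots> = refl2 b i j"
    using reflection_comp[OF Q] by (simp add: refl2_def comp_assoc)
  finally have "r (b i) \<circ> ?s \<circ> r (b i) \<circ> ?s = refl2 b i j" .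
  moreover have "r (b i) \<circ> ?s \<circ> r (b i) \<circ> ?s \<in> \<Omega>"
    using commutator_\<Omega>[OF refl_OG[of i] swap_OG[OF ij]] reflection_inv[OF Qb_nz[of i]]
      reflection_inv[OF Q] ij by simp
  ultimately show ?thesis by simp
qed

section \<open>The self-centralizing 2-subgroup of a frame and 3-cycles in its normalizer\<close>

abbreviation "E \<equiv> E_set m b"
abbreviation "P \<equiv> P_grp m b"

lemma E_H: "E \<subseteq> carrier H"
  using refl2_\<Omega> by (auto simp: E_set_def carrier_H)

lemma subgroup_P: "subgroup P H"
  unfolding P_grp_def using H.subgroup_centralizer[OF E_H] .

lemma P_diag:
  assumes "X \<in> P"
  shows "\<exists>g. g \<in> \<Omega> \<and> X = \<pi> g \<and> diag g"
proof -
  obtain g where g: "g \<in> \<Omega>" "X = \<pi> g"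
    using assms by (auto simp: P_grp_def centralizer_def carrier_H)
  have "diag g"
  proof (rule diag_if_commute[OF \<Omega>_OG[OF g(1)]])
    fix i j assume "i < m" "j < m" "i \<noteq> j"
    then have "\<pi> (refl2 b i j) \<in> E"
      by (auto simp: E_set_def)
    then show "\<pi> g \<otimes>\<^bsub>PO\<^esub> \<pi> (refl2 b i j) = \<pi> (refl2 b i j) \<otimes>\<^bsub>PO\<^esub> \<pi> g"
      using assms g(2) by (simp add: P_grp_def centralizer_def mult_H)
  qed
  with g show ?thesis by blast
qed

lemma \<pi>_diag_commute:
  "g \<in> carrier OG \<Longrightarrow> diag g \<Longrightarrow> h \<in> carrier OG \<Longrightarrow> diag h \<Longrightarrow> \<pi> g \<otimes>\<^bsub>H\<^esub> \<pi> h = \<pi> h \<otimes>\<^bsub>H\<^esub> \<pi> g"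
  using diag_commute by (simp add: mult_H \<pi>_comp[symmetric])

lemma E_P: "E \<subseteq> P"
proof
  fix X assume X: "X \<in> E"
  have "X \<otimes>\<^bsub>H\<^esub> Y = Y \<otimes>\<^bsub>H\<^esub> X" if "Y \<in> E" for Y
    using X that refl2_OG diag_refl2 \<pi>_diag_commute by (fastforce simp: E_set_def)
  then show "X \<in> P"
    using X E_H by (auto simp: P_grp_def centralizer_def)
qed

lemma P_centralizer: "centralizer H P = P"
proof
  show "centralizer H P \<subseteq> P"
    using E_P by (auto simp: P_grp_def centralizer_def)
  show "P \<subseteq> centralizer H P"
  proof
    fix X assume X: "X \<in> P"
    have "X \<otimes>\<^bsub>H\<^esub> Y = Y \<otimes>\<^bsub>H\<^esub> X" if "Y \<in> P" for Y
      using P_diag[OF X] P_diag[OF that] \<Omega>_OG \<pi>_diag_commute by blast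
    then show "X \<in> centralizer H P"
      using X by (simp add: centralizer_def P_grp_def)
  qed
qed

lemma P_square:
  assumes "X \<in> P"
  shows "X \<otimes>\<^bsub>H\<^esub> X = \<one>\<^bsub>H\<^esub>"
proof -
  obtain g where g: "g \<in> \<Omega>" "X = \<pi> g" "diag g"
    using P_diag[OF assms] by blast
  have "X \<otimes>\<^bsub>H\<^esub> X = \<pi> (g \<circ> g)"
    using g \<Omega>_OG by (simp add: mult_H \<pi>_comp)
  also have "\<dots> = \<one>\<^bsub>H\<^esub>"
    using diag_square[OF \<Omega>_OG[OF g(1)] g(3)] \<pi>.hom_one by (simp add: one_OG one_H)
  finally show ?thesis .
qed

lemmas P_two_centric = H.self_centralizing_two_centric[OF finite_H subgroup_P P_centralizer P_square]

text \<open>The reflection in \<open>b i - b j\<close> swaps \<open>b i\<close> and \<open>b j\<close>, so this commutator is a 3-cycle.\<close>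

definition cyc :: "nat \<Rightarrow> nat \<Rightarrow> nat \<Rightarrow> 'v \<Rightarrow> 'v" where
  "cyc i j k = r (b i - b j) \<circ> r (b j - b k) \<circ> r (b i - b j) \<circ> r (b j - b k)"

lemma cyc_\<Omega>:
  assumes "i < m" "j < m" "k < m" "i \<noteq> j" "j \<noteq> k"
  shows "cyc i j k \<in> \<Omega>"
  using commutator_\<Omega>[OF swap_OG[OF assms(1,2,4)] swap_OG[OF assms(2,3,5)]]
    reflection_inv[of "b i - b j"] reflection_inv[of "b j - b k"] Q_b_diff two a0 assms
  by (simp add: cyc_def)

lemma cyc_b:
  assumes "i < m" "j < m" "k < m" "i \<noteq> j" "j \<noteq> k" "l \<le> m"
  shows "cyc i j k (b l) = b ((Transposition.transpose i j \<circ> Transposition.transpose j k \<circ>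
    Transposition.transpose i j \<circ> Transposition.transpose j k) l)"
proof -
  have le: "Transposition.transpose p q l \<le> m" if "p < m" "q < m" "l \<le> m" for p q l
    using that by (auto simp: Transposition.transpose_def)
  show ?thesis
    using assms by (simp add: cyc_def swap_b le)
qed

end

context quad_space
begin

lemma E_set_image:
  assumes fr: "frame scale Q m b a" and g: "g \<in> carrier OG"
  shows "E_set m (g \<circ> b) = (\<lambda>X. \<pi> g \<otimes>\<^bsub>PO\<^esub> X \<otimes>\<^bsub>PO\<^esub> inv\<^bsub>PO\<^esub> (\<pi> g)) ` E_set m b"
proof -
  interpret frame scale Q m b a by (fact fr)
  have "\<pi> g \<otimes>\<^bsub>PO\<^esub> \<pi> (refl2 b i j) \<otimes>\<^bsub>PO\<^esub> inv\<^bsub>PO\<^esub> (\<pi> g) = \<pi> (refl2 (g \<circ> b) i j)"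
    if "i < m" "j < m" for i j
  proof -
    have "g \<circ> refl2 b i j = r (g (b i)) \<circ> (g \<circ> r (b j))"
      using reflection_conj[OF Qb_nz[of i] g] that by (simp add: refl2_def comp_assoc[symmetric])
    also have "\<dots> = refl2 (g \<circ> b) i j \<circ> g"
      using reflection_conj[OF Qb_nz[of j] g] that by (simp add: refl2_def comp_assoc)
    finally have eq: "g \<circ> refl2 b i j = refl2 (g \<circ> b) i j \<circ> g" .
    have c: "refl2 (g \<circ> b) i j \<in> carrier OG" "refl2 b i j \<in> carrier OG"
      using frame.refl2_OG[OF frame_image[OF g]] refl2_OG that by auto
    have "\<pi> g \<otimes>\<^bsub>PO\<^esub> \<pi> (refl2 b i j) = \<pi> (refl2 (g \<circ> b) i j) \<otimes>\<^bsub>PO\<^esub> \<pi> g"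
      using eq c g by (simp add: \<pi>_comp[symmetric])
    then show ?thesis
      using c g by (simp add: PO.m_assoc)
  qed
  then show ?thesis
    unfolding E_set_def by (force simp: image_iff)
qed

lemma conj_aut_H:
  "g \<in> \<Omega> \<Longrightarrow> X \<in> carrier H \<Longrightarrow>
    conj_aut H (\<pi> g) X = \<pi> g \<otimes>\<^bsub>PO\<^esub> X \<otimes>\<^bsub>PO\<^esub> inv\<^bsub>PO\<^esub> (\<pi> g)"
  using inv_H[of "\<pi> g"] by (simp add: conj_aut_def mult_H carrier_H)

lemma P_grp_image:
  assumes fr: "frame scale Q m b a" and g: "g \<in> \<Omega>"
  shows "P_grp m (g \<circ> b) = conj_set H (\<pi> g) (P_grp m b)"
proof -
  interpret frame scale Q m b a by (fact fr)
  have \<pi>g: "\<pi> g \<in> carrier H" using g by (simp add: carrier_H)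
  have "E_set m (g \<circ> b) = conj_aut H (\<pi> g) ` E"
    unfolding E_set_image[OF fr \<Omega>_OG[OF g]] using conj_aut_H[OF g] E_H
    by (intro image_cong) auto
  then have "P_grp m (g \<circ> b) = conj_aut H (\<pi> g) ` P"
    unfolding P_grp_def using H.centralizer_auto[OF H.conj_aut_auto[OF \<pi>g] E_H] by simp
  then show ?thesis
    using H.conj_set_eq[OF subgroup.subset[OF subgroup_P]] by simp
qed

end

context frame
begin

text \<open>The 3-cycle permutes the vectors \<open>b l\<close> with \<open>l < m\<close> without
  introducing signs, so each double reflection of \<open>b\<close> is one of the permuted frame.
  Passing to centralizers reverses this inclusion, and the centralizer for the permuted frame is the
  conjugate of \<open>P\<close>.\<close>

lemma cyc_normalizes_P:
  assumes ijk: "i < m" "j < m" "k < m" "i \<noteq> j" "j \<noteq> k"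
  shows "conj_set H (\<pi> (cyc i j k)) P \<subseteq> P"
proof -
  let ?\<sigma> = "Transposition.transpose i j \<circ> Transposition.transpose j k \<circ>
    Transposition.transpose i j \<circ> Transposition.transpose j k"
  have bij: "bij ?\<sigma>"
    by (intro bij_comp) simp_all
  have lt: "?\<sigma> l < m \<longleftrightarrow> l < m" for l
    using ijk by (auto simp: Transposition.transpose_def)
  have "E \<subseteq> E_set m (cyc i j k \<circ> b)"
  proof
    fix X assume "X \<in> E"
    then obtain p q where pq: "p < m" "q < m" "p \<noteq> q" "X = \<pi> (refl2 b p q)"
      by (auto simp: E_set_def)
    obtain p' q' where pq': "p = ?\<sigma> p'" "q = ?\<sigma> q'"
      using bij_is_surj[OF bij] by (metis surjD)
    have "p' < m" "q' < m" "p' \<noteq> q'"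
      using pq pq' lt by auto
    moreover have "refl2 b p q = refl2 (cyc i j k \<circ> b) p' q'"
      using cyc_b[OF ijk, of p'] cyc_b[OF ijk, of q'] pq' calculation by (simp add: refl2_def)
    ultimately show "X \<in> E_set m (cyc i j k \<circ> b)"
      using pq(4) by (auto simp: E_set_def)
  qed
  then have "P_grp m (cyc i j k \<circ> b) \<subseteq> P"
    by (auto simp: P_grp_def centralizer_def)
  then show ?thesis
    using P_grp_image[OF frame_axioms cyc_\<Omega>[OF ijk]] by simp
qed

text \<open>The 3-cycle fixes \<open>b m\<close>, an eigenvector of \<open>t\<close>, which rules
  out anticommuting. True commuting transports the sign of \<open>t\<close> from \<open>b i\<close>
  to \<open>b k\<close>. The sign at \<open>b m\<close> stays free, because no 3-cycle moves this
  vector.\<close>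

lemma diag_const:
  assumes t: "t \<in> carrier OG" "diag t"
    and comm: "\<And>i j k. i < m \<Longrightarrow> j < m \<Longrightarrow> k < m \<Longrightarrow> i \<noteq> j \<Longrightarrow> j \<noteq> k \<Longrightarrow> i \<noteq> k \<Longrightarrow>
      \<pi> t \<otimes>\<^bsub>PO\<^esub> \<pi> (cyc i j k) = \<pi> (cyc i j k) \<otimes>\<^bsub>PO\<^esub> \<pi> t"
  shows "(\<forall>i<m. t (b i) = b i) \<or> (\<forall>i<m. t (b i) = - b i)"
proof -
  have step: "t (b i) = b i \<longleftrightarrow> t (b k) = b k" if ik: "i < m" "k < m" "i \<noteq> k" for i k
  proof -
    obtain j where j: "j < m" "j \<noteq> i" "j \<noteq> k"
      using other_index by blast
    let ?c = "cyc i j k"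
    note ijk = ik(1) j(1) ik(2) j(2)[symmetric] j(3)
    have c: "?c \<in> carrier OG"
      using cyc_\<Omega>[OF ijk] \<Omega>_OG by blast
    have cm: "?c (b m) = b m"
      using cyc_b[OF ijk, of m] ijk by (simp add: Transposition.transpose_def)
    have ci: "?c (b i) = b k"
      using cyc_b[OF ijk, of i] ijk ik by (simp add: Transposition.transpose_def)
    have "t \<circ> ?c \<noteq> uminus \<circ> (?c \<circ> t)"
    proof
      assume "t \<circ> ?c = uminus \<circ> (?c \<circ> t)"
      then have "t (?c (b m)) = - ?c (t (b m))"
        by (metis comp_apply)
      moreover have "t (b m) = b m \<or> t (b m) = - b m"
        using t(2) by (simp add: diag_def)
      ultimately show False
        using cm OG_linear(3)[OF c, of "b m"] b_neq_minus[of m] by auto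
    qed
    then have "t \<circ> ?c = ?c \<circ> t"
      using comm[OF ijk ik(3)] \<pi>_commute_iff[OF t(1) c] by blast
    then have tk: "t (b k) = ?c (t (b i))"
      using ci by (metis comp_apply)
    have "t (b i) = b i \<or> t (b i) = - b i"
      using t(2) ik by (simp add: diag_def)
    then show ?thesis
      using tk ci OG_linear(3)[OF c, of "b i"] b_neq_minus[of i] b_neq_minus[of k] ik by auto
  qed
  have zero: "t (b i) = b i \<longleftrightarrow> t (b 0) = b 0" if "i < m" for i
    using step[of i 0] that m5 by (cases "i = 0") auto
  have "t (b i) = b i \<or> t (b i) = - b i" if "i < m" for i
    using t(2) that by (simp add: diag_def)
  then show ?thesis
    using zero by metis
qed

end

lemma (in group) normal_conj_auto:
  assumes N: "N \<lhd> G" and x: "x \<in> carrier G"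
  shows "(\<lambda>y\<in>N. x \<otimes> y \<otimes> inv x) \<in> auto (G\<lparr>carrier := N\<rparr>)"
proof -
  interpret N: normal N G by (fact N)
  have cl: "z \<otimes> y \<otimes> inv z \<in> N" if "z \<in> carrier G" "y \<in> N" for z y
    using N.inv_op_closed2 that by simp
  have cancel: "inv z \<otimes> (z \<otimes> y \<otimes> inv z) \<otimes> z = y" if "z \<in> carrier G" "y \<in> N" for z y
  proof -
    have "inv z \<otimes> (z \<otimes> y \<otimes> inv z) \<otimes> z = (inv z \<otimes> z) \<otimes> y \<otimes> (inv z \<otimes> z)"
      using that(1) N.mem_carrier[OF that(2)] by (simp only: m_assoc m_closed inv_closed)
    then show ?thesis
      using that by simp
  qed
  have "bij_betw (\<lambda>y\<in>N. x \<otimes> y \<otimes> inv x) N N"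
    by (rule bij_betwI[where g = "\<lambda>y. inv x \<otimes> y \<otimes> x"])
      (use x cl[of x] cl[of "inv x"] cancel[of x] cancel[of "inv x"] in auto)
  moreover have "(\<lambda>y\<in>N. x \<otimes> y \<otimes> inv x) \<in> hom (G\<lparr>carrier := N\<rparr>) (G\<lparr>carrier := N\<rparr>)"
  proof (rule homI)
    fix y z assume "y \<in> carrier (G\<lparr>carrier := N\<rparr>)" "z \<in> carrier (G\<lparr>carrier := N\<rparr>)"
    then have yz: "y \<in> N" "z \<in> N" by simp_all
    have "(x \<otimes> y \<otimes> inv x) \<otimes> (x \<otimes> z \<otimes> inv x) = x \<otimes> y \<otimes> (inv x \<otimes> x) \<otimes> z \<otimes> inv x"
      using x N.mem_carrier[OF yz(1)] N.mem_carrier[OF yz(2)]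
      by (simp only: m_assoc m_closed inv_closed)
    then show "(\<lambda>y\<in>N. x \<otimes> y \<otimes> inv x) (y \<otimes>\<^bsub>G\<lparr>carrier := N\<rparr>\<^esub> z) =
        (\<lambda>y\<in>N. x \<otimes> y \<otimes> inv x) y \<otimes>\<^bsub>G\<lparr>carrier := N\<rparr>\<^esub> (\<lambda>y\<in>N. x \<otimes> y \<otimes> inv x) z"
      using x yz by (simp add: m_assoc)
  qed (use cl x in auto)
  ultimately show ?thesis
    by (simp add: auto_def Bij_def)
qed

lemma (in group) commute_if_conj_eq:
  assumes "x \<in> carrier G" "y \<in> carrier G" "c \<in> carrier G"
    and "x \<otimes> c \<otimes> inv x = y \<otimes> c \<otimes> inv y"
  shows "(inv x \<otimes> y) \<otimes> c = c \<otimes> (inv x \<otimes> y)"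
proof -
  have "(inv x \<otimes> y) \<otimes> c = inv x \<otimes> (y \<otimes> c \<otimes> inv y) \<otimes> y"
    using assms(1-3) by (simp add: m_assoc)
  also have "\<dots> = (inv x \<otimes> x) \<otimes> c \<otimes> (inv x \<otimes> y)"
    unfolding assms(4)[symmetric] by (simp only: assms(1-3) m_assoc m_closed inv_closed)
  also have "\<dots> = c \<otimes> (inv x \<otimes> y)"
    using assms(1-3) by simp
  finally show ?thesis .
qed

section \<open>The action on lines of a given norm and the line fixed by a larger 2-group\<close>

context quad_space
begin

text \<open>For \<open>c \<noteq> 0\<close> a line is represented by the pair of its vectors of norm
  \<open>c\<close>. Elements of \<open>PO\<close>, being isometries up to sign, act on such
  pairs.\<close>

definition lines :: "'k \<Rightarrow> 'v set set" where
  "lines c = {{v, - v} |v. Q v = c}"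

definition act :: "('v \<Rightarrow> 'v) set \<Rightarrow> 'v set \<Rightarrow> 'v set" where
  "act A S = {g v |g v. g \<in> A \<and> v \<in> S}"

lemma act_\<pi>: "g \<in> carrier OG \<Longrightarrow> act (\<pi> g) {v, - v} = {g v, - g v}"
  by (auto simp: act_def \<pi>_eq OG_linear) (metis OG_linear(3))

lemma action_on_lines:
  assumes "subgroup K H"
  shows "group_action (H\<lparr>carrier := K\<rparr>) (lines c) (\<lambda>A. restrict (act A) (lines c))"
proof -
  interpret K: group "H\<lparr>carrier := K\<rparr>"
    using H.subgroup_imp_group[OF assms] .
  have rep: "\<exists>g \<in> carrier OG. A = \<pi> g" if "A \<in> K" for A
    using subgroup.mem_carrier[OF assms that] \<Omega>_OG by (auto simp: carrier_H)
  have act2: "act (\<pi> g \<otimes>\<^bsub>PO\<^esub> \<pi> h) S = act (\<pi> g) (act (\<pi> h) S)"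
    if gh: "g \<in> carrier OG" "h \<in> carrier OG" and S: "S \<in> lines c" for g h S
  proof -
    obtain v where "S = {v, - v}" using S by (auto simp: lines_def)
    then show ?thesis
      using gh by (simp add: \<pi>_comp[symmetric] act_\<pi> comp_OG)
  qed
  show ?thesis
  proof (rule K.group_actionI)
    fix A S assume A: "A \<in> carrier (H\<lparr>carrier := K\<rparr>)" and S: "S \<in> lines c"
    obtain g where g: "g \<in> carrier OG" "A = \<pi> g" using rep A by auto
    obtain v where "S = {v, - v}" "Q v = c" using S by (auto simp: lines_def)
    then show "act A S \<in> lines c"
      using g OG_Q[OF g(1), of v] by (auto simp: act_\<pi> lines_def)
  next
    fix S assume "S \<in> lines c"
    then obtain v where "S = {v, - v}" by (auto simp: lines_def)
    then show "act \<one>\<^bsub>H\<lparr>carrier := K\<rparr>\<^esub> S = S"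
      using act_\<pi>[OF id_OG, of v] \<pi>.hom_one by (simp add: one_H one_OG)
  next
    fix A A' S
    assume A: "A \<in> carrier (H\<lparr>carrier := K\<rparr>)" and A': "A' \<in> carrier (H\<lparr>carrier := K\<rparr>)"
      and S: "S \<in> lines c"
    obtain g where "g \<in> carrier OG" "A = \<pi> g" using rep A by auto
    moreover obtain h where "h \<in> carrier OG" "A' = \<pi> h" using rep A' by auto
    ultimately show "act (A \<otimes>\<^bsub>H\<lparr>carrier := K\<rparr>\<^esub> A') S = act A (act A' S)"
      using act2[OF _ _ S] by (simp add: mult_H)
  qed
qed

lemma two_group_lines:
  assumes K: "subgroup K H" "card K = 2 ^ k"
  shows "card (lines c) mod 2 = card {S \<in> lines c. \<forall>A\<in>K. act A S = S} mod 2"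
proof -
  interpret group_action "H\<lparr>carrier := K\<rparr>" "lines c" "\<lambda>A. restrict (act A) (lines c)"
    using action_on_lines[OF K(1)] .
  have fin: "finite (lines c)"
    unfolding lines_def using finite_subset[OF subset_UNIV fin_space] by simp
  have "{S \<in> lines c. \<forall>A\<in>carrier (H\<lparr>carrier := K\<rparr>). restrict (act A) (lines c) S = S} =
      {S \<in> lines c. \<forall>A\<in>K. act A S = S}"
    by auto
  then show ?thesis
    using card_mod_two_group[OF _ fin, of k] K(2) by (simp add: Coset.order_def)
qed

end

context frame
begin

lemma eq_on_basis:
  assumes g: "g \<in> carrier OG" and h: "h \<in> carrier OG" and eq: "\<And>i. i \<le> m \<Longrightarrow> g (b i) = h (b i)"
  shows "g = h"
proof
  fix x
  interpret gb: frame scale Q m "g \<circ> b" a using frame_image[OF g] .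
  show "g x = h x"
  proof (rule gb.eqI)
    fix i assume "i \<le> m"
    then show "B (g x) ((g \<circ> b) i) = B (h x) ((g \<circ> b) i)"
      using OG_B[OF g, of x "b i"] OG_B[OF h, of x "b i"] eq by simp
  qed
qed

text \<open>\<open>P\<close> fixes exactly one of the lines spanned by vectors \<open>v\<close> with \<open>Q v = Q (b m)\<close>, so the number of
  these lines is odd, and the larger 2-group \<open>R\<close> must fix one of them, too.\<close>

lemma fixed_line:
  assumes R: "subgroup R H" "card R = 2 ^ k" and PR: "P \<subseteq> R" and g: "g \<in> carrier OG" "\<pi> g \<in> R"
  shows "g (b m) = b m \<or> g (b m) = - b m"
proof -
  let ?c = "Q (b m)"
  let ?F = "\<lambda>K. {S \<in> lines ?c. \<forall>A\<in>K. act A S = S}"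
  obtain j where j: "card P = 2 ^ j"
    using P_two_centric(1) by (auto simp: two_centric_def)
  have sub: "?F P \<subseteq> {{b m, - b m}}"
  proof
    fix S assume S: "S \<in> ?F P"
    then obtain v where v: "S = {v, - v}" "Q v = ?c" by (auto simp: lines_def)
    have d: "refl2 b i j v = v \<or> refl2 b i j v = - v" if "i < m" "j < m" "i \<noteq> j" for i j
    proof -
      have "\<pi> (refl2 b i j) \<in> P"
        using E_P that by (auto simp: E_set_def)
      then have "act (\<pi> (refl2 b i j)) S = S"
        using S by blast
      then have "{refl2 b i j v, - refl2 b i j v} = {v, - v}"
        using act_\<pi>[OF refl2_OG[of i j], of v] that v(1) by simp
      then show ?thesis by (auto simp: doubleton_eq_iff)
    qed
    \<comment> \<open>If the coordinate at \<open>i\<close> is nonzero, every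
      \<open>refl2 b i j\<close> sends \<open>v\<close> to \<open>- v\<close>. Since
      \<open>j\<close> can avoid any given \<open>l\<close>, all other coordinates vanish, and
      \<open>Q v\<close> is a square times \<open>a\<close>, against \<open>Q_last\<close>.\<close>
    have zero: "B v (b i) = 0" if i: "i < m" for i
    proof (rule ccontr)
      assume nz: "B v (b i) \<noteq> 0"
      have "B v (b l) = 0" if l: "l \<le> m" "l \<noteq> i" for l
      proof -
        obtain j where j: "j < m" "j \<noteq> i" "j \<noteq> l" using other_index by blast
        have "refl2 b i j v \<noteq> v"
        proof
          assume "refl2 b i j v = v"
          then have "B v (b i) = - B v (b i)"
            using B_refl2[of i j i v] i j by simp
          then show False using eq_neg_0 nz by blast
        qed
        then have "refl2 b i j v = - v"
          using d[OF i j(1)] j by auto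
        then have "B v (b l) = - B v (b l)"
          using B_refl2[of i j l v] i j l by simp
        then show ?thesis by (rule eq_neg_0)
      qed
      then have "v = scale (B v (b i) / B (b i) (b i)) (b i)"
        using eq_scale_b[of i v] i by simp
      then have "Q v = (B v (b i) / B (b i) (b i))\<^sup>2 * a"
        using Qb[OF i] by (metis Q_scale)
      then show False
        using v(2) Q_last by metis
    qed
    have "v = scale (B v (b m) / B (b m) (b m)) (b m)"
      using eq_scale_b[of m v] zero by (simp add: le_less)
    then obtain s where s: "v = scale s (b m)" by blast
    then have "s\<^sup>2 * ?c = ?c"
      using v(2) by (simp add: Q_scale)
    then have "s = 1 \<or> s = -1"
      using Qb_nz[of m] by (simp add: power2_eq_1_iff)
    then have "v = b m \<or> v = - b m"
      using s by auto
    then have "S = {b m, - b m}"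
      using v(1) by (auto simp: insert_commute)
    then show "S \<in> {{b m, - b m}}" by simp
  qed
  moreover have "{b m, - b m} \<in> ?F P"
  proof -
    have "act A {b m, - b m} = {b m, - b m}" if A: "A \<in> P" for A
    proof -
      obtain h where h: "h \<in> \<Omega>" "A = \<pi> h" "diag h" using P_diag[OF A] by blast
      then have "h (b m) = b m \<or> h (b m) = - b m" by (simp add: diag_def)
      then have "{h (b m), - h (b m)} = {b m, - b m}"
        by (auto simp: insert_commute)
      then show ?thesis
        using act_\<pi>[OF \<Omega>_OG[OF h(1)], of "b m"] h(2) by simp
    qed
    then show ?thesis by (auto simp: lines_def)
  qed
  ultimately have FP: "?F P = {{b m, - b m}}" by blast
  have "card (?F R) mod 2 = card (?F P) mod 2"
    using two_group_lines[OF R, of ?c] two_group_lines[OF subgroup_P j, of ?c] by simp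
  then have "card (?F R) mod 2 = 1"
    unfolding FP by simp
  then have "?F R \<noteq> {}"
    by (metis card.empty mod_0 zero_neq_one)
  moreover have "?F R \<subseteq> ?F P"
    using PR by blast
  ultimately have "{b m, - b m} \<in> ?F R"
    unfolding FP by blast
  then have "act (\<pi> g) {b m, - b m} = {b m, - b m}"
    using g(2) by blast
  then show ?thesis
    using act_\<pi>[OF g(1), of "b m"] by (auto simp: doubleton_eq_iff)
qed

end

section \<open>Conjugation by a reflection\<close>

context quad_space
begin

lemma frame_conj_into_Syl:
  assumes fr: "frame scale Q m b a" and R: "R \<in> Syl 2 H"
  shows "\<exists>b'. frame scale Q m b' a \<and> P_grp m b' \<subseteq> R"
proof -
  interpret frame scale Q m b a by (fact fr)
  obtain k where "card P = 2 ^ k"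
    using P_two_centric(1) by (auto simp: two_centric_def)
  then obtain X where X: "X \<in> carrier H" "conj_set H X P \<subseteq> R"
    using H.two_subgroup_conj_into_Syl[OF finite_H R subgroup_P] by blast
  then obtain g where g: "g \<in> \<Omega>" "X = \<pi> g" by (auto simp: carrier_H)
  then have "P_grp m (g \<circ> b) \<subseteq> R"
    using P_grp_image[OF fr g(1)] X(2) by simp
  then show ?thesis
    using frame_image[OF \<Omega>_OG[OF g(1)]] by blast
qed

lemma reflection_aut_auto:
  assumes "Q w \<noteq> 0"
  shows "reflection_aut scale Q w \<in> auto H"
proof -
  have "(\<lambda>X\<in>\<pi> ` \<Omega>. \<pi> (r w) \<otimes>\<^bsub>PO\<^esub> X \<otimes>\<^bsub>PO\<^esub> inv\<^bsub>PO\<^esub> \<pi> (r w)) \<in> auto (PO\<lparr>carrier := \<pi> ` \<Omega>\<rparr>)"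
    using PO.normal_conj_auto[OF normal_H] reflection_OG[OF assms] by simp
  then show ?thesis
    by (simp add: reflection_aut_def POmega_def)
qed

lemma reflection_aut_eq:
  "X \<in> carrier H \<Longrightarrow> reflection_aut scale Q w X =
    \<pi> (r w) \<otimes>\<^bsub>PO\<^esub> X \<otimes>\<^bsub>PO\<^esub> inv\<^bsub>PO\<^esub> \<pi> (r w)"
  by (simp add: reflection_aut_def)

lemma reflection_aut_fixes:
  assumes w: "Q w \<noteq> 0" and g: "g \<in> \<Omega>" and gw: "g w = w \<or> g w = - w"
  shows "reflection_aut scale Q w (\<pi> g) = \<pi> g"
proof -
  have gO: "g \<in> carrier OG" using g \<Omega>_OG by blast
  have "g \<circ> r w = r w \<circ> g"
    using reflection_conj[OF w gO] gw reflection_minus by metis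
  then have "\<pi> (r w) \<otimes>\<^bsub>PO\<^esub> \<pi> g = \<pi> g \<otimes>\<^bsub>PO\<^esub> \<pi> (r w)"
    using gO reflection_OG[OF w] by (simp add: \<pi>_comp[symmetric])
  then show ?thesis
    using gO reflection_OG[OF w] g by (simp add: reflection_aut_eq carrier_H PO.m_assoc)
qed

text \<open>A reflection fixing all these vectors has \<open>w\<close> on the line of
  \<open>b m\<close>, whose norms are in the wrong square class. One negating them would put the
  orthogonal vectors \<open>b 0\<close> and \<open>b 1\<close> on the line of
  \<open>w\<close>.\<close>

lemma reflection_not_scalar_on_frame:
  assumes fr: "frame scale Q m b a" and w: "Q w = a"
  shows "\<not> (\<forall>i<m. r w (b i) = b i)" "\<not> (\<forall>i<m. r w (b i) = - b i)"
proof -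
  interpret frame scale Q m b a by (fact fr)
  have w0: "Q w \<noteq> 0" using w a0 by simp
  show "\<not> (\<forall>i<m. r w (b i) = b i)"
  proof
    assume *: "\<forall>i<m. r w (b i) = b i"
    have "B w (b i) = 0" if "i < m" for i
    proof -
      have "B w (b i) = B (r w w) (r w (b i))"
        using OG_B[OF reflection_OG[OF w0]] by simp
      then have "B w (b i) = - B w (b i)"
        using * that reflection_self[OF w0] by simp
      then show ?thesis by (rule eq_neg_0)
    qed
    then have "w = scale (B w (b m) / B (b m) (b m)) (b m)"
      using eq_scale_b[of m w] by (simp add: le_less)
    then obtain s where s: "w = scale s (b m)" by blast
    have "Q (b m) = (1 / s)\<^sup>2 * a"
      using w w0 by (auto simp: s Q_scale power_divide)
    then show False using Q_last by blast
  qed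
  show "\<not> (\<forall>i<m. r w (b i) = - b i)"
  proof
    assume *: "\<forall>i<m. r w (b i) = - b i"
    have "\<exists>s. b i = scale s w" if i: "i < m" for i
    proof -
      have "b i - scale (B (b i) w / Q w) w = - b i"
        using * i by (simp add: reflection_eq)
      then have "b i + b i = scale (B (b i) w / Q w) w"
        by (simp add: diff_eq_eq eq_diff_eq)
      also have "b i + b i = scale 2 (b i)"
        by (metis one_add_one scale_left_distrib scale_one)
      finally have "scale (1 / 2) (scale 2 (b i)) = scale (1 / 2) (scale (B (b i) w / Q w) w)"
        by simp
      then have "b i = scale (1 / 2 * (B (b i) w / Q w)) w"
        using two by simp
      then show ?thesis by blast
    qed
    then obtain s t where st: "b 0 = scale s w" "b 1 = scale t w"
      using m5 by (metis less_le_trans zero_less_numeral one_less_numeral_iff semiring_norm(77))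
    have "B (b 0) (b 1) = 0"
      using m5 by (intro orth) auto
    then have "s * (t * (2 * Q w)) = 0"
      unfolding st by (auto simp: B_scale_left B_scale_right B_self)
    then have "s = 0 \<or> t = 0" using two w0 by simp
    then show False using b_nz[of 0] b_nz[of 1] m5 unfolding st by auto
  qed
qed

theorem reflection_noninner:
  assumes fr: "frame scale Q m b a" and fr': "frame scale Q m b' (Q (b m))"
    and R: "R \<in> Syl 2 H" and PR: "P_grp m b \<subseteq> R" "P_grp m b' \<subseteq> R"
    and notin: "\<pi> (r (b m)) \<notin> carrier H"
  shows "reflection_aut scale Q (b m) ` R = R"
    "rigid H R (induced_link H R (reflection_aut scale Q (b m)))"
    "induced_link H R (reflection_aut scale Q (b m)) \<notin> Inn_link H R"
proof -
  interpret frame scale Q m b a by (fact fr)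
  interpret f': frame scale Q m b' "Q (b m)" by (fact fr')
  interpret L: linking H R
    by unfold_locales (use finite_H R in auto)
  let ?w = "b m" and ?a = "reflection_aut scale Q (b m)"
  let ?\<rho> = "\<pi> (r ?w)"
  have w: "Q ?w \<noteq> 0" using Qb_nz by simp
  have rw: "r ?w \<in> carrier OG" using reflection_OG[OF w] .
  have \<rho>: "?\<rho> \<in> carrier PO" using rw by simp
  have aut: "?a \<in> auto H" using reflection_aut_auto[OF w] .
  have subR: "subgroup R H" and "\<exists>k. card R = 2 ^ k"
    using R by (auto simp: Syl_def)
  then obtain k where k: "card R = 2 ^ k" by blast
  have fixR: "?a X = X" if X: "X \<in> R" for X
  proof -
    obtain g where g: "g \<in> \<Omega>" "X = \<pi> g"
      using subgroup.mem_carrier[OF subR X] by (auto simp: carrier_H)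
    then have "g ?w = ?w \<or> g ?w = - ?w"
      using fixed_line[OF subR k PR(1) \<Omega>_OG[OF g(1)]] X by simp
    then show ?thesis
      using reflection_aut_fixes[OF w g(1)] g(2) by simp
  qed
  then show "?a ` R = R" by simp
  show "rigid H R (induced_link H R ?a)"
    using L.rigid_induced[OF aut fixR] .
  show "induced_link H R ?a \<notin> Inn_link H R"
  proof (rule L.induced_not_in_Inn_link[OF aut fixR])
    fix X assume X: "X \<in> centralizer H R"
    then have XH: "X \<in> carrier H" by (simp add: centralizer_def)
    then obtain \<gamma> where \<gamma>: "\<gamma> \<in> \<Omega>" "X = \<pi> \<gamma>" by (auto simp: carrier_H)
    have \<gamma>O: "\<gamma> \<in> carrier OG" using \<Omega>_OG \<gamma> by blast
    \<comment> \<open>\<open>\<pi> t\<close> commutes with every element of \<open>H\<close> on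
      which conjugation by \<open>X\<close> and by the reflection agree.\<close>
    define t where "t = inv\<^bsub>OG\<^esub> \<gamma> \<otimes>\<^bsub>OG\<^esub> r ?w"
    have tO: "t \<in> carrier OG" using \<gamma>O rw by (simp add: t_def)
    have \<pi>t: "\<pi> t = inv\<^bsub>PO\<^esub> X \<otimes>\<^bsub>PO\<^esub> ?\<rho>"
      using \<gamma>O rw \<gamma>(2) by (simp add: t_def)
    have comm: "\<pi> t \<otimes>\<^bsub>PO\<^esub> c = c \<otimes>\<^bsub>PO\<^esub> \<pi> t"
      if c: "c \<in> carrier H" "X \<otimes>\<^bsub>H\<^esub> c \<otimes>\<^bsub>H\<^esub> inv\<^bsub>H\<^esub> X = ?a c" for c
      using PO.commute_if_conj_eq[OF H_PO[OF XH] \<rho> H_PO[OF c(1)]] c(2) XH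
      by (simp add: \<pi>t mult_H inv_H reflection_aut_eq[OF c(1)])
    have commR: "X \<otimes>\<^bsub>H\<^esub> c \<otimes>\<^bsub>H\<^esub> inv\<^bsub>H\<^esub> X = ?a c" if c: "c \<in> R" for c
    proof -
      have cH: "c \<in> carrier H" using c subgroup.mem_carrier[OF subR] by blast
      have "X \<otimes>\<^bsub>H\<^esub> c = c \<otimes>\<^bsub>H\<^esub> X" using X c by (simp add: centralizer_def)
      then show ?thesis
        using fixR[OF c] cH XH by (simp add: H.m_assoc)
    qed
    show "\<exists>P\<in>Obj (linking_system H R). odd_core_centralizer H P = {\<one>\<^bsub>H\<^esub>} \<and>
        (\<exists>c\<in>L.Tr P P. X \<otimes>\<^bsub>H\<^esub> c \<otimes>\<^bsub>H\<^esub> inv\<^bsub>H\<^esub> X \<noteq> ?a c)"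
    proof (rule ccontr)
      assume neg: "\<not> ?thesis"
      \<comment> \<open>The double reflections lie in \<open>R\<close>, where both conjugations are
        the identity; this makes \<open>t\<close> diagonal. On the 3-cycles the conjugations agree
        by \<open>neg\<close>, because \<open>K\<close> of the object is trivial.\<close>
      have scalar: "(\<forall>i<m. t (\<beta> i) = \<beta> i) \<or> (\<forall>i<m. t (\<beta> i) = - \<beta> i)"
        "\<forall>i\<le>m. t (\<beta> i) = \<beta> i \<or> t (\<beta> i) = - \<beta> i"
        if f\<beta>: "frame scale Q m \<beta> \<alpha>" and P\<beta>: "P_grp m \<beta> \<subseteq> R" for \<beta> \<alpha>
      proof -
        interpret \<beta>: frame scale Q m \<beta> \<alpha> by (fact f\<beta>)
        have dg: "\<beta>.diag t"
        proof (rule \<beta>.diag_if_commute[OF tO])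
          fix i j assume "i < m" "j < m" "i \<noteq> j"
          then have "\<pi> (refl2 \<beta> i j) \<in> E_set m \<beta>" by (auto simp: E_set_def)
          then have "\<pi> (refl2 \<beta> i j) \<in> R"
            using \<beta>.E_P P\<beta> by blast
          then show "\<pi> t \<otimes>\<^bsub>PO\<^esub> \<pi> (refl2 \<beta> i j) = \<pi> (refl2 \<beta> i j) \<otimes>\<^bsub>PO\<^esub> \<pi> t"
            using comm commR subgroup.mem_carrier[OF subR] by blast
        qed
        then show "\<forall>i\<le>m. t (\<beta> i) = \<beta> i \<or> t (\<beta> i) = - \<beta> i"
          by (simp add: \<beta>.diag_def)
        have Obj: "P_grp m \<beta> \<in> Obj (linking_system H R)"
          using \<beta>.P_two_centric(1) P\<beta> by (simp add: L.Obj_L)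
        show "(\<forall>i<m. t (\<beta> i) = \<beta> i) \<or> (\<forall>i<m. t (\<beta> i) = - \<beta> i)"
        proof (rule \<beta>.diag_const[OF tO dg])
          fix i j k assume ijk: "i < m" "j < m" "k < m" "i \<noteq> j" "j \<noteq> k" "i \<noteq> k"
          let ?c = "\<pi> (\<beta>.cyc i j k)"
          have cH: "?c \<in> carrier H"
            using \<beta>.cyc_\<Omega> ijk by (auto simp: carrier_H)
          have "?c \<in> L.Tr (P_grp m \<beta>) (P_grp m \<beta>)"
            using cH \<beta>.cyc_normalizes_P ijk by (simp add: L.Tr_def)
          then have "X \<otimes>\<^bsub>H\<^esub> ?c \<otimes>\<^bsub>H\<^esub> inv\<^bsub>H\<^esub> X = ?a ?c"
            using neg Obj \<beta>.P_two_centric(2) by blast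
          then show "\<pi> t \<otimes>\<^bsub>PO\<^esub> ?c = ?c \<otimes>\<^bsub>PO\<^esub> \<pi> t"
            using comm[OF cH] by blast
        qed
      qed
      have rb: "r ?w (b i) = b i" if "i < m" for i
        using refl_b[of m i] that by simp
      have rbm: "r ?w (b m) = - b m"
        using refl_b[of m m] by simp
      \<comment> \<open>One common sign on the vectors below \<open>m\<close> and an independent
        sign on \<open>b m\<close> leave four isometries.\<close>
      have "t = id \<or> t = uminus \<or> t = r ?w \<or> t = uminus \<circ> r ?w"
      proof -
        have "t = id" if "\<forall>i<m. t (b i) = b i" "t (b m) = b m"
          using that by (intro eq_on_basis[OF tO id_OG]) (auto simp: le_less)
        moreover have "t = uminus" if "\<forall>i<m. t (b i) = - b i" "t (b m) = - b m"
          using that by (intro eq_on_basis[OF tO uminus_OG]) (auto simp: le_less)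
        moreover have "t = r ?w" if "\<forall>i<m. t (b i) = b i" "t (b m) = - b m"
          using that rb rbm by (intro eq_on_basis[OF tO rw]) (auto simp: le_less)
        moreover have "t = uminus \<circ> r ?w" if "\<forall>i<m. t (b i) = - b i" "t (b m) = b m"
          using that rb rbm by (intro eq_on_basis[OF tO comp_OG[OF uminus_OG rw]]) (auto simp: le_less)
        ultimately show ?thesis
          using scalar[OF fr PR(1)] by blast
      qed
      moreover have "t \<noteq> r ?w"
        using scalar(1)[OF fr' PR(2)] reflection_not_scalar_on_frame[OF fr' refl] by fastforce
      moreover have "t \<noteq> uminus \<circ> r ?w"
      proof
        assume "t = uminus \<circ> r ?w"
        then have "r ?w x = - t x" for x by simp
        then show False
          using scalar(1)[OF fr' PR(2)] reflection_not_scalar_on_frame[OF fr' refl] by fastforce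
      qed
      ultimately have "t = id \<or> t = uminus" by blast
      then have "\<pi> t = \<one>\<^bsub>PO\<^esub>"
        using \<pi>_eq_iff[OF tO id_OG] \<pi>.hom_one by (auto simp: one_OG)
      then have "?\<rho> = X"
        using \<pi>t PO.eq_if_inv_mult_eq_one[of X ?\<rho>] H_PO[OF XH] \<rho> by simp
      then show False using notin XH by simp
    qed
  qed
qed

end

section \<open>Orthogonal bases over finite fields\<close>

text \<open>With \<open>4 * j\<close> nonzero elements, \<open>X^(2j) - 1\<close> cannot vanish at
  all of them. A nonzero \<open>x\<close> that is not a root has \<open>x ^ (4 * j) = 1\<close>,
  hence \<open>x ^ (2 * j) = -1\<close>, and \<open>x ^ j\<close> is the required root. In
  particular \<open>-1\<close> differs from 1, so the characteristic is not 2.\<close>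

lemma sqrt_minus_one:
  assumes "card (UNIV :: 'k::{field,finite} set) mod 4 = 1"
  shows "(2::'k) \<noteq> 0" "\<exists>z::'k. z\<^sup>2 = -1"
proof -
  define j where "j = card (UNIV :: 'k set) div 4"
  have card: "card (UNIV :: 'k set) = 4 * j + 1"
    using assms unfolding j_def by presburger
  have "card {0, 1::'k} \<le> card (UNIV :: 'k set)"
    by (rule card_mono) auto
  then have j: "j > 0" using card by simp
  define p :: "'k poly" where "p = Polynomial.monom 1 (2 * j) + [:- 1:]"
  have deg: "degree p = 2 * j"
    unfolding p_def using j by (subst degree_add_eq_left) (auto simp: degree_monom_eq)
  then have "p \<noteq> 0" using j by auto
  then have le: "card {x. poly p x = 0} \<le> 2 * j"
    using card_poly_roots_bound deg by metis
  have "\<exists>x. x \<noteq> 0 \<and> x ^ (2 * j) \<noteq> (1::'k)"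
  proof (rule ccontr)
    assume "\<nexists>x. x \<noteq> 0 \<and> x ^ (2 * j) \<noteq> (1::'k)"
    then have "UNIV - {0} \<subseteq> {x. poly p x = 0}"
      by (auto simp: p_def poly_monom)
    then have "card (UNIV - {0::'k}) \<le> 2 * j"
      using le card_mono[of "{x. poly p x = 0}"] by (meson finite_code order_trans)
    then show False using card j by (simp add: card_Diff_singleton)
  qed
  then obtain x :: 'k where x: "x \<noteq> 0" "x ^ (2 * j) \<noteq> 1" by blast
  let ?y = "x ^ (2 * j)"
  have "x ^ (4 * j) = 1"
  proof -
    \<comment> \<open>Multiplication by \<open>x\<close> permutes the nonzero elements; comparing
      the two products gives \<open>x ^ card ?U = 1\<close>.\<close>
    let ?U = "UNIV - {0::'k}"
    have "bij_betw (\<lambda>y. x * y) ?U ?U"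
      by (rule bij_betwI[where g = "\<lambda>y. y / x"]) (use x(1) in auto)
    then have "(\<Prod>y\<in>?U. x * y) = \<Prod>?U"
      by (rule prod.reindex_bij_betw)
    then have "x ^ card ?U * \<Prod>?U = \<Prod>?U"
      by (simp add: prod.distrib)
    moreover have "\<Prod>?U \<noteq> 0" by simp
    moreover have "card ?U = 4 * j"
      using card by (simp add: card_Diff_singleton)
    ultimately show ?thesis by simp
  qed
  then have y2: "?y\<^sup>2 = 1"
    by (simp add: power_mult[symmetric] mult.commute)
  then have y: "?y = -1"
    using x(2) by (simp add: power2_eq_1_iff)
  show "(2::'k) \<noteq> 0"
  proof
    assume "(2::'k) = 0"
    then have "1 + 1 = (0::'k)" by simp
    then have "-1 = (1::'k)" by (metis add_eq_0_iff)
    then show False using x(2) y by simp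
  qed
  have "(x ^ j)\<^sup>2 = -1"
    using y by (simp add: power_mult[symmetric] mult.commute)
  then show "\<exists>z::'k. z\<^sup>2 = -1" by blast
qed

text \<open>Both sides of \<open>p x\<^sup>2 = a - q y\<^sup>2\<close> take more than half of all values.\<close>

lemma binary_form_universal:
  fixes p q a :: "'k::{field,finite}"
  assumes two: "(2::'k) \<noteq> 0" and p: "p \<noteq> 0" and q: "q \<noteq> 0"
  shows "\<exists>x y. p * x\<^sup>2 + q * y\<^sup>2 = a"
proof -
  let ?S = "range (\<lambda>x::'k. x\<^sup>2)"
  \<comment> \<open>The fibres of squaring over nonzero values have at most two elements, which
    bounds the number of squares from below.\<close>
  have "(UNIV :: 'k set) - {0} = (\<Union>s\<in>?S - {0}. {x. x\<^sup>2 = s})"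
    by auto
  then have "card ((UNIV :: 'k set) - {0}) \<le> (\<Sum>s\<in>?S - {0}. card {x. x\<^sup>2 = s})"
    using card_UN_le[of "?S - {0}" "\<lambda>s. {x. x\<^sup>2 = s}"] by simp
  also have "\<dots> \<le> (\<Sum>s\<in>?S - {0}. 2)"
  proof (rule sum_mono)
    fix s assume "s \<in> ?S - {0}"
    then obtain x where "s = x\<^sup>2" by auto
    then have "{y. y\<^sup>2 = s} \<subseteq> {x, - x}"
      by (auto simp: power2_eq_iff)
    then have "card {y. y\<^sup>2 = s} \<le> card {x, - x}"
      by (intro card_mono) auto
    also have "\<dots> \<le> 2"
      by (simp add: card_insert_if)
    finally show "card {y. y\<^sup>2 = s} \<le> 2" .
  qed
  also have "\<dots> = 2 * (card ?S - 1)"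
    by (auto simp: card_Diff_singleton image_iff)
  finally have "card (UNIV :: 'k set) - 1 \<le> 2 * (card ?S - 1)"
    by (simp add: card_Diff_singleton)
  moreover have "card ?S > 0"
    by (simp add: card_gt_0_iff)
  ultimately have le: "card (UNIV :: 'k set) \<le> 2 * card ?S - 1"
    by linarith
  have inj1: "inj (\<lambda>s. p * s)" and inj2: "inj (\<lambda>s. a - q * s)"
    using p q by (auto simp: inj_on_def)
  let ?X = "(\<lambda>s. p * s) ` ?S" and ?Y = "(\<lambda>s. a - q * s) ` ?S"
  have c: "card ?X = card ?S" "card ?Y = card ?S"
    using card_image[OF inj_on_subset[OF inj1 subset_UNIV]]
      card_image[OF inj_on_subset[OF inj2 subset_UNIV]] by blast+
  have "?X \<inter> ?Y \<noteq> {}"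
  proof
    assume "?X \<inter> ?Y = {}"
    then have "card (?X \<union> ?Y) = 2 * card ?S"
      using card_Un_disjoint[of ?X ?Y] c by simp
    moreover have "card (?X \<union> ?Y) \<le> card (UNIV :: 'k set)"
      by (rule card_mono) auto
    moreover have "card (UNIV :: 'k set) > 0"
      by (rule finite_UNIV_card_ge_0) simp
    ultimately show False using le by linarith
  qed
  then obtain x y where "p * x\<^sup>2 = a - q * y\<^sup>2" by auto
  then have "p * x\<^sup>2 + q * y\<^sup>2 = a" by simp
  then show ?thesis by blast
qed

section \<open>Extending orthogonal families of anisotropic vectors\<close>

context quad_space
begin

lemma independent_pairing:
  assumes "finite A" "\<And>x. x \<in> A \<Longrightarrow> \<exists>y. B x y \<noteq> 0 \<and> (\<forall>x'\<in>A - {x}. B x' y = 0)"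
  shows "independent A"
proof (rule independent_if_scalars_zero[OF assms(1)])
  fix f x assume sum: "(\<Sum>x\<in>A. scale (f x) x) = 0" and x: "x \<in> A"
  obtain y where y: "B x y \<noteq> 0" "\<forall>x'\<in>A - {x}. B x' y = 0" using assms(2)[OF x] by blast
  have "0 = (\<Sum>x\<in>A. f x * B x y)"
    using arg_cong[OF sum, of "\<lambda>v. B v y"] by (simp add: B_sum_left B_scale_left)
  also have "\<dots> = f x * B x y"
    using sum.remove[OF assms(1) x, of "\<lambda>x. f x * B x y"] y(2) by simp
  finally show "f x = 0" using y(1) by simp
qed

lemma span_totally_isotropic:
  assumes "\<And>x y. x \<in> A \<Longrightarrow> y \<in> A \<Longrightarrow> B x y = 0" "w \<in> span A"
  shows "Q w = 0"
proof -
  have 1: "B x y = 0" if "x \<in> span A" "y \<in> A" for x y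
    using that(1) by (induction rule: span_induct_alt)
      (use assms(1) that(2) in \<open>auto simp: B_add_left B_scale_left\<close>)
  have "B x y = 0" if "y \<in> span A" "x \<in> span A" for x y
    using that(1) by (induction rule: span_induct_alt)
      (use 1[OF that(2)] in \<open>auto simp: B_add_right B_scale_right\<close>)
  then have "B w w = 0" using assms(2) by blast
  then show ?thesis by simp
qed

definition orth_family :: "nat \<Rightarrow> (nat \<Rightarrow> 'v) \<Rightarrow> bool" where
  "orth_family k b \<longleftrightarrow> (\<forall>i<k. Q (b i) \<noteq> 0) \<and> (\<forall>i<k. \<forall>j<k. i \<noteq> j \<longrightarrow> B (b i) (b j) = 0)"

lemma orth_family_independent:
  assumes "orth_family k b"
  shows "independent (b ` {..<k})" "card (b ` {..<k}) = k"
proof -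
  have nz: "B (b i) (b i) \<noteq> 0" if "i < k" for i
    using assms that by (simp add: orth_family_def)
  have z: "B (b i) (b j) = 0" if "i < k" "j < k" "i \<noteq> j" for i j
    using assms that by (simp add: orth_family_def)
  have "inj_on b {..<k}"
  proof (rule inj_onI)
    fix i j assume "i \<in> {..<k}" "j \<in> {..<k}" "b i = b j"
    then show "i = j"
      using nz[of i] z[of i j] by auto
  qed
  then show "card (b ` {..<k}) = k"
    by (simp add: card_image)
  show "independent (b ` {..<k})"
  proof (rule independent_pairing)
    fix x assume "x \<in> b ` {..<k}"
    then obtain i where i: "i < k" "x = b i" by auto
    have "B x' x = 0" if "x' \<in> b ` {..<k} - {x}" for x'
      using that z[of _ i] i by auto
    then show "\<exists>y. B x y \<noteq> 0 \<and> (\<forall>x'\<in>b ` {..<k} - {x}. B x' y = 0)"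
      using nz[OF i(1)] i(2) by blast
  qed simp
qed

text \<open>Let \<open>p\<close> be the orthogonal projection onto the span. On the orthogonal
  complement \<open>Q\<close> vanishes, hence by polarization so does the form. Thus
  \<open>x - p x\<close> is orthogonal both to the complement and to the span, and nondegeneracy
  gives \<open>x = p x\<close>.\<close>

lemma orth_family_extend_aux:
  assumes b: "orth_family k b" and U: "\<And>u. (\<And>i. i < k \<Longrightarrow> B u (b i) = 0) \<Longrightarrow> Q u = 0"
  shows "span (b ` {..<k}) = UNIV"
proof -
  define p where "p = (\<lambda>x. \<Sum>i<k. scale (B x (b i) / B (b i) (b i)) (b i))"
  have pb: "B (p x) (b j) = B x (b j)" if j: "j < k" for x j
  proof -
    have "B (p x) (b j) = (\<Sum>i<k. B x (b i) / B (b i) (b i) * B (b i) (b j))"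
      by (simp add: p_def B_sum_left B_scale_left)
    also have "\<dots> = B x (b j) / B (b j) (b j) * B (b j) (b j)"
      using sum.remove[of "{..<k}" j "\<lambda>i. B x (b i) / B (b i) (b i) * B (b i) (b j)"] j b
      by (simp add: orth_family_def)
    also have "\<dots> = B x (b j)"
      using b j by (simp add: orth_family_def)
    finally show ?thesis .
  qed
  have "x = p x" for x
  proof -
    let ?u = "x - p x"
    have u: "B ?u (b i) = 0" if "i < k" for i
      using pb[OF that] by (simp add: B_diff_left)
    have "B ?u y = 0" for y
    proof -
      have v: "B (y - p y) (b i) = 0" if "i < k" for i
        using pb[OF that] by (simp add: B_diff_left)
      have "B ?u (p y) = 0"
        using u by (subst B_commute) (simp add: p_def B_sum_left B_scale_left B_commute)
      moreover have "Q (?u + (y - p y)) = 0" "Q ?u = 0" "Q (y - p y) = 0"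
        using u v by (auto intro!: U simp: B_add_left)
      then have "B ?u (y - p y) = 0"
        by (simp add: polar_def)
      ultimately show ?thesis
        using B_add_right[of ?u "y - p y" "p y"] by simp
    qed
    then have "?u = 0"
      using nondeg unfolding nondegenerate_def by blast
    then show ?thesis by simp
  qed
  moreover have "p x \<in> span (b ` {..<k})" for x
    unfolding p_def by (intro span_sum span_scale span_base) simp
  ultimately show ?thesis by (metis UNIV_eq_I)
qed

lemma orth_family_extend:
  assumes b: "orth_family k b" and k: "k < dim UNIV"
  shows "\<exists>u. Q u \<noteq> 0 \<and> (\<forall>i<k. B u (b i) = 0)"
proof (rule ccontr)
  assume "\<not> ?thesis"
  then have "span (b ` {..<k}) = UNIV"
    using orth_family_extend_aux[OF b] by blast
  then have "dim UNIV = k"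
    using dim_eq_card[of "b ` {..<k}" UNIV] orth_family_independent[OF b] by simp
  then show False using k by simp
qed

lemma orth_family_upd:
  assumes "orth_family k b" "Q u \<noteq> 0" "\<forall>i<k. B u (b i) = 0"
  shows "orth_family (Suc k) (b(k := u))"
  using assms B_commute by (auto simp: orth_family_def less_Suc_eq)

lemma orth_family_le_dim:
  assumes "orth_family k b"
  shows "k \<le> dim UNIV"
proof -
  obtain A where A: "independent A" "UNIV \<subseteq> span A" "card A = dim UNIV"
    using basis_exists[of UNIV] by blast
  have "finite A"
    by (rule finite_subset[OF subset_UNIV fin_space])
  then show ?thesis
    using independent_span_bound[of A "b ` {..<k}"] A orth_family_independent[OF assms] by auto
qed

text \<open>A further anisotropic vector orthogonal to the family would extend it beyond the
  dimension, so the family spans, and a vector orthogonal to it is orthogonal to everything.\<close>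

lemma orth_family_separating:
  assumes b: "orth_family (dim UNIV) b" and x: "\<And>i. i < dim UNIV \<Longrightarrow> B x (b i) = 0"
  shows "x = 0"
proof -
  have "span (b ` {..<dim UNIV}) = UNIV"
  proof (rule orth_family_extend_aux[OF b])
    fix u assume "\<And>i. i < dim UNIV \<Longrightarrow> B u (b i) = 0"
    then show "Q u = 0"
      using orth_family_le_dim[OF orth_family_upd[OF b, of u]] by auto
  qed
  then have "y \<in> span (b ` {..<dim UNIV})" for y by simp
  then have "B x y = 0" for y
    by (induction rule: span_induct_alt) (use x in \<open>auto simp: B_add_right B_scale_right\<close>)
  then show ?thesis
    using nondeg by (simp add: nondegenerate_def)
qed

end

locale finite_quad_space = quad_space scale Q
  for scale :: "'k::{field,finite} \<Rightarrow> 'v::ab_group_add \<Rightarrow> 'v" and Q +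
  fixes n :: nat and \<iota> :: 'k
  assumes n3: "3 \<le> n" and dim: "dim UNIV = 2 * n" and witt: "witt_index scale Q < n"
    and \<iota>: "\<iota>\<^sup>2 = -1"
begin

text \<open>Two more orthogonal anisotropic vectors are available, and the binary form on their
  plane represents every value. With only one dimension left this fails, so the norm of the last
  basis vector cannot be prescribed.\<close>

lemma orth_family_extend_norm:
  assumes b: "orth_family k b" and k: "k + 2 \<le> 2 * n"
  shows "\<exists>u. Q u = a \<and> (\<forall>i<k. B u (b i) = 0)"
proof -
  obtain u where u: "Q u \<noteq> 0" "\<forall>i<k. B u (b i) = 0"
    using orth_family_extend[OF b] k dim by auto
  obtain v where v: "Q v \<noteq> 0" "\<forall>i<Suc k. B v ((b(k := u)) i) = 0"
    using orth_family_extend[OF orth_family_upd[OF b u]] k dim by auto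
  have uv: "B v u = 0" "\<forall>i<k. B v (b i) = 0"
    using v(2) by (auto simp: All_less_Suc)
  obtain x y where xy: "Q u * x\<^sup>2 + Q v * y\<^sup>2 = a"
    using binary_form_universal[OF two u(1) v(1)] by blast
  let ?w = "scale x u + scale y v"
  have "Q ?w = a"
    using uv(1) xy B_commute[of u v]
    by (simp add: Q_add Q_scale B_scale_left B_scale_right mult.commute)
  moreover have "\<forall>i<k. B ?w (b i) = 0"
    using u uv by (simp add: B_add_left B_scale_left)
  ultimately show ?thesis by blast
qed

lemma orth_family_norm:
  assumes "a \<noteq> 0" "k < 2 * n"
  shows "\<exists>b. orth_family k b \<and> (\<forall>i<k. Q (b i) = a)"
  using assms(2)
proof (induction k)
  case 0
  then show ?case by (simp add: orth_family_def)
next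
  case (Suc k)
  then obtain b where b: "orth_family k b" "\<forall>i<k. Q (b i) = a" by auto
  obtain u where u: "Q u = a" "\<forall>i<k. B u (b i) = 0"
    using orth_family_extend_norm[OF b(1)] Suc.prems by auto
  then have "orth_family (Suc k) (b(k := u))"
    using orth_family_upd[OF b(1)] assms(1) by simp
  moreover have "\<forall>i<Suc k. Q ((b(k := u)) i) = a"
    using b u by (auto simp: less_Suc_eq)
  ultimately show ?case by blast
qed

text \<open>The vectors \<open>b\<^sub>2\<^sub>i + \<iota> b\<^sub>2\<^sub>i\<^sub>+\<^sub>1\<close> span a totally singular subspace.\<close>

lemma no_orth_family_equal_norm:
  assumes b: "orth_family (2 * n) b" "\<And>i. i < 2 * n \<Longrightarrow> Q (b i) = a"
  shows False
proof -
  have a: "a \<noteq> 0" using b(1) b(2)[of 0] n3 by (auto simp: orth_family_def)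
  have orth: "B (b i) (b j) = 0" if "i < 2 * n" "j < 2 * n" "i \<noteq> j" for i j
    using b(1) that by (simp add: orth_family_def)
  have self: "B (b i) (b i) = 2 * a" if "i < 2 * n" for i
    using b(2)[OF that] by (simp add: B_self)
  define e where "e = (\<lambda>i. b (2 * i) + scale \<iota> (b (2 * i + 1)))"
  have ee: "B (e i) (e j) = 0" if ij: "i < n" "j < n" for i j
  proof (cases "i = j")
    case True
    have "B (e i) (e i) = 2 * a + \<iota>\<^sup>2 * (2 * a)"
      using ij orth[of "2 * i" "2 * i + 1"] orth[of "2 * i + 1" "2 * i"]
        self[of "2 * i"] self[of "2 * i + 1"]
      unfolding e_def B_add_left B_add_right B_scale_left B_scale_right
      by (simp add: power2_eq_square)
    then have "B (e i) (e i) = 0" by (simp add: \<iota>)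
    then show ?thesis using True by blast
  next
    case False
    then have "2 * i + 1 \<noteq> 2 * j" "2 * i \<noteq> 2 * j + 1" by presburger+
    then show ?thesis
      using False ij orth[of "2 * i" "2 * j"] orth[of "2 * i + 1" "2 * j"] orth[of "2 * i" "2 * j + 1"]
        orth[of "2 * i + 1" "2 * j + 1"]
      by (simp add: e_def B_add_left B_add_right B_scale_left B_scale_right)
  qed
  \<comment> \<open>Up to the factor \<open>2 * a\<close>, the vectors \<open>b (2 * j)\<close> are
    dual to the \<open>e i\<close>; this yields injectivity of \<open>e\<close> and
    independence.\<close>
  have eb: "B (e i) (b (2 * j)) = (if i = j then 2 * a else 0)" if ij: "i < n" "j < n" for i j
  proof -
    have "2 * i + 1 \<noteq> 2 * j" by presburger
    then show ?thesis
      using ij orth[of "2 * i" "2 * j"] orth[of "2 * i + 1" "2 * j"] self[of "2 * i"]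
      by (auto simp: e_def B_add_left B_scale_left)
  qed
  have a2: "2 * a \<noteq> 0" using two a by simp
  let ?A = "e ` {..<n}"
  have inj: "inj_on e {..<n}"
  proof (rule inj_onI)
    fix i j assume ij: "i \<in> {..<n}" "j \<in> {..<n}" "e i = e j"
    show "i = j"
    proof (rule ccontr)
      assume "i \<noteq> j"
      then have "B (e j) (b (2 * i)) = 0" "B (e i) (b (2 * i)) = 2 * a"
        using eb[of j i] eb[of i i] ij(1,2) by simp_all
      then show False using ij(3) a2 by metis
    qed
  qed
  have "independent ?A"
  proof (rule independent_pairing)
    fix x assume "x \<in> ?A"
    then obtain i where i: "i < n" "x = e i" by auto
    show "\<exists>y. B x y \<noteq> 0 \<and> (\<forall>x'\<in>?A - {x}. B x' y = 0)"
      using eb i a2 by (intro exI[of _ "b (2 * i)"]) (auto split: if_splits)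
  qed simp
  then have dimA: "dim (span ?A) = n"
    using dim_eq_card_independent inj by (simp add: card_image)
  let ?D = "{dim W |W. subspace W \<and> (\<forall>w\<in>W. Q w = 0)}"
  have "finite ?D"
  proof (rule finite_image_set)
    have "finite (Pow (UNIV :: 'v set))" using fin_space by (rule finite_Pow_iff[THEN iffD2])
    then show "finite {W. subspace W \<and> (\<forall>w\<in>W. Q w = 0)}"
      by (rule finite_subset[rotated]) auto
  qed
  moreover have "n \<in> ?D"
    using dimA span_totally_isotropic[of ?A] ee
    by (intro CollectI exI[of _ "span ?A"]) auto
  ultimately have "n \<le> witt_index scale Q"
    unfolding witt_index_def by (intro Max_ge) auto
  then show False using witt by simp
qed

text \<open>If the last vector \<open>u\<close> had norm \<open>s\<^sup>2 * a\<close>, rescaling it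
  by \<open>1 / s\<close> would complete an orthogonal basis of constant norm \<open>a\<close>,
  which \<open>no_orth_family_equal_norm\<close> forbids.\<close>

theorem frame_exists:
  assumes a: "a \<noteq> 0"
  shows "\<exists>b. frame scale Q (2 * n - 1) b a"
proof -
  let ?m = "2 * n - 1"
  have m: "Suc ?m = 2 * n" using n3 by simp
  obtain c where c: "orth_family ?m c" "\<forall>i<?m. Q (c i) = a"
    using orth_family_norm[OF a, of ?m] n3 by auto
  obtain u where u: "Q u \<noteq> 0" "\<forall>i<?m. B u (c i) = 0"
    using orth_family_extend[OF c(1)] dim n3 by auto
  define b where "b = c(?m := u)"
  have b: "orth_family (2 * n) b"
    using orth_family_upd[OF c(1) u] m by (simp add: b_def)
  have "frame scale Q ?m b a"
  proof unfold_locales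
    show "5 \<le> ?m" using n3 by simp
    show "a \<noteq> 0" by (fact a)
    show "B (b i) (b j) = 0" if "i \<le> ?m" "j \<le> ?m" "i \<noteq> j" for i j
    proof -
      have "i < 2 * n" "j < 2 * n" using that n3 by auto
      then show ?thesis using b that(3) by (simp add: orth_family_def)
    qed
    show "Q (b i) = a" if "i < ?m" for i
      using c that by (simp add: b_def)
    show "Q (b ?m) \<noteq> s\<^sup>2 * a" for s
    proof
      assume eq: "Q (b ?m) = s\<^sup>2 * a"
      then have s: "s \<noteq> 0" using u by (auto simp: b_def)
      let ?u = "scale (1 / s) u"
      have Qu: "Q ?u = a"
        using eq s by (simp add: b_def Q_scale power_divide)
      have "orth_family (2 * n) (c(?m := ?u))"
        using orth_family_upd[OF c(1), of ?u] Qu a u(2) m by (simp add: B_scale_left)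
      moreover have "Q ((c(?m := ?u)) i) = a" if "i < 2 * n" for i
      proof -
        have "i < ?m \<or> i = ?m" using that by linarith
        then show ?thesis using Qu c(2) by auto
      qed
      ultimately show False by (rule no_orth_family_equal_norm)
    qed
    show "x = 0" if "\<And>i. i \<le> ?m \<Longrightarrow> B x (b i) = 0" for x
      using orth_family_separating[of b x] b dim that by simp
  qed
  then show ?thesis by blast
qed

end

section \<open>Determinants\<close>

text \<open>\<open>D\<close> is the determinant of the matrix with respect to the basis
  \<open>b\<close> and its dual coordinates \<open>co\<close>. Multiplicativity and the values on
  diagonal maps are all that the argument about \<open>\<Omega>\<close> uses.\<close>

lemma (in vector_space) exists_determinant:
  fixes co :: "nat \<Rightarrow> 'b \<Rightarrow> 'a"
  assumes co_add: "\<And>i x y. co i (x + y) = co i x + co i y"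
    and co_scale: "\<And>i c x. co i (scale c x) = c * co i x"
    and dual: "\<And>i j. i < N \<Longrightarrow> j < N \<Longrightarrow> co i (b j) = (if i = j then 1 else 0)"
    and expand: "\<And>x. x = (\<Sum>k<N. scale (co k x) (b k))"
  shows "\<exists>D. (\<forall>g h. Vector_Spaces.linear scale scale g \<longrightarrow> D (g \<circ> h) = D g * D h) \<and>
    (\<forall>g e. (\<forall>j<N. g (b j) = scale (e j) (b j)) \<longrightarrow> D g = (\<Prod>j<N. e j))"
proof -
  define M where "M = (\<lambda>g. mat N N (\<lambda>(i, j). co i (g (b j))))"
  have M: "M g \<in> carrier_mat N N" for g
    by (simp add: M_def)
  have co_0: "co i 0 = 0" for i
    using co_scale[of i 0 0] by simp
  have co_sum: "co i (\<Sum>k\<in>A. f k) = (\<Sum>k\<in>A. co i (f k))" for i f and A :: "nat set"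
    by (induction A rule: infinite_finite_induct) (simp_all add: co_add co_0)
  have "M (g \<circ> h) = M g * M h" if g: "Vector_Spaces.linear scale scale g" for g h
  proof (rule eq_matI)
    fix i j assume "i < dim_row (M g * M h)" "j < dim_col (M g * M h)"
    then have ij: "i < N" "j < N" by (simp_all add: M_def)
    interpret g: Vector_Spaces.linear scale scale g by (fact g)
    have "g (h (b j)) = (\<Sum>k<N. scale (co k (h (b j))) (g (b k)))"
      by (subst expand[of "h (b j)"]) (simp add: g.sum g.scale)
    then have "co i (g (h (b j))) = (\<Sum>k<N. co i (g (b k)) * co k (h (b j)))"
      by (simp add: co_sum co_scale mult.commute)
    then show "M (g \<circ> h) $$ (i, j) = (M g * M h) $$ (i, j)"
      using ij by (simp add: M_def scalar_prod_def lessThan_atLeast0)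
  qed (simp_all add: M_def)
  then have "det (M (g \<circ> h)) = det (M g) * det (M h)" if "Vector_Spaces.linear scale scale g" for g h
    using that det_mult[OF M M] by simp
  moreover have "det (M g) = (\<Prod>j<N. e j)" if e: "\<forall>j<N. g (b j) = scale (e j) (b j)" for g e
  proof -
    have entry: "M g $$ (i, j) = (if i = j then e j else 0)" if "i < N" "j < N" for i j
      using that e dual by (simp add: M_def co_scale)
    have "det (M g) = prod_list (diag_mat (M g))"
      using M entry by (intro det_lower_triangular[of N]) auto
    also have "\<dots> = (\<Prod>j<N. M g $$ (j, j))"
      using M[of g] by (simp add: prod_list_diag_prod lessThan_atLeast0)
    also have "\<dots> = (\<Prod>j<N. e j)"
      by (intro prod.cong) (simp_all add: entry)
    finally show ?thesis .
  qed
  ultimately show ?thesis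
    by (intro exI[of _ "\<lambda>g. det (M g)"]) blast
qed

text \<open>The determinant is 1 on \<open>\<Omega>\<close> and \<open>-1\<close> on both preimages of the class of the reflection,
  because the dimension is even.\<close>

lemma (in frame) reflection_notin_H:
  assumes "odd m"
  shows "\<pi> (r (b m)) \<notin> carrier H"
proof
  assume "\<pi> (r (b m)) \<in> carrier H"
  then obtain \<gamma> where \<gamma>: "\<gamma> \<in> \<Omega>" "\<pi> (r (b m)) = \<pi> \<gamma>" by (auto simp: carrier_H)
  have rw: "r (b m) \<in> carrier OG" using refl_OG by simp
  have \<gamma>_eq: "\<gamma> = r (b m) \<or> \<gamma> = uminus \<circ> r (b m)"
    using \<pi>_eq_iff[OF \<Omega>_OG[OF \<gamma>(1)] rw] \<gamma>(2) by simp
  define co where "co = (\<lambda>i x. B x (b i) / B (b i) (b i))"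
  have dual: "co i (b j) = (if i = j then 1 else 0)" if "i < Suc m" "j < Suc m" for i j
    using that orth[of j i] Qb_nz[of i] by (auto simp: co_def)
  have "x = (\<Sum>k<Suc m. scale (co k x) (b k))" for x
  proof (rule eqI)
    fix i assume i: "i \<le> m"
    have "B (\<Sum>k<Suc m. scale (co k x) (b k)) (b i) = (\<Sum>k<Suc m. co k x * B (b k) (b i))"
      by (simp only: B_sum_left B_scale_left)
    also have "\<dots> = co i x * B (b i) (b i)"
      using sum.remove[of "{..<Suc m}" i "\<lambda>k. co k x * B (b k) (b i)"] i orth[of _ i] by simp
    also have "\<dots> = B x (b i)"
      using Qb_nz[OF i] by (simp add: co_def)
    finally show "B x (b i) = B (\<Sum>k<Suc m. scale (co k x) (b k)) (b i)" by simp
  qed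
  then obtain D where "\<forall>g h. Vector_Spaces.linear scale scale g \<longrightarrow> D (g \<circ> h) = D g * D h"
    and D_diag: "\<forall>g e. (\<forall>j<Suc m. g (b j) = scale (e j) (b j)) \<longrightarrow> D g = (\<Prod>j<Suc m. e j)"
    using exists_determinant[of co "Suc m" b] dual
    by (auto simp: co_def B_add_left B_scale_left add_divide_distrib)
  then have D_mult: "D (g \<circ> h) = D g * D h" if "g \<in> carrier OG" for g h
    using that by (simp add: carrier_OG)
  have D_id: "D id = 1"
    using D_diag[rule_format, of id "\<lambda>_. 1"] by simp
  have D_inv: "D g * D (Hilbert_Choice.inv g) = 1" if "g \<in> carrier OG" for g
    using D_mult[OF that, of "Hilbert_Choice.inv g"] inv_comp_OG(2)[OF that] D_id by simp
  \<comment> \<open>The kernel of \<open>D\<close> is a subgroup containing all commutators, hence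
    all of \<open>\<Omega>\<close>.\<close>
  have "subgroup {g \<in> carrier OG. D g = 1} OG"
  proof (rule OG.subgroupI)
    show "{g \<in> carrier OG. D g = 1} \<noteq> {}"
      using id_OG D_id by blast
    show "inv\<^bsub>OG\<^esub> g \<in> {g \<in> carrier OG. D g = 1}" if "g \<in> {g \<in> carrier OG. D g = 1}" for g
      using that D_inv[of g] by (simp add: inv_OG inv_OG_closed)
    show "g \<otimes>\<^bsub>OG\<^esub> h \<in> {g \<in> carrier OG. D g = 1}"
      if "g \<in> {g \<in> carrier OG. D g = 1}" "h \<in> {g \<in> carrier OG. D g = 1}" for g h
      using that D_mult by (simp add: mult_OG comp_OG)
  qed auto
  moreover have "derived_set OG (carrier OG) \<subseteq> {g \<in> carrier OG. D g = 1}"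
  proof
    fix x assume "x \<in> derived_set OG (carrier OG)"
    then obtain g h where gh: "g \<in> carrier OG" "h \<in> carrier OG"
      and x: "x = g \<otimes>\<^bsub>OG\<^esub> h \<otimes>\<^bsub>OG\<^esub> inv\<^bsub>OG\<^esub> g \<otimes>\<^bsub>OG\<^esub> inv\<^bsub>OG\<^esub> h"
      by (elim UN_E) simp
    have "D x = D g * D h * D (Hilbert_Choice.inv g) * D (Hilbert_Choice.inv h)"
      using gh by (simp add: x mult_OG inv_OG inv_OG_closed comp_OG D_mult)
    also have "\<dots> = (D g * D (Hilbert_Choice.inv g)) * (D h * D (Hilbert_Choice.inv h))"
      by (simp only: mult.assoc mult.left_commute)
    also have "\<dots> = 1"
      using D_inv gh by simp
    finally show "x \<in> {g \<in> carrier OG. D g = 1}"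
      using gh by (simp add: x)
  qed
  ultimately have "\<Omega> \<subseteq> {g \<in> carrier OG. D g = 1}"
    unfolding Omega_def derived_def by (intro OG.generate_subgroup_incl)
  then have "D \<gamma> = 1" using \<gamma>(1) by blast
  moreover have "D (r (b m)) = (\<Prod>j<Suc m. if j = m then -1 else 1)"
    by (rule D_diag[rule_format]) (auto simp: refl_b less_Suc_eq)
  \<comment> \<open>The \<open>m\<close> entries -1 multiply to -1 because \<open>m\<close> is
    odd.\<close>
  moreover have "D (uminus \<circ> r (b m)) = (\<Prod>j<Suc m. if j = m then 1 else -1)"
    by (rule D_diag[rule_format]) (auto simp: refl_b less_Suc_eq)
  moreover have "(\<Prod>j<m. if j = m then 1 else -1 :: 'k) = (\<Prod>j<m. -1)"
    "(\<Prod>j<m. if j = m then -1 else 1 :: 'k) = (\<Prod>j<m. 1)"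
    by (auto intro!: prod.cong)
  ultimately have "(-1 :: 'k) = 1"
    using \<gamma>_eq assms by auto
  then show False
    using two by (metis add.right_inverse one_add_one)
qed

theorem theorem5p21:
  fixes q0 l n :: nat
    and scale :: "'k::{field,finite} \<Rightarrow> 'v::ab_group_add \<Rightarrow> 'v"
    and Q :: "'v \<Rightarrow> 'k"
    and R :: "('v \<Rightarrow> 'v) set set"
  assumes "prime q0" and "q0 mod 4 = 1"
    and "card (UNIV :: 'k set) = q0 ^ (2 ^ l)"
    and "n \<ge> 3"
    and "vector_space scale" and "vector_space.dim scale UNIV = 2 * n"
    and "quadratic_form scale Q" and "nondegenerate Q" and "witt_index scale Q = n - 1"
    and "R \<in> Syl 2 (POmega scale Q)"
  shows "\<exists>\<alpha> w. \<alpha> \<in> carrier (Aut_link (POmega scale Q) R) \<and>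
           rigid (POmega scale Q) R \<alpha> \<and>
           \<alpha> \<notin> Inn_link (POmega scale Q) R \<and>
           anisotropic Q w \<and>
           induced_by_reflection scale Q R w \<alpha>"
proof -
  interpret vector_space scale by (fact assms(5))
  have "card (UNIV :: 'k set) mod 4 = (q0 mod 4) ^ (2 ^ l) mod 4"
    unfolding assms(3) by (rule power_mod[symmetric])
  then have card: "card (UNIV :: 'k set) mod 4 = 1"
    using assms(2) by simp
  obtain \<iota> :: 'k where \<iota>: "\<iota>\<^sup>2 = -1"
    using sqrt_minus_one(2)[OF card] by blast
  obtain A where A: "independent A" "UNIV \<subseteq> span A" "card A = dim UNIV"
    using basis_exists[of UNIV] by blast
  \<comment> \<open>Infinite sets have \<open>card\<close> 0, so positive dimension makes the basis
    finite; together with the finite field this makes the whole space finite.\<close>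
  have "card A > 0" using A(3) assms(4,6) by simp
  then have finA: "finite A" and "A \<noteq> {}" by (auto simp: card_gt_0_iff)
  have "x \<in> (\<lambda>u. \<Sum>v\<in>A. scale (u v) v) ` (A \<rightarrow>\<^sub>E UNIV)" for x
  proof -
    obtain u where "x = (\<Sum>v\<in>A. scale (u v) v)"
      using A(2) span_finite[OF finA] by blast
    also have "\<dots> = (\<Sum>v\<in>A. scale (restrict u A v) v)"
      by (intro sum.cong) auto
    finally show ?thesis by (intro image_eqI[of _ _ "restrict u A"]) auto
  qed
  then have "UNIV \<subseteq> (\<lambda>u. \<Sum>v\<in>A. scale (u v) v) ` (A \<rightarrow>\<^sub>E (UNIV :: 'k set))" by blast
  then have fin: "finite (UNIV :: 'v set)"
    by (rule finite_subset) (intro finite_imageI finite_PiE finA finite)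
  obtain v where "v \<in> A" using \<open>A \<noteq> {}\<close> by blast
  then have "v \<noteq> 0" using A(1) dependent_zero by metis
  interpret finite_quad_space scale Q n \<iota>
    by unfold_locales
      (use assms(4,6-9) sqrt_minus_one(1)[OF card] fin \<open>v \<noteq> 0\<close> \<iota> in auto)
  let ?m = "2 * n - 1"
  obtain b where b: "frame scale Q ?m b 1" "P_grp ?m b \<subseteq> R"
    using frame_exists[of 1] frame_conj_into_Syl[OF _ assms(10)] by force
  interpret frame scale Q ?m b 1 by (fact b(1))
  have w: "Q (b ?m) \<noteq> 0" using Qb_nz by simp
  obtain b' where b': "frame scale Q ?m b' (Q (b ?m))" "P_grp ?m b' \<subseteq> R"
    using frame_exists[OF w] frame_conj_into_Syl[OF _ assms(10)] by blast
  have "odd ?m" using assms(4) by simp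
  then have "\<pi> (r (b ?m)) \<notin> carrier H" by (rule reflection_notin_H)
  note refl = reflection_noninner[OF b(1) b'(1) assms(10) b(2) b'(2) this]
  interpret L: linking H R
    by unfold_locales (use finite_H assms(10) in auto)
  let ?a = "reflection_aut scale Q (b ?m)"
  have a: "?a \<in> auto H" using reflection_aut_auto[OF w] .
  have "induced_link H R ?a \<in> carrier (Aut_link H R)"
    using L.induced_in_Aut_link[OF a refl(1)] .
  moreover have "anisotropic Q (b ?m)"
    using w by (simp add: anisotropic_def)
  moreover have "induced_by_reflection scale Q R (b ?m) (induced_link H R ?a)"
    using L.kappa_Out_class[OF a refl(1)] by (simp add: induced_by_reflection_def)
  ultimately show ?thesis
    using refl by blast
qed

end
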